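(* Let $\mathcal{M}$ be a von Neumann algebra with center $\mathcal{Z}(\mathcal{M})$. (1) If $\operatorname{dec}(\mathcal{M}) > \aleph_0 \cdot \operatorname{gen}(\mathcal{M})$, then $\operatorname{dec}(\mathcal{M}) = \operatorname{dec}(\mathcal{Z}(\mathcal{M}))$. (2) $\aleph_0 \cdot \chi_r(\mathcal{M}) = \aleph_0 \cdot \operatorname{dec}(\mathcal{Z}(\mathcal{M})) \cdot \operatorname{gen}(\mathcal{M})$. (3) If $\mathcal{M}$ has $\sigma$-finite center, then $\chi_r(\mathcal{M}) \leq \aleph_0 \cdot \operatorname{gen}(\mathcal{M})$, with equality when $\mathcal{M}$ is infinite-dimensional. (4) $\mathcal{M}$ can be written as a direct sum of von Neumann algebras in which each summand $\mathcal{M}_i$ is either a matrix algebra $\mathbb{M}_n$ for some (finite) $n$ or satisfies $\chi_r(\mathcal{M}_i) = \aleph_0 \cdot \operatorname{gen}(\mathcal{M}_i)$.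
   Context: Von Neumann algebras are nonzero. A subset $S \subseteq \mathcal{M}$ generates a von Neumann algebra $\mathcal{M}$ if $\mathcal{M}$ is the smallest von Neumann algebra (with the same unit) containing $S$. For a von Neumann algebra $\mathcal{M}$: - $\operatorname{gen}(\mathcal{M})$ is the minimal cardinality of a generating set, with the convention $\operatorname{gen}(\mathbb{C}) = 1$ (instead of $0$); - $\chi_r(\mathcal{M})$ is the minimal dimension of a Hilbert space on which $\mathcal{M}$ acts faithfully and normally; - $\operatorname{dec}(\mathcal{M})$ is the maximal cardinality of a set of pairwise orthogonal nonzero projections in $\mathcal{M}$ (the supremum is known to be attained). $\mathcal{M}$ is $\sigma$-finite if $\operatorname{dec}(\mathcal{M}) \leq \aleph_0$. Direct sums are $\ell^\infty$-direct sums (norm-bounded families), and $\mathbb{M}_n$ is the algebra of $n \times n$ complex matrices. *)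

theory Defs
  imports
    "HOL-Analysis.Analysis"
    "HOL-Algebra.Module"
    "Jordan_Normal_Form.Schur_Decomposition"
begin

unbundle cardinal_syntax


section \<open>Complex Hilbert spaces\<close>

class complex_vector = real_vector +
  fixes scaleC :: "complex \<Rightarrow> 'a \<Rightarrow> 'a"  (infixr \<open>*\<^sub>C\<close> 75)
  assumes scaleC_add_right: "c *\<^sub>C (x + y) = c *\<^sub>C x + c *\<^sub>C y"
    and scaleC_add_left: "(c + d) *\<^sub>C x = c *\<^sub>C x + d *\<^sub>C x"
    and scaleC_scaleC: "c *\<^sub>C d *\<^sub>C x = (c * d) *\<^sub>C x"
    and scaleC_of_real: "complex_of_real r *\<^sub>C x = r *\<^sub>R x"

lemma scaleC_one [simp]: "1 *\<^sub>C x = (x :: 'a::complex_vector)"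
  using scaleC_of_real[of 1 x] by simp

global_interpretation complex_vector:
  vector_space "scaleC :: complex \<Rightarrow> 'a \<Rightarrow> 'a::complex_vector"
  by unfold_locales (simp_all add: scaleC_add_right scaleC_add_left scaleC_scaleC)

text \<open>
  The inner product is linear in its first argument. Norm, distance and topology are those of
  the underlying real inner product space, whose inner product is the real part of
  \<open>cinner\<close>; positive definiteness of \<open>cinner\<close> is inherited from there, since
  \<open>cinner x x\<close> is real by conjugate symmetry.
\<close>
class complex_hilbert_space = complex_vector + real_inner + complete_space +
  fixes cinner :: "'a \<Rightarrow> 'a \<Rightarrow> complex"
  assumes cinner_commute: "cinner x y = cnj (cinner y x)"
    and cinner_add_left: "cinner (x + y) z = cinner x z + cinner y z"
    and cinner_scaleC_left: "cinner (c *\<^sub>C x) y = c * cinner x y"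
    and inner_eq_Re_cinner: "inner x y = Re (cinner x y)"

lemma cinner_same: "cinner x x = complex_of_real ((norm x)\<^sup>2)"
  for x :: "'a::complex_hilbert_space"
proof -
  have "Im (cinner x x) = 0"
    using arg_cong[OF cinner_commute[of x x], of Im] by simp
  then show ?thesis
    by (simp add: complex_eq_iff power2_norm_eq_inner inner_eq_Re_cinner)
qed

lemma norm_scaleC: "norm (c *\<^sub>C x) = cmod c * norm x"
  for x :: "'a::complex_hilbert_space"
proof -
  have "cinner (c *\<^sub>C x) (c *\<^sub>C x) = c * cnj c * cinner x x"
    by (metis cinner_commute cinner_scaleC_left complex_cnj_mult mult.assoc)
  also have "\<dots> = complex_of_real ((cmod c * norm x)\<^sup>2)"
    by (simp add: cinner_same complex_norm_square power_mult_distrib flip: of_real_power)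
  finally have "(norm (c *\<^sub>C x))\<^sup>2 = (cmod c * norm x)\<^sup>2"
    unfolding cinner_same of_real_eq_iff .
  then show ?thesis
    by (simp add: power2_eq_iff_nonneg)
qed

lemma bounded_linear_scaleC: "bounded_linear (\<lambda>x. c *\<^sub>C (x :: 'a::complex_hilbert_space))"
proof (rule bounded_linear_intro)
  show "c *\<^sub>C (r *\<^sub>R x) = r *\<^sub>R c *\<^sub>C x" for r and x :: 'a
    by (simp add: scaleC_scaleC mult.commute flip: scaleC_of_real)
  show "norm (c *\<^sub>C x) \<le> norm x * cmod c" for x :: 'a
    by (simp add: norm_scaleC mult.commute)
qed (rule scaleC_add_right)

instantiation blinfun :: (real_normed_vector, complex_hilbert_space) complex_vector
begin

lift_definition scaleC_blinfun :: "complex \<Rightarrow> 'a \<Rightarrow>\<^sub>L 'b \<Rightarrow> 'a \<Rightarrow>\<^sub>L 'b"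
  is "\<lambda>c f x. c *\<^sub>C f x"
  by (rule bounded_linear_compose[OF bounded_linear_scaleC])

instance
  by standard
    (transfer; simp add: fun_eq_iff scaleC_add_right scaleC_add_left scaleC_scaleC scaleC_of_real)+

end

definition closed_csubspace :: "'h::complex_hilbert_space set \<Rightarrow> bool" where
  "closed_csubspace K \<longleftrightarrow> complex_vector.subspace K \<and> closed K"

definition orthonormal_basis :: "'h::complex_hilbert_space set \<Rightarrow> 'h set \<Rightarrow> bool" where
  "orthonormal_basis K B \<longleftrightarrow>
     (\<forall>x\<in>B. \<forall>y\<in>B. cinner x y = (if x = y then 1 else 0)) \<and>
     closure (complex_vector.span B) = K"

text \<open>All orthonormal bases of \<open>K\<close> have the same cardinality.\<close>
definition hilbert_dim :: "'h::complex_hilbert_space set \<Rightarrow> 'h rel" where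
  "hilbert_dim K = |SOME B. orthonormal_basis K B|"


section \<open>Bounded operators\<close>

type_synonym 'h oper = "'h \<Rightarrow>\<^sub>L 'h"

text \<open>
  Since a Hilbert space cannot range over types inside a formula, Hilbert spaces are closed
  complex subspaces \<open>K\<close> of an ambient one. A bounded operator on \<open>K\<close> is identified with its
  extension by \<open>0\<close> on the orthogonal complement of \<open>K\<close>; this preserves the algebraic operations,
  the adjoint and the operator norm. The identity of \<open>K\<close> becomes the orthogonal projection onto
  \<open>K\<close>. The whole ambient space is the case \<open>K = UNIV\<close>.
\<close>
definition bounded_ops :: "'h::complex_hilbert_space set \<Rightarrow> 'h oper set" where
  "bounded_ops K = {a :: 'h oper. (\<forall>c x. a (c *\<^sub>C x) = c *\<^sub>C a x) \<and> (\<forall>x. a x \<in> K) \<and>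
                       (\<forall>x. (\<forall>y\<in>K. cinner x y = 0) \<longrightarrow> a x = 0)}"

definition id_on :: "'h::complex_hilbert_space set \<Rightarrow> 'h oper" where
  "id_on K = (THE p :: 'h oper. p \<in> bounded_ops K \<and> (\<forall>x\<in>K. p x = x))"

definition adj :: "'h::complex_hilbert_space oper \<Rightarrow> 'h oper" where
  "adj a = (THE b :: 'h oper. \<forall>x y. cinner (a x) y = cinner x (b y))"

definition self_adjoint_part :: "'h::complex_hilbert_space oper set \<Rightarrow> 'h oper set" where
  "self_adjoint_part M = {a \<in> M. adj a = a}"

text \<open>Only used for self-adjoint operators, for which \<open>cinner (a x) x\<close> is real.\<close>
definition op_le :: "'h::complex_hilbert_space oper \<Rightarrow> 'h oper \<Rightarrow> bool" where
  "op_le a b \<longleftrightarrow> (\<forall>x. 0 \<le> Re (cinner ((b - a) x) x))"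

definition op_lub :: "'h::complex_hilbert_space oper set \<Rightarrow> 'h oper set \<Rightarrow> 'h oper \<Rightarrow> bool" where
  "op_lub M D s \<longleftrightarrow> s \<in> self_adjoint_part M \<and> (\<forall>d\<in>D. op_le d s) \<and>
     (\<forall>u\<in>self_adjoint_part M. (\<forall>d\<in>D. op_le d u) \<longrightarrow> op_le s u)"


section \<open>Unital *-algebras\<close>

record 'a star_algebra = "(complex, 'a) module" +
  star :: "'a \<Rightarrow> 'a"

definition star_hom ::
    "('a, 'm) star_algebra_scheme \<Rightarrow> ('b, 'n) star_algebra_scheme \<Rightarrow> ('a \<Rightarrow> 'b) set" where
  "star_hom A B = {f \<in> Ring.ring_hom A B.
     (\<forall>c. \<forall>x\<in>carrier A. f (c \<odot>\<^bsub>A\<^esub> x) = c \<odot>\<^bsub>B\<^esub> f x) \<and>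
     (\<forall>x\<in>carrier A. f (star A x) = star B (f x))}"

definition star_isomorphic ::
    "('a, 'm) star_algebra_scheme \<Rightarrow> ('b, 'n) star_algebra_scheme \<Rightarrow> bool" where
  "star_isomorphic A B \<longleftrightarrow> (\<exists>f\<in>star_hom A B. bij_betw f (carrier A) (carrier B))"

definition oper_algebra ::
    "'h::complex_hilbert_space set \<Rightarrow> 'h oper set \<Rightarrow> 'h oper star_algebra" where
  "oper_algebra K M =
     \<lparr>carrier = M, mult = (\<lambda>a b. a o\<^sub>L b), one = id_on K, zero = 0, add = (+),
      smult = scaleC, star = adj\<rparr>"

definition matrix_algebra :: "nat \<Rightarrow> complex mat star_algebra" where
  "matrix_algebra n =
     \<lparr>carrier = carrier_mat n n, mult = (*), one = 1\<^sub>m n, zero = 0\<^sub>m n n, add = (+),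
      smult = (\<cdot>\<^sub>m), star = mat_adjoint\<rparr>"

definition linf_direct_sum ::
    "'i set \<Rightarrow> ('i \<Rightarrow> 'h::complex_hilbert_space set) \<Rightarrow> ('i \<Rightarrow> 'h oper set) \<Rightarrow>
     ('i \<Rightarrow> 'h oper) star_algebra" where
  "linf_direct_sum I K M =
     \<lparr>carrier = {x \<in> Pi\<^sub>E I M. \<exists>C. \<forall>i\<in>I. norm (x i) \<le> C},
      mult = (\<lambda>x y. \<lambda>i\<in>I. x i o\<^sub>L y i), one = (\<lambda>i\<in>I. id_on (K i)),
      zero = (\<lambda>i\<in>I. 0), add = (\<lambda>x y. \<lambda>i\<in>I. x i + y i),
      smult = (\<lambda>c x. \<lambda>i\<in>I. c *\<^sub>C x i), star = (\<lambda>x. \<lambda>i\<in>I. adj (x i))\<rparr>"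


section \<open>Von Neumann algebras\<close>

definition commutant ::
    "'h::complex_hilbert_space set \<Rightarrow> 'h oper set \<Rightarrow> 'h oper set" where
  "commutant K S = {b \<in> bounded_ops K. \<forall>a\<in>S. a o\<^sub>L b = b o\<^sub>L a}"

text \<open>A nonzero von Neumann algebra acting on \<open>K\<close>, with unit the identity of \<open>K\<close>.\<close>
definition von_neumann_algebra ::
    "'h::complex_hilbert_space set \<Rightarrow> 'h oper set \<Rightarrow> bool" where
  "von_neumann_algebra K M \<longleftrightarrow>
     closed_csubspace K \<and> K \<noteq> {0} \<and> M \<subseteq> bounded_ops K \<and> (\<forall>a\<in>M. adj a \<in> M) \<and>
     commutant K (commutant K M) = M"

definition center :: "'h::complex_hilbert_space oper set \<Rightarrow> 'h oper set" where
  "center M = {a \<in> M. \<forall>b\<in>M. a o\<^sub>L b = b o\<^sub>L a}"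

definition finite_dimensional :: "'h::complex_hilbert_space oper set \<Rightarrow> bool" where
  "finite_dimensional M \<longleftrightarrow> (\<exists>B. finite B \<and> complex_vector.span B = M)"

text \<open>
  Faithful normal unital representations of \<open>M\<close> on a Hilbert space \<open>L\<close>, possibly inside another
  ambient space. Normality is preservation of suprema of bounded increasing nets of self-adjoint
  elements.
\<close>
definition normal_map ::
    "'h::complex_hilbert_space oper set \<Rightarrow> 'k::complex_hilbert_space set \<Rightarrow>
     ('h oper \<Rightarrow> 'k oper) \<Rightarrow> bool" where
  "normal_map M L \<pi> \<longleftrightarrow>
     (\<forall>D s. D \<subseteq> self_adjoint_part M \<and> D \<noteq> {} \<and>
        (\<forall>a\<in>D. \<forall>b\<in>D. \<exists>c\<in>D. op_le a c \<and> op_le b c) \<and> op_lub M D s \<longrightarrow>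
        op_lub (bounded_ops L) (\<pi> ` D) (\<pi> s))"

definition faithful_normal_rep ::
    "'h::complex_hilbert_space set \<Rightarrow> 'h oper set \<Rightarrow> 'k::complex_hilbert_space set \<Rightarrow>
     ('h oper \<Rightarrow> 'k oper) \<Rightarrow> bool" where
  "faithful_normal_rep K M L \<pi> \<longleftrightarrow>
     closed_csubspace L \<and>
     \<pi> \<in> star_hom (oper_algebra K M) (oper_algebra L (bounded_ops L)) \<and>
     inj_on \<pi> M \<and> normal_map M L \<pi>"

definition generates ::
    "'h::complex_hilbert_space set \<Rightarrow> 'h oper set \<Rightarrow> 'h oper set \<Rightarrow> bool" where
  "generates K M S \<longleftrightarrow>
     S \<subseteq> M \<and> von_neumann_algebra K M \<and>
     (\<forall>N. von_neumann_algebra K N \<and> S \<subseteq> N \<longrightarrow> M \<subseteq> N)"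


section \<open>Cardinal invariants\<close>

text \<open>
  Cardinals are cardinal orders up to \<open>=o\<close>. The minimal (maximal) member of a family of cardinals
  is unique up to \<open>=o\<close>.
\<close>
definition min_card :: "'a rel set \<Rightarrow> 'a rel" where
  "min_card R = (SOME r. r \<in> R \<and> (\<forall>s\<in>R. r \<le>o s))"

definition max_card :: "'a rel set \<Rightarrow> 'a rel" where
  "max_card R = (SOME r. r \<in> R \<and> (\<forall>s\<in>R. s \<le>o r))"

text \<open>The first case is the convention that the scalars have one generator instead of none.\<close>
definition gen :: "'h::complex_hilbert_space set \<Rightarrow> 'h oper set \<Rightarrow> 'h oper rel" where
  "gen K M = (if M = range (\<lambda>c. c *\<^sub>C id_on K) then |{id_on K}|
              else min_card {|S| |S. generates K M S})"

text \<open>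
  Letting \<open>L\<close> range over the closed subspaces of the ambient space of \<open>K\<close> is no restriction: the
  inclusion of \<open>M\<close> is a faithful normal representation on \<open>K\<close>, and any Hilbert space of dimension
  at most that of \<open>K\<close> is unitarily equivalent to a closed subspace of \<open>K\<close>.
\<close>
definition chi_r :: "'h::complex_hilbert_space set \<Rightarrow> 'h oper set \<Rightarrow> 'h rel" where
  "chi_r K M = min_card {hilbert_dim L |(L :: 'h set) \<pi>. faithful_normal_rep K M L \<pi>}"

definition orthogonal_projections :: "'h::complex_hilbert_space oper set \<Rightarrow> bool" where
  "orthogonal_projections P \<longleftrightarrow>
     (\<forall>p\<in>P. p o\<^sub>L p = p \<and> adj p = p \<and> p \<noteq> 0) \<and> (\<forall>p\<in>P. \<forall>q\<in>P. p \<noteq> q \<longrightarrow> p o\<^sub>L q = 0)"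

definition dec :: "'h::complex_hilbert_space oper set \<Rightarrow> 'h oper rel" where
  "dec M = max_card {|P| |P. P \<subseteq> M \<and> orthogonal_projections P}"

definition sigma_finite :: "'h::complex_hilbert_space oper set \<Rightarrow> bool" where
  "sigma_finite M \<longleftrightarrow> dec M \<le>o natLeq"

end

theory Submission
  imports Defs
begin

text \<open>
  The difficult inequality is \<open>gen M \<le> \<aleph>\<^sub>0 \<cdot> dim L\<close> for an arbitrary faithful normal representation \<open>\<pi>\<close> on \<open>L\<close>.
  Comparing a vector functional on \<open>K\<close> with one pulled back from \<open>L\<close>, normality yields below every
  nonzero projection of \<open>M\<close> a vector \<open>\<eta> \<noteq> 0\<close> of \<open>K\<close> and a vector \<open>\<xi>\<close> such that \<open>\<parallel>a \<eta>\<parallel> \<le> \<parallel>\<pi> a \<xi>\<parallel>\<close> for all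
  \<open>a \<in> M\<close>. A maximal family of such \<open>\<eta>\<close> with pairwise orthogonal subspaces \<open>[M' \<eta>]\<close> has at most \<open>\<aleph>\<^sub>0 \<cdot> dim L\<close>
  members by Bessel's inequality, and the spaces \<open>M \<eta>\<close> inherit dense subsets of that size from \<open>\<pi> M \<xi>\<close>.
  If \<open>Y\<close> is dense in their union, operators \<open>s \<in> M\<close> for which the pairs \<open>(s y, s* y')\<close> approximate all
  \<open>(x y, x* y')\<close>, for each \<open>y\<close> and \<open>y'\<close> in \<open>Y\<close>, have commutant \<open>M'\<close> and hence generate \<open>M\<close>.

  Conversely, if the cyclic subspaces of vectors \<open>x\<^sub>i\<close> under the commutant of the center decompose \<open>K\<close>,
  then \<open>M\<close> acts faithfully on the closed span of the \<open>M x\<^sub>i\<close>, which words in a generating set span. Since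
  also \<open>dec M \<le> \<aleph>\<^sub>0 \<cdot> dim L\<close>, this gives (2), and (1) and (3) are consequences. For (4), the corners
  of the central projections onto such cyclic subspaces have \<open>\<sigma>\<close>-finite center; where the corner is
  finite-dimensional, the projection is refined to minimal central ones, whose corners have matrix units.
\<close>

section \<open>Inner products, projections and adjoints\<close>

text \<open>The obstacle to the difficult inequality is that a small \<open>L\<close> says nothing
  directly about the vectors of \<open>K\<close>. The comparison of norms is the bridge: applied to
  \<open>t - a\<close>, it makes \<open>\<pi> a \<xi> \<mapsto> a \<eta>\<close> well defined and
  contracting, so approximation in \<open>L\<close> is carried to \<open>K\<close>, and no structure
  of the image \<open>\<pi> M\<close> is involved.

  Pairs are approximated because commuting with \<open>x\<close> has to be tested by a condition
  that is closed in the data. For \<open>b\<close> in the commutant of the generators and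
  \<open>c\<close>, \<open>a\<close> in \<open>M'\<close>, the equation \<open>\<langle>x b c y, a
  y'\<rangle> = \<langle>b x c y, a y'\<rangle>\<close> becomes \<open>\<langle>b c y, a x*
  y'\<rangle> = \<langle>b c x y, a y'\<rangle>\<close>, which sees \<open>x\<close> only through
  \<open>x y\<close> and \<open>x* y'\<close>.

  The commutant of the center replaces \<open>M'\<close> in the converse because its cyclic
  projections are central, which is where \<open>dec\<close> of the center enters, and because the
  vectors killed by \<open>a M\<close>, for \<open>a\<close> in \<open>M\<close>, form a subspace
  with central projection: once it contains the \<open>x\<^sub>i\<close>, it is all of
  \<open>K\<close>.

  In (4) finite-dimensional corners are treated apart: there \<open>\<chi>\<^sub>r\<close> is finite
  while \<open>\<aleph>\<^sub>0 \<cdot> gen\<close> is not.\<close>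

lemma cinner_scaleC_right: "cinner x (c *\<^sub>C y) = cnj c * cinner x y"
  for x y :: "'h::complex_hilbert_space"
  by (metis cinner_commute cinner_scaleC_left complex_cnj_mult)

lemma cinner_add_right: "cinner x (y + z) = cinner x y + cinner x z"
  for x y z :: "'h::complex_hilbert_space"
  by (metis cinner_commute cinner_add_left complex_cnj_add)

text \<open>A phase \<open>c\<close> turns the complex inner product into a nonnegative real one, so
  the real Cauchy-Schwarz inequality applies.\<close>

lemma cmod_cinner_le: "cmod (cinner x y) \<le> norm x * norm y"
  for x y :: "'h::complex_hilbert_space"
proof (cases "cinner x y = 0")
  case False
  define c where "c = cnj (cinner x y) / cmod (cinner x y)"
  have c: "cmod c = 1"
    using False by (simp add: c_def norm_divide)
  have "cinner (c *\<^sub>C x) y = (cnj (cinner x y) * cinner x y) / cmod (cinner x y)"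
    by (simp add: cinner_scaleC_left c_def)
  also have "\<dots> = cmod (cinner x y)"
    using False by (simp add: mult.commute[of "cnj _"] power2_eq_square flip: complex_norm_square)
  finally have "cinner (c *\<^sub>C x) y = cmod (cinner x y)" .
  then have "cmod (cinner x y) = inner (c *\<^sub>C x) y"
    by (simp add: inner_eq_Re_cinner)
  also have "\<dots> \<le> norm (c *\<^sub>C x) * norm y"
    by (rule norm_cauchy_schwarz)
  finally show ?thesis
    by (simp add: norm_scaleC c)
qed simp

global_interpretation cinner: bounded_bilinear "cinner :: 'h::complex_hilbert_space \<Rightarrow> 'h \<Rightarrow> complex"
proof
  show "cinner (r *\<^sub>R a) b = r *\<^sub>R cinner a b" for r and a b :: 'h
    by (simp add: cinner_scaleC_left scaleR_conv_of_real flip: scaleC_of_real)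
  show "cinner a (r *\<^sub>R b) = r *\<^sub>R cinner a b" for r and a b :: 'h
    by (simp add: cinner_scaleC_right scaleR_conv_of_real flip: scaleC_of_real)
  show "\<exists>K. \<forall>a b :: 'h. cmod (cinner a b) \<le> norm a * norm b * K"
    by (rule exI[of _ 1]) (simp add: cmod_cinner_le)
qed (auto simp: cinner_add_left cinner_add_right)

lemma cinner_eq_zero_commute: "cinner x y = 0 \<longleftrightarrow> cinner y x = 0"
  for x y :: "'h::complex_hilbert_space"
  by (metis cinner_commute complex_cnj_zero)

lemma cinner_same_eq_zero [simp]: "cinner x x = 0 \<longleftrightarrow> x = 0"
  for x :: "'h::complex_hilbert_space"
  by (simp add: cinner_same)

lemma Re_cinner_same: "Re (cinner x x) = (norm x)\<^sup>2"
  for x :: "'h::complex_hilbert_space"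
  by (simp add: cinner_same)

lemma cinner_left_eqI: "(\<And>z. cinner x z = cinner y z) \<Longrightarrow> x = y"
  for x y :: "'h::complex_hilbert_space"
  using cinner_same_eq_zero[of "x - y"] by (simp add: cinner.diff_left)

lemma cinner_right_eqI: "(\<And>z. cinner z x = cinner z y) \<Longrightarrow> x = y"
  for x y :: "'h::complex_hilbert_space"
  by (metis cinner_commute cinner_left_eqI)

lemma norm_add_orthogonal: "cinner x y = 0 \<Longrightarrow> (norm (x + y))\<^sup>2 = (norm x)\<^sup>2 + (norm y)\<^sup>2"
  for x y :: "'h::complex_hilbert_space"
  using cinner_eq_zero_commute[of x y]
  by (simp flip: Re_cinner_same add: cinner_add_left cinner_add_right)

lemma tendsto_scaleC [tendsto_intros]:
  "(f \<longlongrightarrow> l) F \<Longrightarrow> ((\<lambda>x. c *\<^sub>C f x) \<longlongrightarrow> c *\<^sub>C (l :: 'h::complex_hilbert_space)) F"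
  by (rule bounded_linear.tendsto[OF bounded_linear_scaleC])

subsection \<open>Closed subspaces\<close>

lemma closed_csubspaceI:
  assumes "0 \<in> V" "\<And>x y. x \<in> V \<Longrightarrow> y \<in> V \<Longrightarrow> x + y \<in> V" "\<And>c x. x \<in> V \<Longrightarrow> c *\<^sub>C x \<in> V" "closed V"
  shows "closed_csubspace V"
  using assms by (simp add: closed_csubspace_def complex_vector.subspace_def)

lemma
  assumes "closed_csubspace V"
  shows csub_zero: "0 \<in> V"
    and csub_add: "x \<in> V \<Longrightarrow> y \<in> V \<Longrightarrow> x + y \<in> V"
    and csub_diff: "x \<in> V \<Longrightarrow> y \<in> V \<Longrightarrow> x - y \<in> V"
    and csub_scale: "x \<in> V \<Longrightarrow> c *\<^sub>C x \<in> V"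
    and csub_scaleR: "x \<in> V \<Longrightarrow> r *\<^sub>R x \<in> V"
    and csub_closed: "closed V"
  using assms
proof -
  have V: "complex_vector.subspace V" "closed V"
    using assms by (auto simp: closed_csubspace_def)
  show "0 \<in> V" "x \<in> V \<Longrightarrow> y \<in> V \<Longrightarrow> x + y \<in> V" "x \<in> V \<Longrightarrow> y \<in> V \<Longrightarrow> x - y \<in> V"
    "x \<in> V \<Longrightarrow> c *\<^sub>C x \<in> V" "closed V"
    by (fact V complex_vector.subspace_0[OF V(1)] complex_vector.subspace_add[OF V(1)]
        complex_vector.subspace_diff[OF V(1)] complex_vector.subspace_scale[OF V(1)])+
  show "x \<in> V \<Longrightarrow> r *\<^sub>R x \<in> V"
    unfolding scaleC_of_real[symmetric] by (rule complex_vector.subspace_scale[OF V(1)])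
qed

lemma closed_csubspace_Inter:
  "(\<And>V. V \<in> \<V> \<Longrightarrow> closed_csubspace V) \<Longrightarrow> closed_csubspace (\<Inter>\<V>)"
  by (rule closed_csubspaceI) (simp_all add: csub_zero csub_add csub_scale csub_closed closed_Inter)

lemma closed_csubspace_Int:
  "closed_csubspace V \<Longrightarrow> closed_csubspace W \<Longrightarrow> closed_csubspace (V \<inter> W)"
  by (rule closed_csubspaceI) (auto simp: csub_zero csub_add csub_scale csub_closed)

definition orth_compl :: "'h::complex_hilbert_space set \<Rightarrow> 'h set" where
  "orth_compl S = {x. \<forall>y\<in>S. cinner x y = 0}"

lemma closed_csubspace_orth_compl: "closed_csubspace (orth_compl S)"
proof (rule closed_csubspaceI)
  have "closed (\<Inter>y\<in>S. {x. cinner x y = 0})"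
    by (intro closed_INT ballI closed_Collect_eq)
      (auto intro!: bounded_linear.continuous_on[OF cinner.bounded_linear_left] continuous_intros)
  then show "closed (orth_compl S)"
    by (simp add: orth_compl_def Collect_ball_eq)
qed (auto simp: orth_compl_def cinner_add_left cinner_scaleC_left cinner.zero_left)

definition ccspan :: "'h::complex_hilbert_space set \<Rightarrow> 'h set" where
  "ccspan S = closure (complex_vector.span S)"

lemma closed_csubspace_ccspan: "closed_csubspace (ccspan S)"
proof (rule closed_csubspaceI)
  show "0 \<in> ccspan S"
    using closure_subset complex_vector.span_zero by (fastforce simp: ccspan_def)
  show "x + y \<in> ccspan S" if x: "x \<in> ccspan S" and y: "y \<in> ccspan S" for x y
  proof -
    obtain f where f: "\<forall>n. f n \<in> complex_vector.span S" "f \<longlonglongrightarrow> x"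
      using x unfolding ccspan_def closure_sequential by blast
    obtain g where g: "\<forall>n. g n \<in> complex_vector.span S" "g \<longlonglongrightarrow> y"
      using y unfolding ccspan_def closure_sequential by blast
    note fg = f g
    have "(\<lambda>n. f n + g n) \<longlonglongrightarrow> x + y"
      by (intro tendsto_intros fg)
    moreover have "\<forall>n. f n + g n \<in> complex_vector.span S"
      using fg complex_vector.span_add by blast
    ultimately show ?thesis
      unfolding ccspan_def closure_sequential by (intro exI[of _ "\<lambda>n. f n + g n"]) simp
  qed
  show "c *\<^sub>C x \<in> ccspan S" if x: "x \<in> ccspan S" for c x
  proof -
    obtain f where f: "\<forall>n. f n \<in> complex_vector.span S" "f \<longlonglongrightarrow> x"
      using x unfolding ccspan_def closure_sequential by blast
    have "(\<lambda>n. c *\<^sub>C f n) \<longlonglongrightarrow> c *\<^sub>C x"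
      by (intro tendsto_intros f)
    moreover have "\<forall>n. c *\<^sub>C f n \<in> complex_vector.span S"
      using f complex_vector.span_scale by blast
    ultimately show ?thesis
      unfolding ccspan_def closure_sequential by (intro exI[of _ "\<lambda>n. c *\<^sub>C f n"]) simp
  qed
qed (simp add: ccspan_def)

lemma ccspan_superset: "S \<subseteq> ccspan S"
  unfolding ccspan_def using complex_vector.span_superset closure_subset by blast

lemma ccspan_minimal: "S \<subseteq> V \<Longrightarrow> closed_csubspace V \<Longrightarrow> ccspan S \<subseteq> V"
  unfolding ccspan_def closed_csubspace_def by (simp add: closure_minimal complex_vector.span_minimal)

lemma ccspan_mono: "S \<subseteq> T \<Longrightarrow> ccspan S \<subseteq> ccspan T"
  by (meson ccspan_minimal ccspan_superset closed_csubspace_ccspan order_trans)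

lemma orth_compl_ccspan [simp]: "orth_compl (ccspan S) = orth_compl S"
proof
  show "orth_compl (ccspan S) \<subseteq> orth_compl S"
    using ccspan_superset by (auto simp: orth_compl_def)
  show "orth_compl S \<subseteq> orth_compl (ccspan S)"
  proof
    fix x assume "x \<in> orth_compl S"
    then have "S \<subseteq> orth_compl {x}"
      by (auto simp: orth_compl_def cinner_eq_zero_commute)
    then have "ccspan S \<subseteq> orth_compl {x}"
      by (rule ccspan_minimal[OF _ closed_csubspace_orth_compl])
    then show "x \<in> orth_compl (ccspan S)"
      by (auto simp: orth_compl_def cinner_eq_zero_commute)
  qed
qed

subsection \<open>Orthogonal projections\<close>

text \<open>Parallelogram law arranged around the midpoint: for \<open>k\<close> and
  \<open>l\<close> in a subspace the last norm is at least the distance from \<open>x\<close> to it,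
  so nearly closest points are close to each other.\<close>

lemma parallelogram_midpoint:
  "(norm (k - l))\<^sup>2 = 2 * (norm (x - k))\<^sup>2 + 2 * (norm (x - l))\<^sup>2 - 4 * (norm (x - (1/2) *\<^sub>R (k + l)))\<^sup>2"
  for x k l :: "'h::real_inner"
  unfolding power2_norm_eq_inner
  by (simp add: inner_add_left inner_add_right inner_diff_left inner_diff_right inner_commute algebra_simps)

lemma closest_point_ex:
  fixes x :: "'h::complex_hilbert_space"
  assumes K: "closed_csubspace K"
  shows "\<exists>k\<in>K. \<forall>y\<in>K. norm (x - k) \<le> norm (x - y)"
proof -
  define d where "d = (INF k\<in>K. (norm (x - k))\<^sup>2)"
  have bdd: "bdd_below ((\<lambda>k. (norm (x - k))\<^sup>2) ` K)"
    by (rule bdd_belowI2[of _ 0]) simp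
  have ne: "K \<noteq> {}"
    using csub_zero[OF K] by blast
  have d_le: "d \<le> (norm (x - k))\<^sup>2" if "k \<in> K" for k
    unfolding d_def by (rule cINF_lower[OF bdd that])
  have "\<exists>k\<in>K. (norm (x - k))\<^sup>2 < d + 1 / real (Suc n)" for n
    using cInf_lessD[of "(\<lambda>k. (norm (x - k))\<^sup>2) ` K" "d + 1 / real (Suc n)"] ne
    unfolding d_def[symmetric] by auto
  then obtain k where k: "\<And>n. k n \<in> K" "\<And>n. (norm (x - k n))\<^sup>2 < d + 1 / real (Suc n)"
    by metis
  have dist: "(dist (k n) (k m))\<^sup>2 \<le> 2 / real (Suc n) + 2 / real (Suc m)" for n m
    using d_le[OF csub_scaleR[OF K csub_add[OF K k(1)[of n] k(1)[of m]], of "1/2"]] k(2)[of n] k(2)[of m]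
    unfolding dist_norm parallelogram_midpoint[of "k n" "k m" x] by simp
  have "Cauchy k"
  proof (rule metric_CauchyI)
    fix e :: real assume e: "0 < e"
    obtain N where N: "4 / e\<^sup>2 < real N"
      using reals_Archimedean2 by blast
    show "\<exists>M. \<forall>m\<ge>M. \<forall>n\<ge>M. dist (k m) (k n) < e"
    proof (intro exI allI impI)
      fix m n assume mn: "m \<ge> N" "n \<ge> N"
      have pos: "0 < real N"
        using N e by (metis divide_pos_pos less_trans zero_less_numeral zero_less_power)
      have "2 / real (Suc m) \<le> 2 / real N" "2 / real (Suc n) \<le> 2 / real N"
        using mn pos by (auto intro!: divide_left_mono)
      then have "(dist (k m) (k n))\<^sup>2 \<le> 4 / real N"
        using dist[of m n] by simp
      also have "\<dots> < e\<^sup>2"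
        using N e pos by (simp add: field_simps)
      finally show "dist (k m) (k n) < e"
        using e by (simp add: power_less_imp_less_base)
    qed
  qed
  then obtain l where l: "k \<longlonglongrightarrow> l"
    using Cauchy_convergent convergent_def by blast
  have lK: "l \<in> K"
    using closed_sequentially[OF csub_closed[OF K] k(1) l] .
  have "(\<lambda>n. (norm (x - k n))\<^sup>2) \<longlonglongrightarrow> (norm (x - l))\<^sup>2"
    by (intro tendsto_intros l)
  moreover have "(\<lambda>n. d + 1 / real (Suc n)) \<longlonglongrightarrow> d + 0"
    by (intro tendsto_intros LIMSEQ_inverse_real_of_nat[unfolded inverse_eq_divide])
  ultimately have "(norm (x - l))\<^sup>2 \<le> d + 0"
    by (rule LIMSEQ_le) (use k(2) in \<open>auto intro: less_imp_le\<close>)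
  then have "norm (x - l) \<le> norm (x - y)" if "y \<in> K" for y
    using d_le[OF that] by (intro power2_le_imp_le[OF _ norm_ge_zero]) linarith
  with lK show ?thesis
    by blast
qed

lemma orthogonal_decomposition_ex:
  fixes x :: "'h::complex_hilbert_space"
  assumes K: "closed_csubspace K"
  shows "\<exists>k\<in>K. x - k \<in> orth_compl K"
proof -
  obtain k where k: "k \<in> K" and min: "\<And>y. y \<in> K \<Longrightarrow> norm (x - k) \<le> norm (x - y)"
    using closest_point_ex[OF K] by blast
  have re: "inner (x - k) y = 0" if y: "y \<in> K" for y
  proof (cases "y = 0")
    case False
    \<comment> \<open>\<open>t\<close> minimises the distance from \<open>x - k\<close> along the
      line through \<open>y\<close>.\<close>
    define t where "t = inner (x - k) y / (norm y)\<^sup>2"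
    have "norm (x - k) \<le> norm (x - (k + t *\<^sub>R y))"
      by (rule min) (intro csub_add[OF K] csub_scaleR[OF K] k y)
    then have "(norm (x - k))\<^sup>2 \<le> (norm ((x - k) - t *\<^sub>R y))\<^sup>2"
      by (simp add: diff_diff_eq)
    also have "\<dots> = (norm (x - k))\<^sup>2 - 2 * t * inner (x - k) y + t\<^sup>2 * (norm y)\<^sup>2"
      unfolding power2_norm_eq_inner
      by (simp add: inner_diff_left inner_diff_right inner_commute power2_eq_square algebra_simps)
    also have "\<dots> = (norm (x - k))\<^sup>2 - (inner (x - k) y)\<^sup>2 / (norm y)\<^sup>2"
      using False by (simp add: t_def power2_eq_square field_simps)
    finally have "(inner (x - k) y)\<^sup>2 / (norm y)\<^sup>2 \<le> 0"
      by simp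
    then show ?thesis
      using False by (simp add: divide_le_0_iff)
  qed simp
  \<comment> \<open>The real inner product is only the real part; replacing \<open>y\<close> by its
    multiple by \<open>\<i>\<close> gives the imaginary part.\<close>
  have "cinner (x - k) y = 0" if y: "y \<in> K" for y
    using re[OF y] re[OF csub_scale[OF K y, of \<i>]]
    by (simp add: inner_eq_Re_cinner cinner_scaleC_right complex_eq_iff)
  with k show ?thesis
    by (auto simp: orth_compl_def)
qed

lemma orthogonal_decomposition_unique:
  fixes x :: "'h::complex_hilbert_space"
  assumes K: "closed_csubspace K" and "k \<in> K" "x - k \<in> orth_compl K" "l \<in> K" "x - l \<in> orth_compl K"
  shows "k = l"
proof -
  have "(x - l) - (x - k) \<in> orth_compl K"
    by (rule csub_diff[OF closed_csubspace_orth_compl]) (use assms in auto)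
  moreover have "k - l \<in> K"
    by (rule csub_diff[OF K]) (use assms in auto)
  ultimately have "cinner (k - l) (k - l) = 0"
    by (simp add: orth_compl_def)
  then show ?thesis
    by simp
qed

text \<open>Elements of \<open>'h oper\<close> are only real-linear, so complex linearity is a
  separate hypothesis wherever adjoints occur.\<close>

definition clinear_op :: "'h::complex_hilbert_space oper \<Rightarrow> bool" where
  "clinear_op a \<longleftrightarrow> (\<forall>c x. a (c *\<^sub>C x) = c *\<^sub>C a x)"

lemma clinear_opD: "clinear_op a \<Longrightarrow> a (c *\<^sub>C x) = c *\<^sub>C a x"
  by (simp add: clinear_op_def)

lemma bounded_ops_iff:
  "a \<in> bounded_ops K \<longleftrightarrow> clinear_op a \<and> (\<forall>x. a x \<in> K) \<and> (\<forall>x\<in>orth_compl K. a x = 0)"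
  by (auto simp: bounded_ops_def clinear_op_def orth_compl_def)

text \<open>Justifies the definite description in \<open>id_on\<close>: members of
  \<open>bounded_ops K\<close> vanish on the orthogonal complement, so their values on
  \<open>K\<close> determine them.\<close>

lemma id_on_ex1:
  fixes K :: "'h::complex_hilbert_space set"
  assumes K: "closed_csubspace K"
  shows "\<exists>!p. p \<in> bounded_ops K \<and> (\<forall>x\<in>K. p x = x)"
proof -
  obtain p where p: "\<And>x. p x \<in> K" "\<And>x. x - p x \<in> orth_compl K"
    using orthogonal_decomposition_ex[OF K] by metis
  have eqI: "p x = k" if "k \<in> K" "x - k \<in> orth_compl K" for x k
    by (rule orthogonal_decomposition_unique[OF K p(1) p(2) that])
  note oc = closed_csubspace_orth_compl[of K]
  have add: "p (x + y) = p x + p y" for x y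
    using csub_add[OF oc p(2)[of x] p(2)[of y]]
    by (intro eqI csub_add[OF K] p(1)) (simp add: algebra_simps)
  have scale: "p (c *\<^sub>C x) = c *\<^sub>C p x" for c x
    using csub_scale[OF oc p(2)[of x], of c]
    by (intro eqI csub_scale[OF K] p(1)) (simp add: complex_vector.scale_right_diff_distrib)
  have norm: "norm (p x) \<le> norm x * 1" for x
  proof -
    have "cinner (p x) (x - p x) = 0"
      using p(1)[of x] p(2)[of x] by (simp add: orth_compl_def cinner_eq_zero_commute[of "p x"])
    from norm_add_orthogonal[OF this] have "(norm (p x))\<^sup>2 \<le> (norm x)\<^sup>2"
      by simp
    then show ?thesis
      by (simp add: power2_le_imp_le[OF _ norm_ge_zero])
  qed
  have bl: "bounded_linear p"
    by (rule bounded_linear_intro[OF add _ norm]) (simp add: scale flip: scaleC_of_real)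
  define q where "q = Blinfun p"
  have q: "blinfun_apply q = p"
    by (simp add: q_def bounded_linear_Blinfun_apply bl)
  have "q \<in> bounded_ops K \<and> (\<forall>x\<in>K. q x = x)"
    by (auto simp: bounded_ops_iff clinear_op_def q scale p(1) intro!: eqI csub_zero K oc)
  moreover have "r = q" if "r \<in> bounded_ops K \<and> (\<forall>x\<in>K. r x = x)" for r
  proof (rule blinfun_eqI)
    fix x
    have "r x = r (p x) + r (x - p x)"
      by (simp flip: blinfun.add_right)
    also have "\<dots> = p x"
      using that p by (simp add: bounded_ops_iff)
    finally show "r x = q x"
      by (simp add: q)
  qed
  ultimately show ?thesis
    by blast
qed

lemma
  assumes "closed_csubspace K"
  shows id_on_bounded_ops: "id_on K \<in> bounded_ops K"
    and id_on_id: "x \<in> K \<Longrightarrow> id_on K x = x"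
  using theI'[OF id_on_ex1[OF assms]] unfolding id_on_def by auto

lemma id_on_in: "closed_csubspace K \<Longrightarrow> id_on K x \<in> K"
  using id_on_bounded_ops by (auto simp: bounded_ops_iff)

lemma id_on_iff: "closed_csubspace K \<Longrightarrow> id_on K x = x \<longleftrightarrow> x \<in> K"
  by (metis id_on_id id_on_in)

lemma id_on_zero: "closed_csubspace K \<Longrightarrow> x \<in> orth_compl K \<Longrightarrow> id_on K x = 0"
  using id_on_bounded_ops by (auto simp: bounded_ops_iff)

lemma id_on_orth:
  assumes K: "closed_csubspace K"
  shows "x - id_on K x \<in> orth_compl K"
proof -
  obtain k where k: "k \<in> K" "x - k \<in> orth_compl K"
    using orthogonal_decomposition_ex[OF K] by blast
  have "id_on K x = id_on K k + id_on K (x - k)"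
    by (simp flip: blinfun.add_right)
  also have "\<dots> = k"
    using k by (simp add: id_on_id[OF K] id_on_zero[OF K])
  finally show ?thesis
    using k by simp
qed

lemma id_on_eqI: "closed_csubspace K \<Longrightarrow> k \<in> K \<Longrightarrow> x - k \<in> orth_compl K \<Longrightarrow> id_on K x = k"
  by (rule orthogonal_decomposition_unique[OF _ id_on_in id_on_orth])

lemma orth_compl_orth_compl:
  assumes K: "closed_csubspace K"
  shows "orth_compl (orth_compl K) = K"
proof
  show "K \<subseteq> orth_compl (orth_compl K)"
    by (auto simp: orth_compl_def cinner_eq_zero_commute)
  show "orth_compl (orth_compl K) \<subseteq> K"
  proof
    fix x assume x: "x \<in> orth_compl (orth_compl K)"
    have "id_on K x \<in> orth_compl (orth_compl K)"
      using id_on_in[OF K, of x] by (auto simp: orth_compl_def cinner_eq_zero_commute)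
    with x have "x - id_on K x \<in> orth_compl (orth_compl K)"
      by (rule csub_diff[OF closed_csubspace_orth_compl])
    with id_on_orth[OF K, of x] have "cinner (x - id_on K x) (x - id_on K x) = 0"
      by (simp add: orth_compl_def)
    then show "x \<in> K"
      using id_on_in[OF K, of x] by simp
  qed
qed

text \<open>When \<open>x\<close> in \<open>K\<close> is split along \<open>ccspan S\<close>, the
  orthogonal part is again in \<open>K\<close> and orthogonal to \<open>S\<close>. Totality thus
  becomes a question about orthogonal vectors.\<close>

lemma ccspan_eqI:
  assumes K: "closed_csubspace K" and S: "S \<subseteq> K" and "\<And>x. x \<in> K \<Longrightarrow> x \<in> orth_compl S \<Longrightarrow> x = 0"
  shows "ccspan S = K"
proof
  show "ccspan S \<subseteq> K"
    by (rule ccspan_minimal[OF S K])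
  show "K \<subseteq> ccspan S"
  proof
    fix x assume x: "x \<in> K"
    note c = closed_csubspace_ccspan[of S]
    have "x - id_on (ccspan S) x \<in> K"
      by (rule csub_diff[OF K x]) (use ccspan_minimal[OF S K] id_on_in[OF c] in blast)
    moreover have "x - id_on (ccspan S) x \<in> orth_compl S"
      using id_on_orth[OF c, of x] by simp
    ultimately have "x - id_on (ccspan S) x = 0"
      by (rule assms(3))
    then show "x \<in> ccspan S"
      using id_on_in[OF c, of x] by simp
  qed
qed

lemma orth_compl_Int_eq_zero: "x \<in> K \<Longrightarrow> x \<in> orth_compl K \<Longrightarrow> x = 0"
  by (auto simp: orth_compl_def)

subsection \<open>Adjoints\<close>

lemma closed_csubspace_vimage:
  assumes V: "closed_csubspace V" and f: "bounded_linear f" "\<And>c x. f (c *\<^sub>C x) = c *\<^sub>C f x"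
  shows "closed_csubspace {x. f x \<in> V}"
proof (rule closed_csubspaceI)
  interpret bounded_linear f by fact
  show "x + y \<in> {x. f x \<in> V}" if "x \<in> {x. f x \<in> V}" "y \<in> {x. f x \<in> V}" for x y
    using that by (auto simp: zero add csub_zero[OF V] csub_add[OF V])
  show "0 \<in> {x. f x \<in> V}"
    by (auto simp: zero csub_zero[OF V])
  show "closed {x. f x \<in> V}"
    using continuous_closed_preimage[OF continuous_on[OF continuous_on_id] closed_UNIV csub_closed[OF V]]
    by (simp add: vimage_def)
qed (auto simp: f(2) csub_scale[OF V])

lemma Riesz:
  fixes f :: "'h::complex_hilbert_space \<Rightarrow> complex"
  assumes f: "bounded_linear f" and fscale: "\<And>c x. f (c *\<^sub>C x) = c * f x"
  shows "\<exists>z. \<forall>x. f x = cinner x z"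
proof -
  interpret bounded_linear f by fact
  define N where "N = {x. f x = 0}"
  have N: "closed_csubspace N"
  proof (rule closed_csubspaceI)
    show "closed N"
      unfolding N_def by (intro closed_Collect_eq continuous_on continuous_on_id continuous_on_const)
  qed (auto simp: N_def zero add fscale)
  show ?thesis
  proof (cases "N = UNIV")
    case True
    then show ?thesis
      by (intro exI[of _ 0]) (auto simp: N_def cinner.zero_right)
  next
    case False
    then obtain y where y: "f y \<noteq> 0"
      by (auto simp: N_def)
    define e where "e = y - id_on N y"
    have fe: "f e \<noteq> 0"
      using id_on_in[OF N, of y] y by (simp add: e_def diff N_def)
    then have e0: "e \<noteq> 0"
      using zero by auto
    have eN: "e \<in> orth_compl N"
      unfolding e_def by (rule id_on_orth[OF N])
    have "f x = cinner x (cnj (f e / (norm e)\<^sup>2) *\<^sub>C e)" for x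
    proof -
      \<comment> \<open>The kernel has codimension one: this combination of \<open>x\<close> and
        \<open>e\<close> always lies in it.\<close>
      have "f e *\<^sub>C x - f x *\<^sub>C e \<in> N"
        by (simp add: N_def diff fscale)
      with eN have "cinner (f e *\<^sub>C x - f x *\<^sub>C e) e = 0"
        by (simp add: orth_compl_def cinner_eq_zero_commute[of _ e])
      then have "f e * cinner x e = f x * (norm e)\<^sup>2"
        by (simp add: cinner.diff_left cinner_scaleC_left cinner_same)
      then show ?thesis
        using e0 by (simp add: cinner_scaleC_right field_simps)
    qed
    then show ?thesis
      by blast
  qed
qed

lemma adjoint_ex:
  fixes a :: "'h::complex_hilbert_space oper"
  assumes a: "clinear_op a"
  shows "\<exists>b :: 'h oper. \<forall>x y. cinner (a x) y = cinner x (b y)"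
proof -
  have "\<exists>z. \<forall>x. cinner (a x) y = cinner x z" for y
  proof (rule Riesz)
    show "bounded_linear (\<lambda>x. cinner (a x) y)"
      by (rule bounded_linear_compose[OF cinner.bounded_linear_left blinfun.bounded_linear_right])
  qed (simp add: clinear_opD[OF a] cinner_scaleC_left)
  then obtain b where b: "\<And>x y. cinner (a x) y = cinner x (b y)"
    by metis
  have "bounded_linear b"
  proof (rule bounded_linear_intro)
    show "b (x + y) = b x + b y" for x y
      by (rule cinner_right_eqI) (simp add: cinner_add_right flip: b)
    show "b (r *\<^sub>R x) = r *\<^sub>R b x" for r x
      by (rule cinner_right_eqI) (simp add: cinner.scaleR_right flip: b)
    show "norm (b x) \<le> norm x * norm a" for x
    proof (cases "b x = 0")
      case False
      have "(norm (b x))\<^sup>2 = cmod (cinner (a (b x)) x)"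
        unfolding b cinner_same norm_of_real by simp
      also have "\<dots> \<le> (norm a * norm (b x)) * norm x"
        by (rule order_trans[OF cmod_cinner_le]) (intro mult_right_mono norm_blinfun, simp)
      finally show ?thesis
        using False by (simp add: power2_eq_square mult.commute mult.left_commute)
    qed simp
  qed
  then have "\<forall>x y. cinner (a x) y = cinner x (Blinfun b y)"
    by (simp add: b bounded_linear_Blinfun_apply)
  then show ?thesis
    by blast
qed

lemma adj_eqI:
  fixes a b :: "'h::complex_hilbert_space oper"
  assumes "\<And>x y. cinner (a x) y = cinner x (b y)"
  shows "adj a = b"
  unfolding adj_def
proof (rule the_equality)
  fix c :: "'h oper" assume c: "\<forall>x y. cinner (a x) y = cinner x (c y)"
  show "c = b"
    by (rule blinfun_eqI, rule cinner_right_eqI) (metis c assms)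
qed (use assms in blast)

lemma cinner_adj: "clinear_op a \<Longrightarrow> cinner (a x) y = cinner x (adj a y)"
  using adjoint_ex adj_eqI by metis

lemma cinner_adj': "clinear_op a \<Longrightarrow> cinner (adj a x) y = cinner x (a y)"
  by (metis cinner_adj cinner_commute)

lemma clinear_adj: "clinear_op a \<Longrightarrow> clinear_op (adj a)"
  unfolding clinear_op_def[of "adj a"]
  by (intro allI cinner_left_eqI) (simp add: cinner_adj' cinner_scaleC_left)

lemma adj_adj: "clinear_op a \<Longrightarrow> adj (adj a) = a"
  by (rule adj_eqI) (rule cinner_adj')

lemma adj_compose: "clinear_op a \<Longrightarrow> clinear_op b \<Longrightarrow> adj (a o\<^sub>L b) = adj b o\<^sub>L adj a"
  by (rule adj_eqI) (simp add: cinner_adj)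

lemma adj_add: "clinear_op a \<Longrightarrow> clinear_op b \<Longrightarrow> adj (a + b) = adj a + adj b"
  by (rule adj_eqI) (simp add: cinner_adj blinfun.add_left cinner_add_left cinner_add_right)

lemma adj_diff: "clinear_op a \<Longrightarrow> clinear_op b \<Longrightarrow> adj (a - b) = adj a - adj b"
  by (rule adj_eqI) (simp add: cinner_adj blinfun.diff_left cinner.diff_left cinner.diff_right)

lemma adj_scaleC: "clinear_op a \<Longrightarrow> adj (c *\<^sub>C a) = cnj c *\<^sub>C adj a"
  by (rule adj_eqI) (simp add: cinner_adj scaleC_blinfun.rep_eq cinner_scaleC_left cinner_scaleC_right)

lemma adj_zero [simp]: "adj 0 = 0"
  by (rule adj_eqI) (simp add: cinner.zero_left cinner.zero_right)

\<comment> \<open>With \<open>banach\<close> the operators form a complete space, as the convergence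
  of the square root iteration requires.\<close>
subclass (in complex_hilbert_space) banach ..

section \<open>Operator algebras on a closed subspace\<close>

lemma clinear_zero: "clinear_op 0"
  by (simp add: clinear_op_def)

lemma clinear_add: "clinear_op a \<Longrightarrow> clinear_op b \<Longrightarrow> clinear_op (a + b)"
  by (simp add: clinear_op_def blinfun.add_left scaleC_add_right)

lemma clinear_diff: "clinear_op a \<Longrightarrow> clinear_op b \<Longrightarrow> clinear_op (a - b)"
  by (simp add: clinear_op_def blinfun.diff_left complex_vector.scale_right_diff_distrib)

lemma clinear_scaleC: "clinear_op a \<Longrightarrow> clinear_op (c *\<^sub>C a)"
  by (simp add: clinear_op_def scaleC_blinfun.rep_eq scaleC_scaleC mult.commute)

lemma clinear_compose: "clinear_op a \<Longrightarrow> clinear_op b \<Longrightarrow> clinear_op (a o\<^sub>L b)"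
  by (simp add: clinear_op_def)

lemma compose_scaleC_left: "(c *\<^sub>C a) o\<^sub>L b = c *\<^sub>C (a o\<^sub>L b)" for a b :: "'h::complex_hilbert_space oper"
  by (rule blinfun_eqI) (simp add: scaleC_blinfun.rep_eq)

lemma compose_scaleC_right: "clinear_op a \<Longrightarrow> a o\<^sub>L (c *\<^sub>C b) = c *\<^sub>C (a o\<^sub>L b)"
  by (rule blinfun_eqI) (simp add: scaleC_blinfun.rep_eq clinear_opD)

lemma compose_diff_left: "(a - b) o\<^sub>L c = (a o\<^sub>L c) - (b o\<^sub>L c)" for a b c :: "'h::complex_hilbert_space oper"
  by (rule blinfun_eqI) (simp add: blinfun.diff_left)

lemma compose_diff_right: "a o\<^sub>L (b - c) = (a o\<^sub>L b) - (a o\<^sub>L c)" for a b c :: "'h::complex_hilbert_space oper"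
  by (rule blinfun_eqI) (simp add: blinfun.diff_left blinfun.diff_right)

lemma compose_add_left: "(a + b) o\<^sub>L c = (a o\<^sub>L c) + (b o\<^sub>L c)" for a b c :: "'h::complex_hilbert_space oper"
  by (rule blinfun_eqI) (simp add: blinfun.add_left)

lemma compose_add_right: "a o\<^sub>L (b + c) = (a o\<^sub>L b) + (a o\<^sub>L c)" for a b c :: "'h::complex_hilbert_space oper"
  by (rule blinfun_eqI) (simp add: blinfun.add_left blinfun.add_right)

lemma compose_scaleR_left: "(r *\<^sub>R a) o\<^sub>L b = r *\<^sub>R (a o\<^sub>L b)" for a b :: "'h::complex_hilbert_space oper"
  by (rule blinfun_eqI) (simp add: blinfun.scaleR_left)

lemma compose_scaleR_right: "a o\<^sub>L (r *\<^sub>R b) = r *\<^sub>R (a o\<^sub>L b)" for a b :: "'h::complex_hilbert_space oper"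
  by (rule blinfun_eqI) (simp add: blinfun.scaleR_left blinfun.scaleR_right)

lemma compose_zero [simp]: "0 o\<^sub>L a = 0" "a o\<^sub>L 0 = 0" for a :: "'h::complex_hilbert_space oper"
  by (rule blinfun_eqI, simp)+

lemma blinfun_compose_assoc: "(a o\<^sub>L b) o\<^sub>L c = a o\<^sub>L (b o\<^sub>L c)"
  by (rule blinfun_eqI) simp

lemma compose_apply: "a o\<^sub>L b = c \<Longrightarrow> a (b x) = c x" for a b c :: "'h::complex_hilbert_space oper"
  by (metis blinfun_apply_blinfun_compose)

lemmas compose_distrib = compose_diff_left compose_diff_right compose_add_left compose_add_right
  compose_scaleR_left compose_scaleR_right

lemma bo_clinear: "a \<in> bounded_ops K \<Longrightarrow> clinear_op a"
  by (simp add: bounded_ops_iff)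

lemma bo_in: "a \<in> bounded_ops K \<Longrightarrow> a x \<in> K"
  by (simp add: bounded_ops_iff)

lemma bo_orth: "a \<in> bounded_ops K \<Longrightarrow> x \<in> orth_compl K \<Longrightarrow> a x = 0"
  by (simp add: bounded_ops_iff)

lemma bo_apply_id_on:
  assumes K: "closed_csubspace K" and a: "a \<in> bounded_ops K"
  shows "a (id_on K x) = a x"
  using bo_orth[OF a id_on_orth[OF K, of x]] by (simp add: blinfun.diff_right)

lemma bo_id_left: "closed_csubspace K \<Longrightarrow> a \<in> bounded_ops K \<Longrightarrow> id_on K o\<^sub>L a = a"
  by (rule blinfun_eqI) (simp add: id_on_id bo_in)

lemma bo_id_right: "closed_csubspace K \<Longrightarrow> a \<in> bounded_ops K \<Longrightarrow> a o\<^sub>L id_on K = a"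
  by (rule blinfun_eqI) (simp add: bo_apply_id_on)

lemma
  assumes K: "closed_csubspace K"
  shows bo_zero: "0 \<in> bounded_ops K"
    and bo_add: "a \<in> bounded_ops K \<Longrightarrow> b \<in> bounded_ops K \<Longrightarrow> a + b \<in> bounded_ops K"
    and bo_diff: "a \<in> bounded_ops K \<Longrightarrow> b \<in> bounded_ops K \<Longrightarrow> a - b \<in> bounded_ops K"
    and bo_scaleC: "a \<in> bounded_ops K \<Longrightarrow> c *\<^sub>C a \<in> bounded_ops K"
  using K
  by (auto simp: bounded_ops_iff clinear_zero clinear_add clinear_diff clinear_scaleC csub_zero csub_add
      csub_diff csub_scale blinfun.add_left blinfun.diff_left scaleC_blinfun.rep_eq)

lemma bo_compose: "a \<in> bounded_ops K \<Longrightarrow> b \<in> bounded_ops K \<Longrightarrow> a o\<^sub>L b \<in> bounded_ops K"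
  by (auto simp: bounded_ops_iff clinear_compose)

lemma bo_adj:
  assumes K: "closed_csubspace K" and a: "a \<in> bounded_ops K"
  shows "adj a \<in> bounded_ops K"
proof -
  note cl = bo_clinear[OF a]
  have "adj a y \<in> orth_compl (orth_compl K)" for y
    by (auto simp: orth_compl_def[of "orth_compl K"] cinner_adj' cl cinner.zero_right bo_orth[OF a])
  moreover have "adj a y = 0" if "y \<in> orth_compl K" for y
    using that bo_in[OF a] by (intro cinner_left_eqI) (simp add: cinner_adj'[OF cl] cinner.zero_left orth_compl_def)
  ultimately show ?thesis
    by (simp add: bounded_ops_iff clinear_adj[OF cl] orth_compl_orth_compl[OF K])
qed

lemma id_on_subspace_bo:
  assumes "closed_csubspace V" "V \<subseteq> K"
  shows "id_on V \<in> bounded_ops K"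
  using id_on_bounded_ops[OF assms(1)] assms(2) unfolding bounded_ops_iff orth_compl_def by blast

lemma clinear_id_on: "closed_csubspace V \<Longrightarrow> clinear_op (id_on V)"
  by (rule bo_clinear[OF id_on_bounded_ops])

lemma id_on_idem: "closed_csubspace V \<Longrightarrow> id_on V o\<^sub>L id_on V = id_on V"
  by (rule bo_id_left) (simp_all add: id_on_bounded_ops)

lemma cinner_id_on:
  assumes V: "closed_csubspace V"
  shows "cinner (id_on V x) y = cinner (id_on V x) (id_on V y)"
proof -
  have "cinner (id_on V x) (y - id_on V y) = 0"
    using id_on_orth[OF V, of y] id_on_in[OF V, of x] by (simp add: orth_compl_def cinner_eq_zero_commute[of _ "y - _"])
  then show ?thesis
    by (simp add: cinner.diff_right)
qed

lemma adj_id_on: "closed_csubspace V \<Longrightarrow> adj (id_on V) = id_on V"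
  by (rule adj_eqI) (metis cinner_id_on cinner_commute)

text \<open>The range of \<open>p\<close> is the kernel of \<open>p - 1\<close>, hence closed. This
  is the passage from algebraic projections to subspaces.\<close>

lemma projection_eq_id_on:
  assumes p: "clinear_op p" "p o\<^sub>L p = p" "adj p = p"
  shows "closed_csubspace (range p)" "p = id_on (range p)"
proof -
  have rng: "range p = {x. (p - id_blinfun) x \<in> {0}}"
  proof (rule subset_antisym; rule subsetI)
    fix x assume "x \<in> range p"
    then show "x \<in> {x. (p - id_blinfun) x \<in> {0}}"
      using compose_apply[OF p(2)] by (auto simp: blinfun.diff_left)
  next
    fix x assume "x \<in> {x. (p - id_blinfun) x \<in> {0}}"
    then have "x = p x"
      by (simp add: blinfun.diff_left)
    then show "x \<in> range p"
      by blast
  qed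
  have zero: "closed_csubspace {0 :: 'a}"
    by (rule closed_csubspaceI) auto
  have id: "clinear_op id_blinfun"
    by (simp add: clinear_op_def)
  show V: "closed_csubspace (range p)"
    unfolding rng
    by (intro closed_csubspace_vimage zero clinear_opD clinear_diff p id blinfun.bounded_linear_right)
  show "p = id_on (range p)"
  proof (rule blinfun_eqI, rule sym, rule id_on_eqI[OF V])
    show "x - p x \<in> orth_compl (range p)" for x
      using compose_apply[OF p(2)] cinner_adj[OF p(1)]
      by (auto simp: orth_compl_def cinner.diff_left p(3))
  qed auto
qed

lemma tendsto_cinner [tendsto_intros]:
  "(f \<longlongrightarrow> a) F \<Longrightarrow> (g \<longlongrightarrow> b) F \<Longrightarrow> ((\<lambda>x. cinner (f x) (g x)) \<longlongrightarrow> cinner (a :: 'h::complex_hilbert_space) b) F"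
  by (rule cinner.tendsto)

lemma bo_lim:
  fixes a :: "'i \<Rightarrow> 'h::complex_hilbert_space oper" and b :: "'h oper"
  assumes K: "closed_csubspace K" and F: "F \<noteq> bot" and a: "\<And>i. a i \<in> bounded_ops K"
    and lim: "\<And>x. ((\<lambda>i. a i x) \<longlongrightarrow> b x) F"
  shows "b \<in> bounded_ops K"
proof -
  have "b (c *\<^sub>C x) = c *\<^sub>C b x" for c x
  proof (rule tendsto_unique[OF F lim])
    show "((\<lambda>i. a i (c *\<^sub>C x)) \<longlongrightarrow> c *\<^sub>C b x) F"
      unfolding clinear_opD[OF bo_clinear[OF a]] by (intro tendsto_intros lim)
  qed
  moreover have "b x \<in> K" for x
    using Lim_in_closed_set[OF csub_closed[OF K] _ F lim] bo_in[OF a] by (simp add: always_eventually)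
  moreover have "b x = 0" if "x \<in> orth_compl K" for x
    using tendsto_unique[OF F lim[of x], of 0] bo_orth[OF a that] by simp
  ultimately show ?thesis
    by (simp add: bounded_ops_iff clinear_op_def)
qed

subsection \<open>Commutants\<close>

lemma commutant_iff: "b \<in> commutant K S \<longleftrightarrow> b \<in> bounded_ops K \<and> (\<forall>a\<in>S. a o\<^sub>L b = b o\<^sub>L a)"
  by (simp add: commutant_def)

lemma commutant_subset: "commutant K S \<subseteq> bounded_ops K"
  by (auto simp: commutant_iff)

lemma commutant_antimono: "S \<subseteq> T \<Longrightarrow> commutant K T \<subseteq> commutant K S"
  unfolding commutant_def by blast

lemma bicommutant_superset: "S \<subseteq> bounded_ops K \<Longrightarrow> S \<subseteq> commutant K (commutant K S)"
  by (auto simp: commutant_iff)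

lemma tricommutant: "S \<subseteq> bounded_ops K \<Longrightarrow> commutant K (commutant K (commutant K S)) = commutant K S"
  by (simp add: bicommutant_superset commutant_antimono commutant_subset subset_antisym)

lemma
  assumes K: "closed_csubspace K" and S: "S \<subseteq> bounded_ops K"
  shows com_zero: "0 \<in> commutant K S"
    and com_one: "id_on K \<in> commutant K S"
    and com_add: "a \<in> commutant K S \<Longrightarrow> b \<in> commutant K S \<Longrightarrow> a + b \<in> commutant K S"
    and com_diff: "a \<in> commutant K S \<Longrightarrow> b \<in> commutant K S \<Longrightarrow> a - b \<in> commutant K S"
    and com_scaleC: "a \<in> commutant K S \<Longrightarrow> c *\<^sub>C a \<in> commutant K S"
    and com_compose: "a \<in> commutant K S \<Longrightarrow> b \<in> commutant K S \<Longrightarrow> a o\<^sub>L b \<in> commutant K S"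
proof -
  have s: "clinear_op a" "id_on K o\<^sub>L a = a" "a o\<^sub>L id_on K = a" if "a \<in> S" for a
    using subsetD[OF S that] by (simp_all add: bo_id_left[OF K] bo_id_right[OF K] bo_clinear)
  show "0 \<in> commutant K S" "id_on K \<in> commutant K S"
    by (auto simp: commutant_iff s bo_zero K id_on_bounded_ops)
  show "a \<in> commutant K S \<Longrightarrow> b \<in> commutant K S \<Longrightarrow> a + b \<in> commutant K S"
    "a \<in> commutant K S \<Longrightarrow> b \<in> commutant K S \<Longrightarrow> a - b \<in> commutant K S"
    "a \<in> commutant K S \<Longrightarrow> c *\<^sub>C a \<in> commutant K S"
    by (auto simp: commutant_iff s bo_add bo_diff bo_scaleC K compose_distrib compose_scaleC_left
        compose_scaleC_right)
  show "a o\<^sub>L b \<in> commutant K S" if "a \<in> commutant K S" "b \<in> commutant K S"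
    using that by (auto simp: commutant_iff bo_compose) (metis blinfun_compose_assoc)
qed

lemma com_adj:
  assumes K: "closed_csubspace K" and S: "S \<subseteq> bounded_ops K" and adj: "\<And>a. a \<in> S \<Longrightarrow> adj a \<in> S"
    and b: "b \<in> commutant K S"
  shows "adj b \<in> commutant K S"
proof -
  have "a o\<^sub>L adj b = adj b o\<^sub>L a" if a: "a \<in> S" for a
  proof -
    have cl: "clinear_op a" "clinear_op b" "clinear_op (adj a)"
      using a b S bo_clinear clinear_adj by (auto simp: commutant_iff)
    have "adj (adj a o\<^sub>L b) = adj (b o\<^sub>L adj a)"
      using b adj[OF a] by (simp add: commutant_iff)
    then show ?thesis
      by (simp add: adj_compose adj_adj cl)
  qed
  then show ?thesis
    using b by (simp add: commutant_iff bo_adj[OF K])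
qed

lemma com_lim:
  fixes a :: "'i \<Rightarrow> 'h::complex_hilbert_space oper" and b :: "'h oper"
  assumes K: "closed_csubspace K" and S: "S \<subseteq> bounded_ops K" and F: "F \<noteq> bot"
    and a: "\<And>i. a i \<in> commutant K S" and lim: "\<And>x. ((\<lambda>i. a i x) \<longlongrightarrow> b x) F"
  shows "b \<in> commutant K S"
proof -
  have bo: "a i \<in> bounded_ops K" for i
    using a by (simp add: commutant_iff)
  have "s o\<^sub>L b = b o\<^sub>L s" if s: "s \<in> S" for s
  proof (rule blinfun_eqI)
    fix x
    have "((\<lambda>i. s (a i x)) \<longlongrightarrow> s (b x)) F"
      by (intro bounded_linear.tendsto[OF blinfun.bounded_linear_right] lim)
    moreover have "s (a i x) = a i (s x)" for i
      using a[of i] s by (metis commutant_iff blinfun_apply_blinfun_compose)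
    ultimately show "(s o\<^sub>L b) x = (b o\<^sub>L s) x"
      using tendsto_unique[OF F _ lim[of "s x"]] by simp
  qed
  then show ?thesis
    using bo_lim[OF K F bo lim] by (simp add: commutant_iff)
qed

lemma com_closed:
  assumes K: "closed_csubspace K" and S: "S \<subseteq> bounded_ops K"
  shows "closed (commutant K S)"
  unfolding closed_sequential_limits
proof (intro allI impI, elim conjE)
  fix f b assume f: "\<forall>n. f n \<in> commutant K S" "f \<longlonglongrightarrow> b"
  show "b \<in> commutant K S"
    by (rule com_lim[OF K S sequentially_bot]) (use f in \<open>auto intro!: blinfun.tendsto\<close>)
qed

text \<open>Since \<open>T\<close> is closed under adjoints, the orthogonal complement of
  \<open>V\<close> is invariant as well, so the projection commutes with \<open>T\<close>.\<close>

lemma id_on_commutant: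
  assumes V: "closed_csubspace V" and VK: "V \<subseteq> K" and T: "T \<subseteq> bounded_ops K"
    and adj: "\<And>a. a \<in> T \<Longrightarrow> adj a \<in> T" and inv: "\<And>a x. a \<in> T \<Longrightarrow> x \<in> V \<Longrightarrow> a x \<in> V"
  shows "id_on V \<in> commutant K T"
proof -
  have "a o\<^sub>L id_on V = id_on V o\<^sub>L a" if a: "a \<in> T" for a
  proof (rule blinfun_eqI, rule sym, simp, rule id_on_eqI[OF V])
    fix x
    have cl: "clinear_op a"
      using a T bo_clinear by auto
    show "a (id_on V x) \<in> V"
      by (rule inv[OF a id_on_in[OF V]])
    have "a (x - id_on V x) \<in> orth_compl V"
      using id_on_orth[OF V, of x] inv[OF adj[OF a]] by (simp add: orth_compl_def cinner_adj[OF cl])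
    then show "a x - a (id_on V x) \<in> orth_compl V"
      by (simp add: blinfun.diff_right)
  qed
  then show ?thesis
    using id_on_subspace_bo[OF V VK] by (simp add: commutant_iff)
qed

subsection \<open>Self-adjoint operators and their order\<close>

definition qform :: "'h::complex_hilbert_space oper \<Rightarrow> 'h \<Rightarrow> real" where
  "qform a x = Re (cinner (a x) x)"

lemma op_le_iff: "op_le a b \<longleftrightarrow> (\<forall>x. qform a x \<le> qform b x)"
  by (simp add: op_le_def qform_def blinfun.diff_left cinner.diff_left)

lemma op_le_refl: "op_le a a"
  by (simp add: op_le_iff)

lemma op_le_trans: "op_le a b \<Longrightarrow> op_le b c \<Longrightarrow> op_le a c"
  by (meson op_le_iff order_trans)

lemma qform_simps:
  "qform (a + b) x = qform a x + qform b x" "qform (a - b) x = qform a x - qform b x"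
  "qform (r *\<^sub>R a) x = r * qform a x" "qform 0 x = 0"
  by (simp_all add: qform_def blinfun.add_left blinfun.diff_left blinfun.scaleR_left cinner.add_left
      cinner.diff_left cinner.scaleR_left cinner.zero_left)

lemma qform_le_norm: "qform a x \<le> norm a * (norm x)\<^sup>2"
proof -
  have "qform a x \<le> cmod (cinner (a x) x)"
    unfolding qform_def by (rule complex_Re_le_cmod)
  also have "\<dots> \<le> (norm a * norm x) * norm x"
    by (rule order_trans[OF cmod_cinner_le]) (intro mult_right_mono norm_blinfun, simp)
  finally show ?thesis
    by (simp add: power2_eq_square mult.assoc)
qed

lemma Re_cinner_commute: "Re (cinner x y) = Re (cinner y x)" for x y :: "'h::complex_hilbert_space"
  by (metis cinner_commute complex_cnj(1) complex.sel(1) cnj.sel(1))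

lemma qform_add_scaled:
  assumes a: "clinear_op a" "adj a = a"
  shows "qform a (x + t *\<^sub>R y) = qform a x + 2 * t * Re (cinner (a x) y) + t\<^sup>2 * qform a y"
proof -
  have "Re (cinner (a y) x) = Re (cinner (a x) y)"
    using cinner_adj[OF a(1), of y x] a(2) Re_cinner_commute by metis
  then show ?thesis
    by (simp add: qform_def blinfun.add_right blinfun.scaleR_right cinner_add_left cinner_add_right
        cinner.scaleR_left cinner.scaleR_right power2_eq_square algebra_simps)
qed

lemma qform_sq: "clinear_op a \<Longrightarrow> qform (adj a o\<^sub>L a) x = (norm (a x))\<^sup>2"
  by (simp add: qform_def cinner_adj' Re_cinner_same)

text \<open>Positivity of the form at \<open>x - (1/C) a x\<close> gives the bound. It turns
  convergence of quadratic forms into strong convergence, which is how suprema of directed sets are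
  constructed.\<close>

lemma positive_norm_le:
  assumes a: "clinear_op a" "adj a = a" and pos: "\<And>x. 0 \<le> qform a x"
    and le: "\<And>x. qform a x \<le> C * (norm x)\<^sup>2" and C: "0 < C"
  shows "(norm (a x))\<^sup>2 \<le> C * qform a x"
proof -
  have "0 \<le> qform a (x + (- 1 / C) *\<^sub>R a x)"
    by (rule pos)
  also have "\<dots> = qform a x - 2 / C * (norm (a x))\<^sup>2 + (1 / C)\<^sup>2 * qform a (a x)"
    unfolding qform_add_scaled[OF a] Re_cinner_same by (simp add: power2_eq_square)
  also have "\<dots> \<le> qform a x - 2 / C * (norm (a x))\<^sup>2 + (1 / C)\<^sup>2 * (C * (norm (a x))\<^sup>2)"
    by (intro add_left_mono mult_left_mono le) simp
  also have "\<dots> = qform a x - (norm (a x))\<^sup>2 / C"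
    using C by (simp add: power2_eq_square field_simps)
  finally show ?thesis
    using C by (simp add: field_simps)
qed

lemma qform_zero_imp_zero:
  assumes a: "clinear_op a" "adj a = a" and zero: "\<And>x. qform a x = 0"
  shows "a = 0"
proof (rule blinfun_eqI)
  fix x
  have "(norm (a x))\<^sup>2 \<le> 1 * qform a x"
    by (rule positive_norm_le[OF a]) (auto simp: zero)
  then show "a x = (0 :: 'a oper) x"
    by (simp add: zero)
qed

lemma op_le_antisym:
  assumes "clinear_op a" "adj a = a" "clinear_op b" "adj b = b" "op_le a b" "op_le b a"
  shows "a = b"
proof -
  have "a - b = 0"
    by (rule qform_zero_imp_zero)
      (use assms in \<open>auto simp: clinear_diff adj_diff qform_simps op_le_iff intro: antisym\<close>)
  then show ?thesis
    by simp
qed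

lemma positive_sq_sqrt_kernel:
  assumes "clinear_op s" "adj s = s" and "qform (s o\<^sub>L s) x = 0"
  shows "s x = 0"
  using assms qform_sq[of s x] by simp

subsection \<open>Square roots\<close>

text \<open>If \<open>\<parallel>x\<parallel> \<le> 1\<close>, the fixed point below is \<open>1 - sqrt (1 - x)\<close>. The increments of the iteration
  are dominated by those of the scalar iteration started at \<open>0\<close> for \<open>x = 1\<close>, which increases to \<open>1\<close>.\<close>
lemma sqrt_fixed_point:
  fixes x :: "'h::complex_hilbert_space oper"
  assumes x: "norm x \<le> 1"
  shows "\<exists>y. norm y \<le> 1 \<and> y = (1/2) *\<^sub>R (x + (y o\<^sub>L y)) \<and>
    (\<forall>A. closed A \<and> 0 \<in> A \<and> (\<forall>a\<in>A. (1/2) *\<^sub>R (x + (a o\<^sub>L a)) \<in> A) \<longrightarrow> y \<in> A)"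
proof -
  define f where "f = (\<lambda>a. (1/2) *\<^sub>R (x + (a o\<^sub>L a)))"
  define Y where "Y n = (f ^^ n) 0" for n
  define s where "s n = ((\<lambda>t. (1 + t\<^sup>2) / 2) ^^ n) (0::real)" for n
  have Y0: "Y 0 = 0" and YS: "Y (Suc n) = f (Y n)" for n
    by (auto simp: Y_def)
  have s0: "s 0 = 0" and sS: "s (Suc n) = (1 + (s n)\<^sup>2) / 2" for n
    by (auto simp: s_def)
  have s01: "0 \<le> s n \<and> s n \<le> 1" for n
    by (induction n) (auto simp: s0 sS power_le_one)
  have "s n \<le> s (Suc n)" for n
    using sum_squares_bound[of 1 "s n"] by (simp add: sS)
  then have inc: "incseq s"
    by (rule incseq_SucI)
  have nY: "norm (Y n) \<le> s n" for n
  proof (induction n)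
    case (Suc n)
    have "norm (Y (Suc n)) \<le> (norm x + norm (Y n o\<^sub>L Y n)) / 2"
      by (simp add: YS f_def norm_triangle_ineq)
    also have "\<dots> \<le> (1 + norm (Y n) * norm (Y n)) / 2"
      by (intro divide_right_mono add_mono x norm_blinfun_compose) simp
    also have "\<dots> \<le> s (Suc n)"
      using mult_mono[OF Suc.IH Suc.IH] s01[of n] by (simp add: sS power2_eq_square)
    finally show ?case .
  qed (simp add: Y0 s0)
  have inc_step: "norm (Y (Suc n) - Y n) \<le> s (Suc n) - s n" for n
  proof (induction n)
    case 0
    then show ?case
      using nY[of 1] by (simp add: Y0 s0)
  next
    case (Suc n)
    define u v where "u = Y (Suc n)" and "v = Y n"
    \<comment> \<open>The factorisation \<open>u u - v v = u (u - v) + (u - v) v\<close> holds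
      without commutativity, and its norm estimate is exactly the increment of the scalar
      iteration.\<close>
    have "Y (Suc (Suc n)) - Y (Suc n) = (1/2) *\<^sub>R ((u o\<^sub>L (u - v)) + ((u - v) o\<^sub>L v))"
      by (simp add: YS[of "Suc n"] YS[of n] f_def u_def v_def compose_distrib algebra_simps flip: YS)
    then have "norm (Y (Suc (Suc n)) - Y (Suc n)) \<le> (norm (u o\<^sub>L (u - v)) + norm ((u - v) o\<^sub>L v)) / 2"
      using norm_triangle_ineq[of "u o\<^sub>L (u - v)" "(u - v) o\<^sub>L v"] by simp
    also have "\<dots> \<le> (norm u * norm (u - v) + norm (u - v) * norm v) / 2"
      by (intro divide_right_mono add_mono norm_blinfun_compose) simp
    also have "\<dots> \<le> (s (Suc n) * (s (Suc n) - s n) + (s (Suc n) - s n) * s n) / 2"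
      using nY[of "Suc n"] nY[of n] Suc.IH s01[of n] s01[of "Suc n"] incseq_SucD[OF inc, of n]
      by (intro divide_right_mono add_mono mult_mono) (auto simp: u_def v_def)
    also have "\<dots> = s (Suc (Suc n)) - s (Suc n)"
      by (simp add: sS[of "Suc n"] sS[of n] power2_eq_square field_simps)
    finally show ?case .
  qed
  have diff: "norm (Y (n + k) - Y n) \<le> s (n + k) - s n" for n k
  proof (induction k)
    case (Suc k)
    then show ?case
      using inc_step[of "n + k"] norm_triangle_ineq[of "Y (Suc (n + k)) - Y (n + k)" "Y (n + k) - Y n"] by simp
  qed simp
  have "convergent s"
    by (rule Bseq_monoseq_convergent) (use s01 inc in \<open>auto intro!: BseqI'[of _ 1] simp: incseq_imp_monoseq\<close>)
  then have Cs: "Cauchy s"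
    by (rule convergent_Cauchy)
  have "Cauchy Y"
  proof (rule metric_CauchyI)
    fix e :: real assume "0 < e"
    then obtain N where N: "\<forall>m\<ge>N. \<forall>n\<ge>N. dist (s m) (s n) < e"
      using Cs unfolding Cauchy_def by blast
    have le: "dist (Y m) (Y n) < e" if "n \<ge> N" "m \<ge> n" for m n
    proof -
      have "dist (Y m) (Y n) \<le> s m - s n"
        using diff[of n "m - n"] that by (simp add: dist_norm)
      also have "\<dots> \<le> dist (s m) (s n)"
        by (simp add: dist_real_def)
      also have "\<dots> < e"
        using N that by simp
      finally show ?thesis .
    qed
    show "\<exists>M. \<forall>m\<ge>M. \<forall>n\<ge>M. dist (Y m) (Y n) < e"
    proof (intro exI allI impI)
      fix m n assume "m \<ge> N" "n \<ge> N"
      then show "dist (Y m) (Y n) < e"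
        using le[of n m] le[of m n] by (cases "m \<ge> n") (auto simp: dist_commute)
    qed
  qed
  then obtain y where y: "Y \<longlonglongrightarrow> y"
    using Cauchy_convergent convergent_def by blast
  have "(\<lambda>n. Y (Suc n)) \<longlonglongrightarrow> f y"
    unfolding YS f_def
    by (intro tendsto_intros y bounded_bilinear.tendsto[OF bounded_bilinear_blinfun_compose])
  moreover have "(\<lambda>n. Y (Suc n)) \<longlonglongrightarrow> y"
    using y by (rule LIMSEQ_Suc)
  ultimately have "y = f y"
    by (rule LIMSEQ_unique[rotated])
  moreover have "norm y \<le> 1"
    by (rule Lim_bounded[OF tendsto_norm[OF y], of 0]) (meson nY s01 order_trans)
  \<comment> \<open>The iterates stay in every invariant set containing \<open>0\<close>. Suitable
    choices of \<open>A\<close> transport membership in an algebra, self-adjointness and commutation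
    to \<open>y\<close>.\<close>
  moreover have "y \<in> A" if A: "closed A" "0 \<in> A" "\<forall>a\<in>A. f a \<in> A" for A
  proof -
    have "Y n \<in> A" for n
      by (induction n) (use A in \<open>auto simp: Y0 YS\<close>)
    then show ?thesis
      by (rule closed_sequentially[OF A(1) _ y])
  qed
  ultimately show ?thesis
    unfolding f_def by blast
qed

section \<open>Von Neumann algebras\<close>

lemma von_neumann_algebra_commutant:
  assumes K: "closed_csubspace K" "K \<noteq> {0}" and T: "T \<subseteq> bounded_ops K" "\<And>a. a \<in> T \<Longrightarrow> adj a \<in> T"
  shows "von_neumann_algebra K (commutant K T)"
  using K com_adj[OF K(1) T] tricommutant[OF T(1)] commutant_subset
  by (simp add: von_neumann_algebra_def)

lemma von_neumann_algebra_bounded_ops: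
  assumes K: "closed_csubspace K" "K \<noteq> {0}"
  shows "von_neumann_algebra K (bounded_ops K)"
proof -
  have "bounded_ops K \<subseteq> commutant K (commutant K (bounded_ops K))"
    by (rule bicommutant_superset) simp
  then show ?thesis
    using K bo_adj commutant_subset[of K "commutant K (bounded_ops K)"]
    unfolding von_neumann_algebra_def by blast
qed

section \<open>Cyclic subspaces and maximality arguments\<close>

definition cyc :: "'h::complex_hilbert_space oper set \<Rightarrow> 'h \<Rightarrow> 'h set" where
  "cyc T x = ccspan ((\<lambda>a. blinfun_apply a x) ` T)"

lemma closed_csubspace_cyc: "closed_csubspace (cyc T x)"
  by (simp add: cyc_def closed_csubspace_ccspan)

lemma in_cyc: "a \<in> T \<Longrightarrow> blinfun_apply a x \<in> cyc T x"
  unfolding cyc_def by (rule subsetD[OF ccspan_superset imageI])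

lemma closed_csubspace_zero: "closed_csubspace {0}"
  by (rule closed_csubspaceI) auto

lemma closed_csubspace_op_vimage:
  "clinear_op a \<Longrightarrow> closed_csubspace V \<Longrightarrow> closed_csubspace {x. a x \<in> V}"
  by (rule closed_csubspace_vimage) (auto simp: clinear_opD blinfun.bounded_linear_right)

lemma closed_csubspace_kernel: "clinear_op a \<Longrightarrow> closed_csubspace {x. a x = 0}"
  using closed_csubspace_op_vimage[OF _ closed_csubspace_zero, of a] by simp

lemma op_eq_on_ccspan:
  assumes "clinear_op a" "clinear_op b" "\<And>x. x \<in> S \<Longrightarrow> a x = b x" "x \<in> ccspan S"
  shows "a x = b x"
proof -
  have "ccspan S \<subseteq> {x. (a - b) x = 0}"
    by (rule ccspan_minimal[OF _ closed_csubspace_kernel]) (auto simp: assms clinear_diff blinfun.diff_left)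
  then show ?thesis
    using assms(4) by (auto simp: blinfun.diff_left)
qed

lemma bo_eqI:
  assumes K: "closed_csubspace K" and "a \<in> bounded_ops K" "b \<in> bounded_ops K" "\<And>x. x \<in> K \<Longrightarrow> a x = b x"
  shows "a = b"
  by (rule blinfun_eqI) (metis assms bo_apply_id_on id_on_in)

text \<open>Conditions on single members and on pairs survive unions of chains, so Zorn's lemma
  applies. \<open>R\<close> is imposed on the diagonal too, which lets it express
  orthonormality.\<close>

lemma maximal_pairwise_family_ex:
  "\<exists>E. (\<forall>x\<in>E. Q x) \<and> (\<forall>x\<in>E. \<forall>y\<in>E. R x y) \<and>
    (\<forall>z. Q z \<and> R z z \<and> (\<forall>x\<in>E. R x z \<and> R z x) \<longrightarrow> z \<in> E)"
proof -
  define \<A> where "\<A> = {E. (\<forall>x\<in>E. Q x) \<and> (\<forall>x\<in>E. \<forall>y\<in>E. R x y)}"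
  have "\<exists>E\<in>\<A>. \<forall>X\<in>\<A>. E \<subseteq> X \<longrightarrow> X = E"
  proof (rule subset_Zorn')
    fix C assume "subset.chain \<A> C"
    then have sub: "C \<subseteq> \<A>" and lin: "\<And>X Y. X \<in> C \<Longrightarrow> Y \<in> C \<Longrightarrow> X \<subseteq> Y \<or> Y \<subseteq> X"
      by (auto simp: subset.chain_def)
    have "R x y" if x: "x \<in> \<Union>C" and y: "y \<in> \<Union>C" for x y
    proof -
      obtain X Y where XY: "X \<in> C" "x \<in> X" "Y \<in> C" "y \<in> Y"
        using x y by blast
      then obtain Z where "Z \<in> C" "x \<in> Z" "y \<in> Z"
        using lin[OF XY(1,3)] by auto
      then show ?thesis
        using sub by (auto simp: \<A>_def)
    qed
    then show "\<Union>C \<in> \<A>"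
      using sub unfolding \<A>_def mem_Collect_eq
      by (intro conjI ballI) (auto dest!: subsetD)
  qed
  then obtain E where E: "E \<in> \<A>" and max: "\<And>X. X \<in> \<A> \<Longrightarrow> E \<subseteq> X \<Longrightarrow> X = E"
    by blast
  have "z \<in> E" if "Q z \<and> R z z \<and> (\<forall>x\<in>E. R x z \<and> R z x)" for z
  proof -
    have "insert z E \<in> \<A>"
      using E that by (simp add: \<A>_def)
    then show ?thesis
      using max by blast
  qed
  then show ?thesis
    using E unfolding \<A>_def by blast
qed

lemma cauchy_filter_filtermap_imp_tendsto:
  fixes f :: "'a \<Rightarrow> 'b::complete_space"
  assumes "cauchy_filter (filtermap f F)" "F \<noteq> bot"
  shows "\<exists>l. (f \<longlongrightarrow> l) F"
  using complete_UNIV[where 'a='b, unfolded complete_uniform, rule_format, of "filtermap f F"] assms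
  by (simp add: filtermap_bot_iff filterlim_def)

section \<open>Invariant subspaces, cyclic families and square roots in a von Neumann
  algebra\<close>

locale vn =
  fixes K :: "'h::complex_hilbert_space set" and M :: "'h oper set"
  assumes vN: "von_neumann_algebra K M"
begin

abbreviation "Mc \<equiv> commutant K M"

lemma K: "closed_csubspace K" and K_ne: "K \<noteq> {0}" and M_sub: "M \<subseteq> bounded_ops K"
  and adj_M: "a \<in> M \<Longrightarrow> adj a \<in> M" and bicommutant: "commutant K Mc = M"
  using vN by (auto simp: von_neumann_algebra_def)

lemma M_bo: "a \<in> M \<Longrightarrow> a \<in> bounded_ops K"
  using M_sub by blast

lemma M_clinear: "a \<in> M \<Longrightarrow> clinear_op a"
  by (rule bo_clinear[OF M_bo])

lemma Mc_bo: "a \<in> Mc \<Longrightarrow> a \<in> bounded_ops K"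
  by (simp add: commutant_iff)

lemma MI: "a \<in> bounded_ops K \<Longrightarrow> (\<And>b. b \<in> Mc \<Longrightarrow> b o\<^sub>L a = a o\<^sub>L b) \<Longrightarrow> a \<in> M"
  using bicommutant by (auto simp: commutant_iff[of _ K "commutant K M"])

lemma Mc_commute: "a \<in> M \<Longrightarrow> b \<in> Mc \<Longrightarrow> a o\<^sub>L b = b o\<^sub>L a"
  by (simp add: commutant_iff)

lemma Mc_commute_apply: "a \<in> M \<Longrightarrow> b \<in> Mc \<Longrightarrow> a (b x) = b (a x)"
  by (metis Mc_commute blinfun_apply_blinfun_compose)

text \<open>\<open>M\<close> is the commutant of \<open>Mc\<close>, so it inherits the closure
  properties of commutants.\<close>

lemmas M_zero = com_zero[OF K commutant_subset, of M, unfolded bicommutant]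
  and M_one = com_one[OF K commutant_subset, of M, unfolded bicommutant]
  and M_add = com_add[OF K commutant_subset, of _ M, unfolded bicommutant]
  and M_diff = com_diff[OF K commutant_subset, of _ M, unfolded bicommutant]
  and M_scaleC = com_scaleC[OF K commutant_subset, of _ M, unfolded bicommutant]
  and M_compose = com_compose[OF K commutant_subset, of _ M, unfolded bicommutant]
  and M_lim = com_lim[OF K commutant_subset, of _ _ M, unfolded bicommutant]
  and M_closed = com_closed[OF K commutant_subset, of M, unfolded bicommutant]

lemma scaleR_eq_scaleC_op: "r *\<^sub>R (a :: 'h oper) = complex_of_real r *\<^sub>C a"
  by (rule blinfun_eqI) (simp add: scaleC_blinfun.rep_eq blinfun.scaleR_left scaleC_of_real)

lemma M_scaleR: "a \<in> M \<Longrightarrow> r *\<^sub>R a \<in> M"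
  by (simp add: scaleR_eq_scaleC_op M_scaleC)

lemma M_sum: "(\<And>i. i \<in> I \<Longrightarrow> f i \<in> M) \<Longrightarrow> sum f I \<in> M"
  by (induction I rule: infinite_finite_induct) (auto simp: M_zero M_add)

lemma vn_Mc: "vn K Mc"
  using von_neumann_algebra_commutant[OF K K_ne M_sub adj_M] by (simp add: vn_def)

lemma adj_Mc: "a \<in> Mc \<Longrightarrow> adj a \<in> Mc"
  by (rule vn.adj_M[OF vn_Mc])

lemma one_apply: "x \<in> K \<Longrightarrow> id_on K x = x"
  by (rule id_on_id[OF K])

lemma id_on_in_M:
  assumes "closed_csubspace V" "V \<subseteq> K" "\<And>b x. b \<in> Mc \<Longrightarrow> x \<in> V \<Longrightarrow> b x \<in> V"
  shows "id_on V \<in> M"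
  using id_on_commutant[OF assms(1,2) commutant_subset adj_Mc assms(3)] bicommutant by blast

lemma self_in_cyc: "x \<in> K \<Longrightarrow> x \<in> cyc M x"
  using in_cyc[OF M_one, of x] by (simp add: one_apply)

lemma cyc_sub: "cyc M x \<subseteq> K"
  unfolding cyc_def by (rule ccspan_minimal[OF _ K]) (use M_bo bo_in in blast)

lemma cyc_inv:
  assumes a: "a \<in> M" and v: "v \<in> cyc M x"
  shows "a v \<in> cyc M x"
proof -
  have "cyc M x \<subseteq> {v. a v \<in> cyc M x}"
    unfolding cyc_def[of _ x, THEN arg_cong[of _ _ "\<lambda>S. S \<subseteq> {v. a v \<in> cyc M x}"]]
  proof (rule ccspan_minimal)
    show "(\<lambda>a. blinfun_apply a x) ` M \<subseteq> {v. a v \<in> cyc M x}"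
      using in_cyc[OF M_compose[OF a], of _ x] by auto
  qed (rule closed_csubspace_op_vimage[OF M_clinear[OF a] closed_csubspace_cyc])
  with v show ?thesis
    by blast
qed

lemma cyc_minimal:
  assumes "closed_csubspace V" "x \<in> V" "\<And>a y. a \<in> M \<Longrightarrow> y \<in> V \<Longrightarrow> a y \<in> V"
  shows "cyc M x \<subseteq> V"
  unfolding cyc_def by (rule ccspan_minimal[OF _ assms(1)]) (use assms in blast)

lemma id_on_cyc: "id_on (cyc M x) \<in> Mc"
  by (rule id_on_commutant[OF closed_csubspace_cyc cyc_sub M_sub adj_M cyc_inv])

text \<open>For a maximal family with mutually orthogonal spaces \<open>M x\<close>, the vectors of
  \<open>K\<close> orthogonal to all of them form an \<open>M\<close>-invariant subspace; were it
  nonzero, a further member could be found there. \<open>Q\<close> may be any property that has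
  witnesses in every nonzero invariant subspace.\<close>

lemma total_family_ex:
  assumes Q: "\<And>V. closed_csubspace V \<Longrightarrow> V \<subseteq> K \<Longrightarrow> V \<noteq> {0} \<Longrightarrow>
    (\<And>a x. a \<in> M \<Longrightarrow> x \<in> V \<Longrightarrow> a x \<in> V) \<Longrightarrow> \<exists>x\<in>V. x \<noteq> 0 \<and> Q x"
  shows "\<exists>E\<subseteq>K. (\<forall>x\<in>E. x \<noteq> 0 \<and> Q x) \<and>
    (\<forall>x\<in>E. \<forall>y\<in>E. x \<noteq> y \<longrightarrow> (\<forall>a\<in>M. cinner (a x) y = 0)) \<and>
    ccspan {blinfun_apply a x |a x. a \<in> M \<and> x \<in> E} = K"
proof -
  obtain E where E: "\<forall>x\<in>E. x \<in> K \<and> x \<noteq> 0 \<and> Q x"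
      "\<forall>x\<in>E. \<forall>y\<in>E. x \<noteq> y \<longrightarrow> (\<forall>a\<in>M. cinner (a x) y = 0)"
    and max: "\<forall>z. (z \<in> K \<and> z \<noteq> 0 \<and> Q z) \<and> (z \<noteq> z \<longrightarrow> (\<forall>a\<in>M. cinner (a z) z = 0)) \<and>
      (\<forall>x\<in>E. (x \<noteq> z \<longrightarrow> (\<forall>a\<in>M. cinner (a x) z = 0)) \<and> (z \<noteq> x \<longrightarrow> (\<forall>a\<in>M. cinner (a z) x = 0))) \<longrightarrow> z \<in> E"
    using maximal_pairwise_family_ex[of "\<lambda>x. x \<in> K \<and> x \<noteq> 0 \<and> Q x"
        "\<lambda>x y. x \<noteq> y \<longrightarrow> (\<forall>a\<in>M. cinner (a x) y = 0)"]
    by (elim exE conjE)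
  define S where "S = {blinfun_apply a x |a x. a \<in> M \<and> x \<in> E}"
  have SK: "S \<subseteq> K"
    using bo_in[OF M_bo] by (auto simp: S_def)
  define V where "V = K \<inter> orth_compl S"
  have V: "closed_csubspace V"
    unfolding V_def by (intro closed_csubspace_Int K closed_csubspace_orth_compl)
  have "V = {0}"
  proof (rule ccontr)
    assume ne: "V \<noteq> {0}"
    have "a x \<in> V" if a: "a \<in> M" and x: "x \<in> V" for a x
    proof -
      have "cinner (a x) (b y) = 0" if "b \<in> M" "y \<in> E" for b y
      proof -
        have "(adj a o\<^sub>L b) y \<in> S"
          using M_compose[OF adj_M[OF a] that(1)] that(2) unfolding S_def by blast
        then show ?thesis
          using x by (simp add: V_def orth_compl_def cinner_adj[OF M_clinear[OF a]])
      qed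
      then show ?thesis
        using bo_in[OF M_bo[OF a]] by (auto simp: V_def orth_compl_def S_def)
    qed
    then obtain x where x: "x \<in> V" "x \<noteq> 0" "Q x"
      using Q[OF V _ ne] by (auto simp: V_def)
    have xE: "cinner x (a y) = 0" if "a \<in> M" "y \<in> E" for a y
      using x(1) that by (auto simp: V_def orth_compl_def S_def)
    have "cinner (a x) y = 0" if "a \<in> M" "y \<in> E" for a y
      using xE[OF adj_M[OF that(1)] that(2)] by (simp add: cinner_adj[OF M_clinear[OF that(1)]])
    moreover have "cinner (a y) x = 0" if "a \<in> M" "y \<in> E" for a y
      using xE[OF that] cinner_eq_zero_commute by blast
    ultimately have "x \<in> E"
      using x max by (auto simp: V_def)
    moreover have "x \<in> K"
      using x by (simp add: V_def)
    ultimately have "cinner x x = 0"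
      using xE[OF M_one \<open>x \<in> E\<close>] by (simp add: one_apply)
    then show False
      using x by simp
  qed
  then have "ccspan S = K"
    by (intro ccspan_eqI[OF K SK]) (auto simp: V_def)
  then show ?thesis
    using E unfolding S_def by (intro exI[of _ E]) auto
qed

lemma cyclic_decomposition_ex:
  "\<exists>E\<subseteq>K. (\<forall>x\<in>E. x \<noteq> 0) \<and> (\<forall>x\<in>E. \<forall>y\<in>E. x \<noteq> y \<longrightarrow> (\<forall>a\<in>M. cinner (a x) y = 0)) \<and>
    ccspan {blinfun_apply a x |a x. a \<in> M \<and> x \<in> E} = K"
proof -
  have "\<exists>E\<subseteq>K. (\<forall>x\<in>E. x \<noteq> 0 \<and> True) \<and>
    (\<forall>x\<in>E. \<forall>y\<in>E. x \<noteq> y \<longrightarrow> (\<forall>a\<in>M. cinner (a x) y = 0)) \<and>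
    ccspan {blinfun_apply a x |a x. a \<in> M \<and> x \<in> E} = K"
    by (rule total_family_ex) (use csub_zero in force)
  then show ?thesis
    by simp
qed

text \<open>With \<open>x = 1 - a / C\<close> the fixed point is
  \<open>y = 1 - sqrt (a / C)\<close>, where \<open>1\<close> is the unit \<open>id_on K\<close> of
  \<open>M\<close>. The last clause asks \<open>b\<close> to commute with this unit because it need
  not be the identity of the ambient space.\<close>

lemma sqrt_ex:
  assumes a: "a \<in> M" "adj a = a" and pos: "\<And>x. 0 \<le> qform a x"
  shows "\<exists>s\<in>M. adj s = s \<and> (\<forall>x. 0 \<le> qform s x) \<and> s o\<^sub>L s = a \<and>
    (\<forall>b. b o\<^sub>L id_on K = id_on K o\<^sub>L b \<and> a o\<^sub>L b = b o\<^sub>L a \<longrightarrow> s o\<^sub>L b = b o\<^sub>L s)"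
proof -
  \<comment> \<open>The summand \<open>1\<close> keeps \<open>C\<close> positive when
    \<open>a = 0\<close>.\<close>
  define C where "C = norm a + 1"
  have C: "0 < C"
    by (simp add: C_def add_nonneg_pos)
  define P where "P = id_on K"
  have P: "P \<in> M" "clinear_op P" "adj P = P" "P o\<^sub>L P = P"
    by (simp_all add: P_def M_one clinear_id_on[OF K] adj_id_on[OF K] id_on_idem[OF K])
  define a1 where "a1 = (1 / C) *\<^sub>R a"
  define x where "x = P - a1"
  have a1: "a1 \<in> M" "adj a1 = a1"
    using M_scaleR[OF a(1)] a by (auto simp: a1_def) (simp add: scaleR_eq_scaleC_op adj_scaleC M_clinear)
  have xM: "x \<in> M" and xadj: "adj x = x"
    using a1 P by (simp_all add: x_def M_diff adj_diff M_clinear)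
  have Pa: "P o\<^sub>L b = b" "b o\<^sub>L P = b" if "b \<in> M" for b
    using that by (auto simp: P_def bo_id_left[OF K M_bo] bo_id_right[OF K M_bo])
  have pos1: "0 \<le> qform a1 v" for v
    using pos C by (simp add: a1_def qform_simps)
  have le1: "qform a1 v \<le> (norm v)\<^sup>2" for v
  proof -
    have "qform a v \<le> C * (norm v)\<^sup>2"
      by (rule order_trans[OF qform_le_norm]) (simp add: C_def mult_right_mono)
    then show ?thesis
      using C by (simp add: a1_def qform_simps field_simps)
  qed
  have normP: "norm (P v) \<le> norm v" for v
  proof -
    have "(norm (P v))\<^sup>2 = Re (cinner (P v) v)"
      using qform_sq[OF P(2), of v] by (simp add: P qform_def)
    also have "\<dots> \<le> norm (P v) * norm v"
      by (rule order_trans[OF complex_Re_le_cmod cmod_cinner_le])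
    finally show ?thesis
      by (cases "P v = 0") (simp_all add: power2_eq_square)
  qed
  \<comment> \<open>Expanding the square adds
    \<open>\<parallel>a1 v\<parallel>\<^sup>2 - 2 qform a1 v\<close> to
    \<open>\<parallel>P v\<parallel>\<^sup>2\<close>. This is at most \<open>0\<close>, since
    \<open>\<parallel>a1 v\<parallel>\<^sup>2 \<le> qform a1 v\<close>.\<close>
  have "norm (x v) \<le> 1 * norm v" for v
  proof -
    have sq: "(norm (a1 v))\<^sup>2 \<le> 1 * qform a1 v"
      by (rule positive_norm_le[OF M_clinear[OF a1(1)] a1(2) pos1]) (simp_all add: le1)
    have "cinner (a1 v) (P v) = cinner (P (a1 v)) v"
      using P by (simp add: cinner_adj[OF P(2)])
    also have "\<dots> = cinner (a1 v) v"
      by (simp add: compose_apply[OF Pa(1)[OF a1(1)]])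
    finally have "inner (P v) (a1 v) = qform a1 v"
      by (simp add: inner_eq_Re_cinner qform_def Re_cinner_commute[of "P v"])
    then have "(norm (x v))\<^sup>2 = (norm (P v))\<^sup>2 - 2 * qform a1 v + (norm (a1 v))\<^sup>2"
      by (simp add: x_def blinfun.diff_left power2_norm_eq_inner inner_diff_left inner_diff_right inner_commute)
    also have "\<dots> \<le> (norm v)\<^sup>2"
      using sq pos1[of v] power_mono[OF normP[of v] norm_ge_zero, of 2] by linarith
    finally show ?thesis
      using power2_le_imp_le[OF _ norm_ge_zero, of "norm (x v)" v] by simp
  qed
  then have "norm x \<le> 1"
    by (intro norm_blinfun_bound) auto
  from sqrt_fixed_point[OF this] obtain y where "norm y \<le> 1 \<and> y = (1/2) *\<^sub>R (x + (y o\<^sub>L y)) \<and>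
    (\<forall>A. closed A \<and> 0 \<in> A \<and> (\<forall>a\<in>A. (1/2) *\<^sub>R (x + (a o\<^sub>L a)) \<in> A) \<longrightarrow> y \<in> A)"
    by (rule exE)
  then have y: "norm y \<le> 1" "y = (1/2) *\<^sub>R (x + (y o\<^sub>L y))"
    and inA: "\<And>A. closed A \<Longrightarrow> 0 \<in> A \<Longrightarrow> (\<And>a. a \<in> A \<Longrightarrow> (1/2) *\<^sub>R (x + (a o\<^sub>L a)) \<in> A) \<Longrightarrow> y \<in> A"
    by simp_all
  have yM: "y \<in> M"
    by (rule inA) (auto simp: M_closed M_zero intro!: M_scaleR M_add M_compose xM)
  have "y \<in> {b :: 'h oper. \<forall>u v. cinner (b u) v = cinner u (b v)}"
  proof (rule inA)
    show "closed {b :: 'h oper. \<forall>u v. cinner (b u) v = cinner u (b v)}"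
      by (intro closed_Collect_all closed_Collect_eq cinner.continuous_on blinfun.continuous_on
          continuous_on_id continuous_on_const)
    show "(1/2) *\<^sub>R (x + (b o\<^sub>L b)) \<in> {b :: 'h oper. \<forall>u v. cinner (b u) v = cinner u (b v)}"
      if "b \<in> {b :: 'h oper. \<forall>u v. cinner (b u) v = cinner u (b v)}" for b
      using that cinner_adj[OF M_clinear[OF xM]]
      by (simp add: blinfun.add_left blinfun.scaleR_left cinner_add_left cinner_add_right
          cinner.scaleR_left cinner.scaleR_right xadj)
  qed (simp add: cinner.zero_left cinner.zero_right)
  then have yadj: "adj y = y"
    by (intro adj_eqI) simp
  define t where "t = P - y"
  define s where "s = sqrt C *\<^sub>R t"
  have tM: "t \<in> M" "adj t = t"
    using P yM yadj by (simp_all add: t_def M_diff adj_diff M_clinear)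
  have "y + y = x + (y o\<^sub>L y)"
    using arg_cong[OF y(2), of "\<lambda>z. z + z"] by (simp flip: scaleR_left_distrib)
  then have tt: "t o\<^sub>L t = a1"
    by (simp add: t_def compose_distrib P(4) Pa yM) (simp add: x_def algebra_simps)
  \<comment> \<open>As \<open>y = P y P\<close>, the bound
    \<open>\<parallel>y\<parallel> \<le> 1\<close> gives \<open>y \<le> P\<close> as forms.\<close>
  have tpos: "0 \<le> qform t v" for v
  proof -
    have "qform y v = Re (cinner (y (P v)) (P v))"
      using compose_apply[OF Pa(1)[OF yM]] compose_apply[OF Pa(2)[OF yM]]
      by (simp add: qform_def P(3) flip: cinner_adj[OF P(2), unfolded P(3)])
    also have "\<dots> = qform y (P v)"
      by (simp add: qform_def)
    also have "\<dots> \<le> norm y * (norm (P v))\<^sup>2"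
      by (rule qform_le_norm)
    also have "\<dots> \<le> 1 * (norm (P v))\<^sup>2"
      by (intro mult_right_mono y) simp
    also have "\<dots> = qform P v"
      using qform_sq[OF P(2), of v] by (simp add: P)
    finally show ?thesis
      by (simp add: t_def qform_simps)
  qed
  have "s \<in> M" "adj s = s"
    using tM by (auto simp: s_def M_scaleR) (simp add: scaleR_eq_scaleC_op adj_scaleC M_clinear)
  moreover have "0 \<le> qform s v" for v
    using tpos C by (simp add: s_def qform_simps)
  moreover have "s o\<^sub>L s = a"
    using C by (simp add: s_def compose_distrib tt a1_def)
  moreover have "s o\<^sub>L b = b o\<^sub>L s" if b: "b o\<^sub>L P = P o\<^sub>L b" "a o\<^sub>L b = b o\<^sub>L a" for b
  proof -
    have xb: "x o\<^sub>L b = b o\<^sub>L x"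
      by (simp add: x_def a1_def compose_distrib b)
    have "y \<in> {c. c o\<^sub>L b = b o\<^sub>L c}"
    proof (rule inA)
      show "closed {c. c o\<^sub>L b = b o\<^sub>L c}"
        by (intro closed_Collect_eq bounded_bilinear.continuous_on[OF bounded_bilinear_blinfun_compose]
            continuous_on_id continuous_on_const)
      show "(1/2) *\<^sub>R (x + (c o\<^sub>L c)) \<in> {c. c o\<^sub>L b = b o\<^sub>L c}" if "c \<in> {c. c o\<^sub>L b = b o\<^sub>L c}" for c
        using that xb by (simp add: compose_distrib) (metis blinfun_compose_assoc)
    qed simp
    then show ?thesis
      by (simp add: s_def t_def compose_distrib b)
  qed
  ultimately show ?thesis
    unfolding P_def by blast
qed

subsection \<open>Suprema of bounded directed sets\<close>

text \<open>Monotone convergence: the quadratic forms increase and are bounded, and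
  \<open>positive_norm_le\<close> upgrades their convergence to strong convergence of the operators.
  Hence the form of the supremum is the supremum of the forms, which is the second
  conclusion.\<close>

lemma directed_sup_ex:
  assumes D: "D \<subseteq> self_adjoint_part M" "D \<noteq> {}"
    and dir: "\<And>a b. a \<in> D \<Longrightarrow> b \<in> D \<Longrightarrow> \<exists>c\<in>D. op_le a c \<and> op_le b c"
    and bound: "\<And>d. d \<in> D \<Longrightarrow> op_le d u"
  shows "\<exists>s. op_lub M D s \<and> (\<forall>x. \<forall>e>0. \<exists>d\<in>D. qform s x < qform d x + e)"
proof -
  \<comment> \<open>The filter of tails of \<open>D\<close>; limits along it are limits of the
    increasing net.\<close>
  define F where "F = (INF d\<in>D. principal {c \<in> D. op_le d c})"
  have evF: "eventually P F \<longleftrightarrow> (\<exists>d\<in>D. \<forall>c\<in>D. op_le d c \<longrightarrow> P c)" for P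
    unfolding F_def
  proof (subst eventually_INF_base[OF D(2)])
    fix a b assume "a \<in> D" "b \<in> D"
    then obtain c where c: "c \<in> D" "op_le a c" "op_le b c"
      using dir by blast
    then show "\<exists>x\<in>D. principal {c \<in> D. op_le x c} \<le> inf (principal {c \<in> D. op_le a c}) (principal {c \<in> D. op_le b c})"
      by (intro bexI[of _ c]) (auto intro: op_le_trans)
  qed (auto simp: eventually_principal)
  have F: "F \<noteq> bot"
    using op_le_refl by (auto simp: trivial_limit_def evF)
  have evD: "eventually (\<lambda>c. c \<in> D) F"
    using D(2) by (auto simp: evF)
  have ev_ge: "eventually (\<lambda>c. op_le d c) F" if "d \<in> D" for d
    using that by (auto simp: evF)
  have DM: "d \<in> M" "adj d = d" "clinear_op d" if "d \<in> D" for d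
    using that D M_clinear by (auto simp: self_adjoint_part_def)
  obtain d0 where d0: "d0 \<in> D"
    using D(2) by blast
  \<comment> \<open>If \<open>d0 \<le> d \<le> c\<close> in \<open>D\<close>, then
    \<open>c - d \<le> u - d0\<close>, so this one constant bounds all the differences that
    occur.\<close>
  define C where "C = norm (u - d0) + 1"
  have C: "0 < C"
    by (simp add: C_def add_nonneg_pos)
  have diff_le: "(norm ((c - d) x))\<^sup>2 \<le> C * (qform c x - qform d x)"
    if "c \<in> D" "d \<in> D" "op_le d0 d" "op_le d c" for c d x
  proof -
    have "(norm ((c - d) x))\<^sup>2 \<le> C * qform (c - d) x"
    proof (rule positive_norm_le[OF _ _ _ _ C])
      show "clinear_op (c - d)" "adj (c - d) = c - d"
        using that by (simp_all add: clinear_diff adj_diff DM)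
      show "0 \<le> qform (c - d) y" for y
        using that by (simp add: qform_simps op_le_iff)
      show "qform (c - d) y \<le> C * (norm y)\<^sup>2" for y
      proof -
        have "qform (c - d) y \<le> qform (u - d0) y"
          using bound[OF that(1)] that(3) by (simp add: qform_simps op_le_iff diff_mono)
        also have "\<dots> \<le> C * (norm y)\<^sup>2"
          by (rule order_trans[OF qform_le_norm]) (simp add: C_def mult_right_mono)
        finally show ?thesis .
      qed
    qed
    then show ?thesis
      by (simp add: qform_simps)
  qed
  have "\<exists>l. ((\<lambda>d. blinfun_apply d x) \<longlongrightarrow> l) F" for x
  proof -
    have "cauchy_filter (filtermap (\<lambda>d. blinfun_apply d x) F)"
      unfolding cauchy_filter_metric_filtermap
    proof (intro allI impI)
      fix e :: real assume e: "0 < e"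
      define g where "g = (SUP d\<in>D. qform d x)"
      have bdd: "bdd_above ((\<lambda>d. qform d x) ` D)"
        using bound by (intro bdd_aboveI2[of _ _ "qform u x"]) (simp add: op_le_iff)
      \<comment> \<open>The tolerance is chosen so that \<open>diff_le\<close> turns it into a
        distance at most \<open>e/3\<close>, strictly below \<open>e/2\<close>.\<close>
      have "g - (e/3)\<^sup>2 / C < g"
        using e C by simp
      then obtain d1 where d1: "d1 \<in> D" "g - (e/3)\<^sup>2 / C < qform d1 x"
        using less_cSUP_iff[OF D(2) bdd] unfolding g_def by blast
      obtain d where d: "d \<in> D" "op_le d1 d" "op_le d0 d"
        using dir[OF d1(1) d0] by blast
      have near: "norm (c x - d x) < e / 2" if "c \<in> D" "op_le d c" for c
      proof -
        have "qform c x \<le> g"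
          unfolding g_def by (rule cSUP_upper[OF that(1) bdd])
        moreover have "qform d1 x \<le> qform d x"
          using d by (simp add: op_le_iff)
        ultimately have "qform c x - qform d x \<le> (e/3)\<^sup>2 / C"
          using d1 by linarith
        then have "C * (qform c x - qform d x) \<le> (e/3)\<^sup>2"
          using C by (simp add: field_simps)
        with diff_le[OF that(1) d(1,3) that(2), of x] have "(norm (c x - d x))\<^sup>2 \<le> (e/3)\<^sup>2"
          by (simp add: blinfun.diff_left)
        then have "norm (c x - d x) \<le> e/3"
          by (rule power2_le_imp_le) (use e in simp)
        then show ?thesis
          using e by simp
      qed
      show "\<exists>P. eventually P F \<and> (\<forall>a b. P a \<and> P b \<longrightarrow> dist (blinfun_apply a x) (blinfun_apply b x) < e)"
      proof (intro exI conjI allI impI)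
        show "eventually (\<lambda>c. norm (blinfun_apply c x - d x) < e / 2) F"
          using d near by (auto simp: evF)
        fix a b :: "'h oper" assume "norm (a x - d x) < e / 2 \<and> norm (b x - d x) < e / 2"
        then show "dist (a x) (b x) < e"
          using dist_triangle_half_r[of "d x" "a x" e "b x"] by (simp add: dist_norm norm_minus_commute)
      qed
    qed
    then show ?thesis
      using F by (rule cauchy_filter_filtermap_imp_tendsto)
  qed
  then obtain f where f: "\<And>x. ((\<lambda>d. blinfun_apply d x) \<longlongrightarrow> f x) F"
    by metis
  have "bounded_linear f"
  proof (rule bounded_linear_intro)
    show "f (x + y) = f x + f y" for x y
      by (rule tendsto_unique[OF F f]) (unfold blinfun.add_right, intro tendsto_intros f)
    show "f (r *\<^sub>R x) = r *\<^sub>R f x" for r x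
      by (rule tendsto_unique[OF F f]) (unfold blinfun.scaleR_right, intro tendsto_intros f)
    show "norm (f x) \<le> norm x * (norm d0 + C)" for x
    proof (rule tendsto_upperbound[OF tendsto_norm[OF f] _ F])
      show "\<forall>\<^sub>F c in F. norm (blinfun_apply c x) \<le> norm x * (norm d0 + C)"
        using eventually_conj[OF evD ev_ge[OF d0]]
      proof (rule eventually_mono, elim conjE)
        fix c assume c: "c \<in> D" "op_le d0 c"
        have "(norm ((c - d0) x))\<^sup>2 \<le> C * (qform c x - qform d0 x)"
          by (rule diff_le[OF c(1) d0 op_le_refl c(2)])
        also have "\<dots> \<le> C * (C * (norm x)\<^sup>2)"
        proof (rule mult_left_mono)
          have "qform c x - qform d0 x \<le> qform (u - d0) x"
            using bound[OF c(1)] by (simp add: qform_simps op_le_iff)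
          also have "\<dots> \<le> C * (norm x)\<^sup>2"
            by (rule order_trans[OF qform_le_norm]) (simp add: C_def mult_right_mono)
          finally show "qform c x - qform d0 x \<le> C * (norm x)\<^sup>2" .
        qed (use C in simp)
        also have "\<dots> = (C * norm x)\<^sup>2"
          by (simp add: power2_eq_square)
        finally have "norm ((c - d0) x) \<le> C * norm x"
          by (rule power2_le_imp_le) (use C in simp)
        moreover have "norm (c x) \<le> norm (d0 x) + norm ((c - d0) x)"
          using norm_triangle_ineq[of "d0 x" "(c - d0) x"] by (simp add: blinfun.diff_left)
        ultimately show "norm (c x) \<le> norm x * (norm d0 + C)"
          using norm_blinfun[of d0 x] by (simp add: algebra_simps)
      qed
    qed
  qed
  define s where "s = Blinfun f"
  have s: "((\<lambda>d. blinfun_apply d x) \<longlongrightarrow> s x) F" for x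
    using f \<open>bounded_linear f\<close> by (simp add: s_def bounded_linear_Blinfun_apply)
  have sM: "s \<in> M"
  proof (rule M_lim[OF F])
    \<comment> \<open>\<open>M_lim\<close> wants every index to give an element of \<open>M\<close>;
      the default \<open>d0\<close> outside \<open>D\<close> does not affect the limit, as
      \<open>D\<close> is eventually entered.\<close>
    show "(if d \<in> D then d else d0) \<in> M" for d
      using DM(1)[of d] DM(1)[OF d0] by simp
    show "((\<lambda>d. (if d \<in> D then d else d0) x) \<longlongrightarrow> s x) F" for x
      by (rule Lim_transform_eventually[OF s eventually_mono[OF evD]]) simp
  qed
  have "adj s = s"
  proof (rule adj_eqI)
    fix x y
    have "((\<lambda>d. cinner (blinfun_apply d x) y) \<longlongrightarrow> cinner (s x) y) F"
      by (intro tendsto_intros s)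
    then have "((\<lambda>d. cinner x (blinfun_apply d y)) \<longlongrightarrow> cinner (s x) y) F"
      by (rule Lim_transform_eventually[OF _ eventually_mono[OF evD]]) (simp add: cinner_adj DM)
    then show "cinner (s x) y = cinner x (s y)"
      by (rule tendsto_unique[OF F]) (intro tendsto_intros s)
  qed
  have qs: "((\<lambda>d. qform d x) \<longlongrightarrow> qform s x) F" for x
    unfolding qform_def by (intro tendsto_intros s)
  have up: "op_le d s" if "d \<in> D" for d
    unfolding op_le_iff
    by (intro allI tendsto_lowerbound[OF qs _ F] eventually_mono[OF ev_ge[OF that]]) (simp add: op_le_iff)
  have least: "op_le s v" if "\<And>d. d \<in> D \<Longrightarrow> op_le d v" for v
    unfolding op_le_iff
    by (intro allI tendsto_upperbound[OF qs _ F] eventually_mono[OF evD]) (use that in \<open>simp add: op_le_iff\<close>)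
  have "\<exists>d\<in>D. qform s x < qform d x + e" if "e > 0" for x e
  proof -
    have "\<forall>\<^sub>F d in F. qform s x - e < qform d x"
      using order_tendstoD(1)[OF qs, of "qform s x - e"] that by simp
    with evD have "\<forall>\<^sub>F d in F. d \<in> D \<and> qform s x - e < qform d x"
      by (rule eventually_conj)
    then obtain d where "d \<in> D \<and> qform s x - e < qform d x"
      using eventually_happens'[OF F] by blast
    then show ?thesis
      by (intro bexI[of _ d]) auto
  qed
  moreover have "op_lub M D s"
    using sM \<open>adj s = s\<close> up least by (simp add: op_lub_def self_adjoint_part_def)
  ultimately show ?thesis
    by blast
qed

lemma op_lub_unique: "op_lub M D s \<Longrightarrow> op_lub M D t \<Longrightarrow> s = t"
  by (rule op_le_antisym) (auto simp: op_lub_def self_adjoint_part_def M_clinear)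

text \<open>Suprema are unique, so any given one agrees with the strong limit constructed in
  \<open>directed_sup_ex\<close>.\<close>

lemma op_lub_approx:
  assumes D: "D \<subseteq> self_adjoint_part M" "D \<noteq> {}"
    and dir: "\<And>a b. a \<in> D \<Longrightarrow> b \<in> D \<Longrightarrow> \<exists>c\<in>D. op_le a c \<and> op_le b c"
    and s: "op_lub M D s" and e: "e > 0"
  shows "\<exists>d\<in>D. qform s x < qform d x + e"
proof -
  obtain t where t: "op_lub M D t" "\<forall>x. \<forall>e>0. \<exists>d\<in>D. qform t x < qform d x + e"
    using directed_sup_ex[OF D dir, of s] s by (auto simp: op_lub_def)
  then show ?thesis
    using op_lub_unique[OF s t(1)] e by blast
qed

end

section \<open>Faithful normal representations\<close>

locale normal_rep = vn K M
  for K :: "'h::complex_hilbert_space set" and M :: "'h oper set" +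
  fixes L :: "'k::complex_hilbert_space set" and \<pi> :: "'h oper \<Rightarrow> 'k oper"
  assumes rep: "faithful_normal_rep K M L \<pi>"
begin

lemma L: "closed_csubspace L" and pi_inj: "inj_on \<pi> M" and pi_normal: "normal_map M L \<pi>"
  using rep by (auto simp: faithful_normal_rep_def)

lemma
  shows pi_bo: "a \<in> M \<Longrightarrow> \<pi> a \<in> bounded_ops L"
    and pi_compose: "a \<in> M \<Longrightarrow> b \<in> M \<Longrightarrow> \<pi> (a o\<^sub>L b) = \<pi> a o\<^sub>L \<pi> b"
    and pi_add: "a \<in> M \<Longrightarrow> b \<in> M \<Longrightarrow> \<pi> (a + b) = \<pi> a + \<pi> b"
    and pi_scaleC: "a \<in> M \<Longrightarrow> \<pi> (c *\<^sub>C a) = c *\<^sub>C \<pi> a"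
    and pi_adj: "a \<in> M \<Longrightarrow> \<pi> (adj a) = adj (\<pi> a)"
  using rep unfolding faithful_normal_rep_def star_hom_def Ring.ring_hom_def oper_algebra_def
  by (auto simp: Pi_iff)

lemma pi_zero: "\<pi> 0 = 0"
  using pi_add[OF M_zero M_zero] by simp

lemma pi_diff: "a \<in> M \<Longrightarrow> b \<in> M \<Longrightarrow> \<pi> (a - b) = \<pi> a - \<pi> b"
  using pi_add[OF M_diff, of a b b] by (simp add: algebra_simps)

lemma pi_clinear: "a \<in> M \<Longrightarrow> clinear_op (\<pi> a)"
  by (rule bo_clinear[OF pi_bo])

lemma pi_eq_zero: "a \<in> M \<Longrightarrow> \<pi> a = 0 \<longleftrightarrow> a = 0"
  using pi_inj M_zero pi_zero by (metis inj_onD)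

lemma L_ne: "L \<noteq> {0}"
proof
  assume "L = {0}"
  then have "\<pi> (id_on K) = 0"
    by (intro blinfun_eqI) (use bo_in[OF pi_bo[OF M_one]] in auto)
  then have "id_on K = 0"
    by (simp add: pi_eq_zero M_one)
  then show False
    using one_apply K_ne csub_zero[OF K] by fastforce
qed

text \<open>A positive element of \<open>M\<close> is \<open>s* s\<close> with \<open>s\<close> in
  \<open>M\<close>, and \<open>\<pi>\<close> preserves such products.\<close>

lemma pi_pos:
  assumes "a \<in> M" "adj a = a" "\<And>x. 0 \<le> qform a x"
  shows "0 \<le> qform (\<pi> a) x"
proof -
  obtain s where s: "s \<in> M" "adj s = s" "s o\<^sub>L s = a"
    using sqrt_ex[OF assms] by blast
  have "\<pi> a = adj (\<pi> s) o\<^sub>L \<pi> s"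
    using s pi_adj[OF s(1)] pi_compose[OF s(1,1)] by simp
  then show ?thesis
    by (simp add: qform_sq pi_clinear s)
qed

lemma pi_mono:
  assumes "a \<in> M" "adj a = a" "b \<in> M" "adj b = b" "op_le a b"
  shows "op_le (\<pi> a) (\<pi> b)"
proof -
  have "0 \<le> qform (\<pi> (b - a)) x" for x
    by (rule pi_pos) (use assms in \<open>auto simp: M_diff adj_diff M_clinear qform_simps op_le_iff\<close>)
  then show ?thesis
    by (simp add: op_le_iff pi_diff assms qform_simps)
qed

text \<open>Normality yields a supremum in \<open>bounded_ops L\<close>, which is itself a von
  Neumann algebra, so the approximation of forms is available there.\<close>

lemma pi_sup_approx:
  assumes D: "D \<subseteq> self_adjoint_part M" "D \<noteq> {}"
    and dir: "\<And>a b. a \<in> D \<Longrightarrow> b \<in> D \<Longrightarrow> \<exists>c\<in>D. op_le a c \<and> op_le b c"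
    and s: "op_lub M D s" and e: "e > 0"
  shows "\<exists>d\<in>D. qform (\<pi> s) x < qform (\<pi> d) x + e"
proof -
  interpret B: vn L "bounded_ops L"
    by (rule vn.intro, rule von_neumann_algebra_bounded_ops[OF L L_ne])
  have DM: "a \<in> M" "adj a = a" if "a \<in> D" for a
    using D that by (auto simp: self_adjoint_part_def)
  have "\<exists>d\<in>\<pi> ` D. qform (\<pi> s) x < qform d x + e"
  proof (rule B.op_lub_approx[OF _ _ _ _ e])
    show "\<pi> ` D \<subseteq> self_adjoint_part (bounded_ops L)"
      using DM pi_bo by (auto simp: self_adjoint_part_def simp flip: pi_adj)
    show "op_lub (bounded_ops L) (\<pi> ` D) (\<pi> s)"
      using pi_normal D dir s unfolding normal_map_def by blast
    show "\<exists>c\<in>\<pi> ` D. op_le a c \<and> op_le b c" if ab: "a \<in> \<pi> ` D" "b \<in> \<pi> ` D" for a b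
    proof -
      obtain a' b' where ab': "a = \<pi> a'" "b = \<pi> b'" "a' \<in> D" "b' \<in> D"
        using ab by blast
      then obtain c where "c \<in> D" "op_le a' c" "op_le b' c"
        using dir by blast
      then show ?thesis
        using ab' by (intro bexI[of _ "\<pi> c"]) (auto intro!: pi_mono DM)
    qed
  qed (use D in auto)
  then show ?thesis
    by blast
qed

text \<open>A Radon--Nikodym type comparison of the vector functionals \<open>\<psi> = \<omega>\<^sub>\<eta>\<close> on \<open>K\<close> and
  \<open>\<phi> = \<omega>\<^sub>\<xi> \<circ> \<pi>\<close>, where \<open>\<psi> p < \<phi> p\<close> for the projection \<open>p\<close> onto \<open>[M' \<eta>]\<close>: by normality there
  is a maximal \<open>x\<close> in the order interval \<open>[0, p]\<close> with \<open>\<phi> x \<le> \<psi> x\<close>, and then \<open>\<psi> \<le> \<phi>\<close> below \<open>p - x\<close>.\<close>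
lemma dominated_vector_ex:
  assumes V: "closed_csubspace V" "V \<subseteq> K" "V \<noteq> {0}" and inv: "\<And>b x. b \<in> Mc \<Longrightarrow> x \<in> V \<Longrightarrow> b x \<in> V"
  shows "\<exists>\<eta>\<in>V. \<eta> \<noteq> 0 \<and> (\<exists>\<xi>. \<forall>a\<in>M. norm (blinfun_apply a \<eta>) \<le> norm (\<pi> a \<xi>))"
proof -
  interpret C: vn K Mc
    by (rule vn_Mc)
  obtain \<eta> where \<eta>: "\<eta> \<in> V" "\<eta> \<noteq> 0"
    using V csub_zero by blast
  define W where "W = cyc Mc \<eta>"
  have W: "closed_csubspace W" "W \<subseteq> V" "\<eta> \<in> W"
    using closed_csubspace_cyc C.cyc_minimal[OF V(1) \<eta>(1) inv] C.self_in_cyc \<eta> V by (auto simp: W_def)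
  define p where "p = id_on W"
  have pM: "p \<in> M"
    using C.id_on_cyc by (simp add: p_def W_def bicommutant)
  have p: "adj p = p" "p o\<^sub>L p = p" "clinear_op p"
    by (simp_all add: p_def adj_id_on id_on_idem W clinear_id_on)
  have p\<eta>: "p \<eta> = \<eta>"
    by (simp add: p_def id_on_id W)
  have "p \<noteq> 0"
    using p\<eta> \<eta> by auto
  then obtain \<xi>0 where "\<pi> p \<xi>0 \<noteq> 0"
    using pi_eq_zero[OF pM] by (metis blinfun_eqI zero_blinfun.rep_eq)
  moreover have "qform (\<pi> p) x = (norm (\<pi> p x))\<^sup>2" for x
    using qform_sq[OF pi_clinear[OF pM], of x] pi_adj[OF pM] pi_compose[OF pM pM] by (simp add: p)
  ultimately have pos0: "0 < qform (\<pi> p) \<xi>0"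
    by simp
  \<comment> \<open>Scaling \<open>\<xi>0\<close> makes the represented functional exceed the given
    one at \<open>p\<close>; the strict inequality keeps \<open>p\<close> out of
    \<open>X\<close>.\<close>
  obtain n where n: "qform p \<eta> < real n * qform (\<pi> p) \<xi>0"
    using reals_Archimedean3[OF pos0] by blast
  define \<xi> where "\<xi> = sqrt (real n) *\<^sub>R \<xi>0"
  have lt: "qform p \<eta> < qform (\<pi> p) \<xi>"
    using n by (simp add: \<xi>_def qform_def blinfun.scaleR_right cinner.scaleR_left cinner.scaleR_right)
  define X where "X = {x \<in> self_adjoint_part M. (\<forall>v. 0 \<le> qform x v) \<and> op_le x p \<and> qform (\<pi> x) \<xi> \<le> qform x \<eta>}"
  have XM: "x \<in> M" "adj x = x" if "x \<in> X" for x
    using that by (auto simp: X_def self_adjoint_part_def)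
  have "\<exists>x\<in>X. \<forall>a\<in>X. op_le x a \<longrightarrow> a = x"
  proof (rule predicate_Zorn)
    show "partial_order_on X (relation_of op_le X)"
      by (rule partial_order_on_relation_ofI)
        (auto intro: op_le_refl op_le_trans op_le_antisym simp: XM M_clinear)
    fix C assume "C \<in> Chains (relation_of op_le X)"
    then have CX: "C \<subseteq> X" and lin: "\<And>a b. a \<in> C \<Longrightarrow> b \<in> C \<Longrightarrow> op_le a b \<or> op_le b a"
      by (auto simp: Chains_def relation_of_def)
    show "\<exists>u\<in>X. \<forall>a\<in>C. op_le a u"
    proof (cases "C = {}")
      case True
      have "0 \<in> X"
        using qform_sq[OF p(3)]
        by (simp add: X_def self_adjoint_part_def M_zero qform_simps op_le_iff pi_zero p)
      with True show ?thesis
        by blast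
    next
      case False
      have Csa: "C \<subseteq> self_adjoint_part M"
        using CX by (auto simp: X_def)
      have dir: "\<exists>c\<in>C. op_le a c \<and> op_le b c" if "a \<in> C" "b \<in> C" for a b
        using lin[OF that] that op_le_refl by blast
      have le_p: "op_le d p" if "d \<in> C" for d
        using CX that by (auto simp: X_def)
      obtain s where s: "op_lub M C s"
        using directed_sup_ex[OF Csa False dir le_p] by blast
      have le_s: "op_le d s" if "d \<in> C" for d
        using s that by (auto simp: op_lub_def)
      have "qform (\<pi> s) \<xi> \<le> qform s \<eta>"
      proof (rule field_le_epsilon)
        fix e :: real assume "0 < e"
        then obtain d where d: "d \<in> C" "qform (\<pi> s) \<xi> < qform (\<pi> d) \<xi> + e"
          using pi_sup_approx[OF Csa False dir s] by blast
        moreover have "qform (\<pi> d) \<xi> \<le> qform d \<eta>" "qform d \<eta> \<le> qform s \<eta>"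
          using CX d le_s[OF d(1)] by (auto simp: X_def op_le_iff)
        ultimately show "qform (\<pi> s) \<xi> \<le> qform s \<eta> + e"
          by simp
      qed
      moreover have "0 \<le> qform s v" for v
      proof -
        obtain d where "d \<in> C"
          using False by blast
        then have "0 \<le> qform d v" "qform d v \<le> qform s v"
          using CX le_s by (auto simp: X_def op_le_iff)
        then show ?thesis
          by simp
      qed
      moreover have "op_le s p"
        using s le_p pM p by (auto simp: op_lub_def self_adjoint_part_def)
      ultimately have "s \<in> X"
        using s by (simp add: X_def op_lub_def)
      with le_s show ?thesis
        by blast
    qed
  qed
  then obtain x where x: "x \<in> X" and max: "\<And>a. a \<in> X \<Longrightarrow> op_le x a \<Longrightarrow> a = x"
    by blast
  define y where "y = p - x"
  have y: "y \<in> M" "adj y = y"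
    using x XM pM p by (simp_all add: y_def M_diff adj_diff M_clinear)
  have ypos: "0 \<le> qform y v" and y_le: "qform y v \<le> qform p v" for v
    using x by (simp_all add: y_def qform_simps X_def op_le_iff)
  obtain r where r: "r \<in> M" "adj r = r" "r o\<^sub>L r = y"
    using sqrt_ex[OF y ypos] by blast
  note r_cl = M_clinear[OF r(1)]
  have r_kernel: "r v = 0" if "qform y v \<le> 0" for v
    using positive_sq_sqrt_kernel[OF r_cl r(2), of v] that ypos[of v] by (simp add: r(3))
  \<comment> \<open>From \<open>y \<le> p\<close>, the root \<open>r\<close> of \<open>y\<close>
    vanishes wherever \<open>p\<close> does.\<close>
  have rp: "r o\<^sub>L p = r"
  proof (rule blinfun_eqI)
    fix v
    have "qform p (v - p v) = 0"
      using compose_apply[OF p(2)] by (simp add: qform_def blinfun.diff_right cinner.zero_left)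
    then have "r (v - p v) = 0"
      using y_le[of "v - p v"] by (intro r_kernel) simp
    then show "(r o\<^sub>L p) v = r v"
      by (simp add: blinfun.diff_right)
  qed
  then have pr: "p o\<^sub>L r = r"
    using adj_compose[OF r_cl p(3)] by (simp add: p r)
  \<comment> \<open>If \<open>r \<eta> = 0\<close>, then \<open>r\<close> kills
    \<open>M' \<eta>\<close> and hence \<open>W\<close>, the range of \<open>p\<close>. Then
    \<open>y = 0\<close>, and \<open>p = x\<close> would lie in \<open>X\<close>.\<close>
  have "r \<eta> \<noteq> 0"
  proof
    assume r0: "r \<eta> = 0"
    have "r v = 0" if "v \<in> W" for v
    proof -
      have "W \<subseteq> {v. r v = 0}"
        unfolding W_def cyc_def
        by (rule ccspan_minimal[OF _ closed_csubspace_kernel[OF r_cl]])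
          (auto simp: Mc_commute_apply[OF r(1)] r0)
      with that show ?thesis
        by blast
    qed
    then have "r = 0"
      using compose_apply[OF rp] id_on_in[OF W(1)] by (intro blinfun_eqI) (metis p_def zero_blinfun.rep_eq)
    then have "p = x"
      using r(3) by (simp add: y_def)
    then show False
      using x lt by (simp add: X_def)
  qed
  moreover have "r \<eta> \<in> V"
    using compose_apply[OF pr, of \<eta>] id_on_in[OF W(1), of "r \<eta>"] W(2) by (auto simp: p_def)
  moreover have "norm (blinfun_apply a (r \<eta>)) \<le> norm (\<pi> a (\<pi> r \<xi>))" if a: "a \<in> M" for a
  proof (rule ccontr)
    assume less: "\<not> ?thesis"
    define b where "b = a o\<^sub>L r"
    have b: "b \<in> M" "adj b \<in> M"
      using a r by (auto simp: b_def M_compose adj_M)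
    define k where "k = (norm a)\<^sup>2 + 1"
    have k: "0 < k"
      by (simp add: k_def add_nonneg_pos)
    \<comment> \<open>If the estimate failed at \<open>a\<close>, then
      \<open>z = r a* a r / k\<close> could be added to \<open>x\<close>: the factor
      \<open>1 / k\<close> ensures \<open>z \<le> r\<^sup>2 = y\<close>, and the failed estimate
      keeps \<open>x + z\<close> in \<open>X\<close>, against maximality.\<close>
    define z where "z = (1 / k) *\<^sub>R (adj b o\<^sub>L b)"
    have z: "z \<in> M" "adj z = z"
      using b by (auto simp: z_def M_scaleR M_compose)
        (simp add: scaleR_eq_scaleC_op adj_scaleC adj_compose M_clinear M_compose adj_adj)
    have qz: "qform z v = (norm (a (r v)))\<^sup>2 / k" for v
      using qform_sq[OF M_clinear[OF b(1)], of v] by (simp add: z_def qform_simps b_def)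
    have q\<pi>z: "qform (\<pi> z) v = (norm (\<pi> a (\<pi> r v)))\<^sup>2 / k" for v
    proof -
      have "\<pi> z = (1 / k) *\<^sub>R (adj (\<pi> b) o\<^sub>L \<pi> b)"
        unfolding z_def scaleR_eq_scaleC_op
        by (subst pi_scaleC) (simp_all add: M_compose b pi_compose pi_adj scaleR_eq_scaleC_op
            vn.scaleR_eq_scaleC_op[OF vn.intro[OF von_neumann_algebra_bounded_ops[OF L L_ne]]])
      then show ?thesis
        using qform_sq[OF pi_clinear[OF b(1)], of v] by (simp add: qform_simps b_def pi_compose a r)
    qed
    have zy: "qform z v \<le> qform y v" for v
    proof -
      have "(norm (a (r v)))\<^sup>2 \<le> (norm a * norm (r v))\<^sup>2"
        by (intro power_mono norm_blinfun) simp
      also have "\<dots> \<le> k * (norm (r v))\<^sup>2"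
        by (simp add: k_def power_mult_distrib mult_right_mono)
      finally show ?thesis
        using k qform_sq[OF r_cl, of v] by (simp add: qz r field_simps)
    qed
    have "(norm (\<pi> a (\<pi> r \<xi>)))\<^sup>2 < (norm (a (r \<eta>)))\<^sup>2"
      using less by (intro power_strict_mono) auto
    then have lt_z: "qform (\<pi> z) \<xi> < qform z \<eta>"
      using k by (simp add: qz q\<pi>z divide_strict_right_mono)
    have zpos: "0 \<le> qform z v" for v
      using k by (simp add: qz)
    have "x + z \<in> X"
      using x z XM[OF x] lt_z zpos zy
      by (auto simp: X_def self_adjoint_part_def M_add adj_add M_clinear qform_simps op_le_iff pi_add y_def
          add_nonneg_nonneg algebra_simps intro: add_mono)
    then have "x + z = x"
      by (rule max) (simp add: op_le_iff qform_simps zpos)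
    then show False
      using lt_z by (simp add: pi_zero qform_simps)
  qed
  ultimately show ?thesis
    by blast
qed

end

section \<open>Minimal projections\<close>

definition projections :: "'h::complex_hilbert_space oper set \<Rightarrow> 'h oper set" where
  "projections M = {p \<in> M. p o\<^sub>L p = p \<and> adj p = p}"

text \<open>For projections, \<open>p o\<^sub>L q = q\<close> encodes the order relation
  \<open>q \<le> p\<close>.\<close>

definition minimal_projection :: "'h::complex_hilbert_space oper set \<Rightarrow> 'h oper \<Rightarrow> bool" where
  "minimal_projection M p \<longleftrightarrow> p \<in> projections M \<and> p \<noteq> 0 \<and>
     (\<forall>q\<in>projections M. p o\<^sub>L q = q \<longrightarrow> q = 0 \<or> q = p)"

lemma projectionsD: "p \<in> projections M \<Longrightarrow> p \<in> M" "p \<in> projections M \<Longrightarrow> p o\<^sub>L p = p"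
  "p \<in> projections M \<Longrightarrow> adj p = p"
  by (simp_all add: projections_def)

lemma orthogonal_projections_iff:
  "P \<subseteq> M \<and> orthogonal_projections P \<longleftrightarrow>
   P \<subseteq> projections M - {0} \<and> (\<forall>p\<in>P. \<forall>q\<in>P. p \<noteq> q \<longrightarrow> p o\<^sub>L q = 0)"
  by (auto simp: orthogonal_projections_def projections_def)

section \<open>The order of projections, and corners at minimal projections\<close>

context vn
begin

lemma proj_clinear: "p \<in> projections M \<Longrightarrow> clinear_op p"
  by (simp add: projections_def M_clinear)

lemma proj_le_commute: "p \<in> projections M \<Longrightarrow> q \<in> projections M \<Longrightarrow> p o\<^sub>L q = q \<longleftrightarrow> q o\<^sub>L p = q"
  by (metis adj_compose proj_clinear projectionsD(3))

lemma proj_orth_commute: "p \<in> projections M \<Longrightarrow> q \<in> projections M \<Longrightarrow> p o\<^sub>L q = 0 \<longleftrightarrow> q o\<^sub>L p = 0"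
  by (metis adj_compose proj_clinear projectionsD(3) adj_zero)

lemma proj_diff:
  assumes "p \<in> projections M" "q \<in> projections M" "p o\<^sub>L q = q"
  shows "p - q \<in> projections M"
  using assms proj_le_commute[OF assms(1,2)]
  by (auto simp: projections_def M_diff adj_diff M_clinear compose_distrib)

lemma proj_add:
  assumes "p \<in> projections M" "q \<in> projections M" "p o\<^sub>L q = 0"
  shows "p + q \<in> projections M"
  using assms proj_orth_commute[OF assms(1,2)]
  by (auto simp: projections_def M_add adj_add M_clinear compose_distrib)

lemma one_proj: "id_on K \<in> projections M"
  by (simp add: projections_def M_one id_on_idem adj_id_on K)

lemma one_compose: "a \<in> M \<Longrightarrow> id_on K o\<^sub>L a = a" "a \<in> M \<Longrightarrow> a o\<^sub>L id_on K = a"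
  by (simp_all add: bo_id_left bo_id_right K M_bo)

lemma id_on_proj: "closed_csubspace V \<Longrightarrow> id_on V \<in> M \<Longrightarrow> id_on V \<in> projections M"
  by (simp add: projections_def id_on_idem adj_id_on)

lemma qform_proj: "p \<in> projections M \<Longrightarrow> qform p x = (norm (p x))\<^sup>2"
  using qform_sq[of p x] by (simp add: proj_clinear projectionsD)

text \<open>The middle clause is there for the induction: it makes the next member orthogonal to the
  partial sum.\<close>

lemma proj_sum:
  assumes "finite P" "P \<subseteq> projections M" "\<And>p q. p \<in> P \<Longrightarrow> q \<in> P \<Longrightarrow> p \<noteq> q \<Longrightarrow> p o\<^sub>L q = 0"
  shows "\<Sum>P \<in> projections M \<and> (\<forall>q\<in>projections M. (\<forall>p\<in>P. p o\<^sub>L q = 0) \<longrightarrow> \<Sum>P o\<^sub>L q = 0) \<and>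
    (\<forall>p\<in>P. \<Sum>P o\<^sub>L p = p)"
  using assms
proof (induction P rule: finite_induct)
  case empty
  then show ?case
    by (simp add: projections_def M_zero)
next
  case (insert x F)
  have IH: "\<Sum>F \<in> projections M" "\<And>q. q \<in> projections M \<Longrightarrow> (\<And>p. p \<in> F \<Longrightarrow> p o\<^sub>L q = 0) \<Longrightarrow> \<Sum>F o\<^sub>L q = 0"
    "\<And>p. p \<in> F \<Longrightarrow> \<Sum>F o\<^sub>L p = p"
    using insert by auto
  have x: "x \<in> projections M"
    using insert by simp
  have Fx: "\<Sum>F o\<^sub>L x = 0"
    by (rule IH(2)[OF x]) (use insert in blast)
  have "x + \<Sum>F \<in> projections M"
    using proj_add[OF IH(1) x Fx] by (simp add: add.commute)
  then show ?case
    using insert.hyps insert.prems IH Fx x projectionsD(2)[OF x] by (auto simp: compose_distrib)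
qed

text \<open>With \<open>S\<close> the absolute value of \<open>T\<close>, the element
  \<open>c = S + T\<close> is twice the positive part. The projection onto its closed range lies in
  \<open>M\<close> below \<open>p\<close>. By minimality either \<open>c = 0\<close>, so that
  \<open>T = -S\<close>, or this projection is \<open>p\<close>, and then
  \<open>(S - T) c = 0\<close> forces \<open>S = T\<close>.\<close>

lemma self_adjoint_definite_in_minimal_corner:
  assumes p: "minimal_projection M p" and T: "T \<in> M" "adj T = T" "T o\<^sub>L p = T"
  shows "(\<forall>x. 0 \<le> qform T x) \<or> (\<forall>x. qform T x \<le> 0)"
proof -
  have pp: "p \<in> projections M"
    using p by (simp add: minimal_projection_def)
  note pM = projectionsD(1)[OF pp] and p_cl = proj_clinear[OF pp]
  have pT: "p o\<^sub>L T = T"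
    using adj_compose[of T p] T projectionsD[OF pp] p_cl M_clinear by simp
  obtain S where S: "S \<in> M" "adj S = S" "\<And>x. 0 \<le> qform S x" "S o\<^sub>L S = T o\<^sub>L T"
    and comm: "\<And>b. b \<in> M \<Longrightarrow> (T o\<^sub>L T) o\<^sub>L b = b o\<^sub>L (T o\<^sub>L T) \<Longrightarrow> S o\<^sub>L b = b o\<^sub>L S"
  proof -
    have "0 \<le> qform (T o\<^sub>L T) x" for x
      using qform_sq[OF M_clinear[OF T(1)], of x] T by simp
    moreover have "adj (T o\<^sub>L T) = T o\<^sub>L T"
      using T by (simp add: adj_compose M_clinear)
    ultimately show ?thesis
      using sqrt_ex[OF M_compose[OF T(1) T(1)]] that one_compose by metis
  qed
  have ST: "S o\<^sub>L T = T o\<^sub>L S"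
    by (rule comm[OF T(1)]) (simp add: blinfun_compose_assoc)
  \<comment> \<open>The squares of \<open>S\<close> and \<open>T\<close> agree, hence
    \<open>\<parallel>S v\<parallel> = \<parallel>T v\<parallel>\<close> for all \<open>v\<close>,
    and the kernels coincide.\<close>
  have Sp: "S o\<^sub>L p = S"
  proof (rule blinfun_eqI)
    fix v
    have "(norm (S (v - p v)))\<^sup>2 = (norm (T (v - p v)))\<^sup>2"
      using qform_sq[OF M_clinear[OF T(1)], of "v - p v"] qform_sq[OF M_clinear[OF S(1)], of "v - p v"] S T
      by simp
    also have "T (v - p v) = 0"
      using compose_apply[OF T(3), of v] by (simp add: blinfun.diff_right)
    finally show "(S o\<^sub>L p) v = S v"
      by (simp add: blinfun.diff_right)
  qed
  have pS: "p o\<^sub>L S = S"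
    using adj_compose[of S p] Sp S(1,2) projectionsD[OF pp] p_cl M_clinear by simp
  define c where "c = S + T"
  have cM: "c \<in> M" and pc: "p o\<^sub>L c = c"
    using S T pT pS by (simp_all add: c_def M_add compose_distrib)
  show ?thesis
  proof (cases "c = 0")
    case True
    then have "qform T x = - qform S x" for x
      using qform_simps(1)[of S T x] qform_simps(4)[of x] by (simp add: c_def)
    then show ?thesis
      using S by simp
  next
    case False
    define V where "V = ccspan (range c)"
    have V: "closed_csubspace V"
      by (simp add: V_def closed_csubspace_ccspan)
    have Vp: "p v = v" if "v \<in> V" for v
    proof -
      have "V \<subseteq> {v. (p - id_blinfun) v = 0}"
        unfolding V_def
        by (rule ccspan_minimal[OF _ closed_csubspace_kernel])
          (auto simp: compose_apply[OF pc] blinfun.diff_left clinear_diff p_cl clinear_op_def[of id_blinfun])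
      then show ?thesis
        using that by (auto simp: blinfun.diff_left)
    qed
    have VK: "V \<subseteq> K"
      using Vp bo_in[OF M_bo[OF pM]] by (metis subsetI)
    \<comment> \<open>The closed range of an element of \<open>M\<close> is invariant under the
      commutant.\<close>
    have "id_on V \<in> M"
    proof (rule id_on_in_M[OF V VK])
      fix b x assume b: "b \<in> Mc" and x: "x \<in> V"
      have "V \<subseteq> {x. b x \<in> V}"
        unfolding V_def
      proof (rule ccspan_minimal)
        show "range c \<subseteq> {x. b x \<in> ccspan (range c)}"
          using ccspan_superset[of "range c"] by (auto simp flip: Mc_commute_apply[OF cM b])
      qed (intro closed_csubspace_op_vimage bo_clinear[OF Mc_bo[OF b]] closed_csubspace_ccspan)
      then show "b x \<in> V"
        using x by blast
    qed
    then have q: "id_on V \<in> projections M"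
      by (rule id_on_proj[OF V])
    have "p o\<^sub>L id_on V = id_on V"
      by (rule blinfun_eqI) (simp add: Vp id_on_in[OF V])
    moreover have qc: "id_on V o\<^sub>L c = c"
      by (rule blinfun_eqI) (simp add: V_def id_on_id[OF closed_csubspace_ccspan] subsetD[OF ccspan_superset])
    then have "id_on V \<noteq> 0"
      using False by auto
    ultimately have qp: "id_on V = p"
      using p q by (auto simp: minimal_projection_def)
    have bc: "(S - T) o\<^sub>L c = 0"
      by (simp add: c_def compose_distrib S(4) ST)
    have "(S - T) v = (0 :: 'h oper) v" if "v \<in> V" for v
      by (rule op_eq_on_ccspan[OF _ _ _ that[unfolded V_def]])
        (auto simp: clinear_diff clinear_zero M_clinear S T compose_apply[OF bc])
    then have "(S - T) (p v) = 0" for v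
      using id_on_in[OF V] by (simp add: flip: qp)
    moreover have "(S - T) (p v) = (S - T) v" for v
      using compose_apply[OF Sp, of v] compose_apply[OF T(3), of v] by (simp add: blinfun.diff_left)
    ultimately have "S = T"
      by (intro blinfun_eqI) (simp add: blinfun.diff_left)
    then show ?thesis
      using S by simp
  qed
qed

text \<open>Every \<open>a - c p\<close> is definite, so the reals \<open>c\<close> with
  \<open>c p \<le> a\<close> and the remaining ones form a cut; at its supremum \<open>m\<close> the
  form of \<open>a - m p\<close> vanishes.\<close>

lemma self_adjoint_minimal_corner:
  assumes p: "minimal_projection M p" and a: "a \<in> M" "adj a = a" "a o\<^sub>L p = a"
  shows "\<exists>m::real. a = m *\<^sub>R p"
proof -
  have pp: "p \<in> projections M" and p0: "p \<noteq> 0"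
    using p by (auto simp: minimal_projection_def)
  note pD = projectionsD[OF pp] and p_cl = proj_clinear[OF pp]
  have definite: "(\<forall>x. c * qform p x \<le> qform a x) \<or> (\<forall>x. qform a x \<le> c * qform p x)" for c
  proof -
    have "adj (a - c *\<^sub>R p) = a - c *\<^sub>R p"
      using a pD by (simp add: adj_diff M_clinear M_scaleR) (simp add: scaleR_eq_scaleC_op adj_scaleC p_cl)
    then have "(\<forall>x. 0 \<le> qform (a - c *\<^sub>R p) x) \<or> (\<forall>x. qform (a - c *\<^sub>R p) x \<le> 0)"
      using a pD by (intro self_adjoint_definite_in_minimal_corner[OF p]) (simp_all add: M_diff M_scaleR compose_distrib)
    then show ?thesis
      by (simp add: qform_simps)
  qed
  have q0: "0 \<le> qform p x" for x
    by (simp add: qform_proj[OF pp])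
  obtain x0 where "p x0 \<noteq> 0"
    using p0 by (metis blinfun_eqI zero_blinfun.rep_eq)
  then have pos: "0 < qform p x0"
    by (simp add: qform_proj[OF pp])
  define I where "I = {c. \<forall>x. c * qform p x \<le> qform a x}"
  define m where "m = Sup I"
  have "- norm a \<in> I"
  proof -
    have "- norm a * qform p x \<le> qform a x" for x
    proof -
      have ap: "qform a x = qform a (p x)"
        using compose_apply[OF a(3), of x] adj_compose[of a p] a pD p_cl M_clinear
        by (simp add: qform_def) (metis blinfun_apply_blinfun_compose cinner_adj)
      have "- qform a (p x) = qform (- a) (p x)"
        using qform_simps(2)[of 0 a "p x"] by (simp add: qform_simps)
      also have "\<dots> \<le> norm a * (norm (p x))\<^sup>2"
        using qform_le_norm[of "- a" "p x"] by simp
      finally show ?thesis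
        by (simp add: ap qform_proj[OF pp])
    qed
    then show ?thesis
      by (simp add: I_def)
  qed
  then have ne: "I \<noteq> {}"
    by blast
  have bdd: "bdd_above I"
    using pos by (intro bdd_aboveI[of _ "qform a x0 / qform p x0"]) (auto simp: I_def field_simps)
  have "qform (a - m *\<^sub>R p) x = 0" for x
  proof (cases "qform p x = 0")
    case True
    \<comment> \<open>Where the form of \<open>p\<close> vanishes, some \<open>c\<close> in
      \<open>I\<close> bounds the form of \<open>a\<close> below by \<open>0\<close>, and some
      \<open>c\<close> outside \<open>I\<close> bounds it above by \<open>0\<close>.\<close>
    have "0 \<le> qform a x"
    proof -
      obtain c where "\<forall>x. c * qform p x \<le> qform a x"
        using ne unfolding I_def by blast
      then show ?thesis
        using True by (metis mult_zero_right)
    qed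
    moreover have "qform a x \<le> 0"
    proof -
      obtain c where "c \<notin> I"
        using bdd by (meson bdd_above_def gt_ex not_le)
      then have "\<forall>x. qform a x \<le> c * qform p x"
        using definite[of c] by (auto simp: I_def)
      then show ?thesis
        using True by (metis mult_zero_right)
    qed
    ultimately show ?thesis
      using True ne by (force simp: qform_simps)
  next
    case False
    then have px: "0 < qform p x"
      using q0[of x] by simp
    have "m \<le> qform a x / qform p x"
      unfolding m_def by (rule cSup_least[OF ne]) (use px in \<open>auto simp: I_def field_simps\<close>)
    moreover have "qform a x / qform p x \<le> m"
    proof (rule dense_ge)
      fix c assume "m < c"
      then have "c \<notin> I"
        using cSup_upper[OF _ bdd, of c] by (auto simp: m_def)
      then show "qform a x / qform p x \<le> c"
        using definite[of c] px by (auto simp: I_def field_simps)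
    qed
    ultimately show ?thesis
      using px by (simp add: qform_simps field_simps)
  qed
  then have "a - m *\<^sub>R p = 0"
    using a pD by (intro qform_zero_imp_zero)
      (auto simp: clinear_diff M_clinear M_scaleR adj_diff, simp add: scaleR_eq_scaleC_op adj_scaleC p_cl)
  then show ?thesis
    by auto
qed

text \<open>The real and imaginary parts of \<open>a\<close> are self-adjoint elements of the same
  corner.\<close>

lemma minimal_corner:
  assumes p: "minimal_projection M p" and a: "a \<in> M" "p o\<^sub>L a = a" "a o\<^sub>L p = a"
  shows "\<exists>c. a = c *\<^sub>C p"
proof -
  have pp: "p \<in> projections M"
    using p by (simp add: minimal_projection_def)
  note pD = projectionsD[OF pp] and p_cl = proj_clinear[OF pp] and a_cl = M_clinear[OF a(1)]
  have ap: "adj a \<in> M" "adj a o\<^sub>L p = adj a"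
    using a adj_compose[OF p_cl a_cl] pD by (simp_all add: adj_M)
  have "\<exists>m::real. a + adj a = m *\<^sub>R p"
    using a ap by (intro self_adjoint_minimal_corner[OF p])
      (simp_all add: M_add adj_add a_cl clinear_adj adj_adj compose_distrib add.commute)
  then obtain m :: real where m: "a + adj a = m *\<^sub>R p" ..
  have "\<exists>n::real. \<i> *\<^sub>C (a - adj a) = n *\<^sub>R p"
  proof (rule self_adjoint_minimal_corner[OF p])
    have "adj (\<i> *\<^sub>C (a - adj a)) = - \<i> *\<^sub>C (adj a - a)"
      using a_cl by (simp add: adj_scaleC adj_diff clinear_diff clinear_adj adj_adj)
    also have "\<dots> = \<i> *\<^sub>C (a - adj a)"
      by (metis complex_vector.scale_minus_left complex_vector.scale_minus_right minus_diff_eq)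
    finally show "adj (\<i> *\<^sub>C (a - adj a)) = \<i> *\<^sub>C (a - adj a)" .
  qed (use a ap in \<open>simp_all add: M_scaleC M_diff compose_scaleC_left compose_distrib\<close>)
  then obtain n :: real where n: "\<i> *\<^sub>C (a - adj a) = n *\<^sub>R p" ..
  have "2 *\<^sub>C a = (a + adj a) + (- \<i>) *\<^sub>C \<i> *\<^sub>C (a - adj a)"
    using scaleC_add_left[of 1 1 a] by (simp add: scaleC_scaleC)
  also have "\<dots> = (of_real m - \<i> * of_real n) *\<^sub>C p"
    by (simp add: m n scaleR_eq_scaleC_op scaleC_scaleC complex_vector.scale_left_diff_distrib)
  finally have "a = ((of_real m - \<i> * of_real n) / 2) *\<^sub>C p"
    by (metis (no_types, lifting) complex_vector.scale_scale divide_inverse mult.commute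
        complex_vector.scale_one left_inverse zero_neq_numeral)
  then show ?thesis
    by blast
qed

text \<open>For nonzero \<open>w\<close> in \<open>q M p\<close>, minimality gives
  \<open>w w* = d q\<close> with \<open>d \<noteq> 0\<close>, and \<open>w* a = e p\<close>. Hence
  \<open>d a = w w* a = e w\<close>.\<close>

lemma minimal_off_diagonal:
  assumes p: "minimal_projection M p" and q: "minimal_projection M q"
  shows "\<exists>w\<in>M. \<forall>a\<in>M. q o\<^sub>L a = a \<and> a o\<^sub>L p = a \<longrightarrow> (\<exists>c. a = c *\<^sub>C w)"
proof (cases "\<forall>a\<in>M. q o\<^sub>L a = a \<and> a o\<^sub>L p = a \<longrightarrow> a = 0")
  case True
  then show ?thesis
    using M_zero by (intro bexI[of _ 0]) (auto intro: exI[of _ 0])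
next
  case False
  then obtain w where w: "w \<in> M" "q o\<^sub>L w = w" "w o\<^sub>L p = w" "w \<noteq> 0"
    by blast
  have pq: "p \<in> projections M" "q \<in> projections M"
    using p q by (auto simp: minimal_projection_def)
  note w_cl = M_clinear[OF w(1)]
  have wa: "adj w \<in> M" "p o\<^sub>L adj w = adj w" "adj w o\<^sub>L q = adj w"
    using w adj_compose[OF proj_clinear[OF pq(2)] w_cl] adj_compose[OF w_cl proj_clinear[OF pq(1)]]
      projectionsD[OF pq(1)] projectionsD[OF pq(2)] by (simp_all add: adj_M)
  obtain d where d: "w o\<^sub>L adj w = d *\<^sub>C q"
    using minimal_corner[OF q, of "w o\<^sub>L adj w"] w wa M_compose
    by (metis blinfun_compose_assoc)
  have "d \<noteq> 0"
  proof
    assume "d = 0"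
    then have "(norm (adj w x))\<^sup>2 = 0" for x
      using qform_sq[OF clinear_adj[OF w_cl], of x] d by (simp add: adj_adj w_cl qform_simps)
    then have "adj w = 0"
      by (intro blinfun_eqI) simp
    then show False
      using adj_adj[OF w_cl] w(4) by simp
  qed
  have "\<exists>c. a = c *\<^sub>C w" if a: "a \<in> M" "q o\<^sub>L a = a" "a o\<^sub>L p = a" for a
  proof -
    obtain e where e: "adj w o\<^sub>L a = e *\<^sub>C p"
      using minimal_corner[OF p, of "adj w o\<^sub>L a"] a wa M_compose
      by (metis blinfun_compose_assoc)
    have "d *\<^sub>C a = (w o\<^sub>L adj w) o\<^sub>L a"
      by (simp add: d compose_scaleC_left a)
    also have "\<dots> = w o\<^sub>L (e *\<^sub>C p)"
      by (simp add: e blinfun_compose_assoc)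
    also have "\<dots> = e *\<^sub>C w"
      by (simp add: compose_scaleC_right w_cl w)
    finally have "a = (e / d) *\<^sub>C w"
      using \<open>d \<noteq> 0\<close> by (metis complex_vector.scale_scale divide_inverse mult.commute
          complex_vector.scale_one left_inverse)
    then show ?thesis
      by blast
  qed
  then show ?thesis
    using w by blast
qed

subsection \<open>Finite-dimensional algebras\<close>

text \<open>Equivalent to finite dimension by \<open>finite_dimensional_iff\<close>, but free of any
  reference to the unit or to a spanning set, so that it passes at once to the center and to
  corners.\<close>

definition orth_families_finite :: bool where
  "orth_families_finite \<longleftrightarrow> (\<forall>P\<subseteq>M. orthogonal_projections P \<longrightarrow> finite P)"

text \<open>A strictly descending sequence of projections would have infinitely many nonzero
  orthogonal differences, so the order on nonzero projections is well-founded.\<close>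

lemma minimal_below:
  assumes fin: orth_families_finite and e: "e \<in> projections M" "e \<noteq> 0"
  shows "\<exists>p. minimal_projection M p \<and> e o\<^sub>L p = p"
proof -
  define r where "r = {(q, p). q \<in> projections M \<and> p \<in> projections M \<and> q \<noteq> 0 \<and> q \<noteq> p \<and> p o\<^sub>L q = q}"
  have "wf r"
    unfolding wf_iff_no_infinite_down_chain
  proof (rule notI, elim exE)
    fix f assume f: "\<forall>i. (f (Suc i), f i) \<in> r"
    have fp: "f i \<in> projections M" "f (Suc i) \<noteq> f i" "f i o\<^sub>L f (Suc i) = f (Suc i)" for i
      using f by (auto simp: r_def)
    have le: "f i o\<^sub>L f (i + k) = f (i + k)" for i k
    proof (induction k)
      case 0
      then show ?case
        by (simp add: projectionsD[OF fp(1)])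
    next
      case (Suc k)
      then show ?case
        using fp(3)[of "i + k"] by (metis add_Suc_right blinfun_compose_assoc)
    qed
    define d where "d i = f i - f (Suc i)" for i
    have dp: "d i \<in> projections M" for i
      unfolding d_def by (rule proj_diff[OF fp(1) fp(1) fp(3)])
    have d0: "d i \<noteq> 0" for i
      using fp(2)[of i] by (auto simp: d_def)
    have orth: "d i o\<^sub>L d j = 0" if "i < j" for i j
    proof -
      have le': "f i o\<^sub>L f j = f j" "f i o\<^sub>L f (Suc j) = f (Suc j)"
        "f (Suc i) o\<^sub>L f j = f j" "f (Suc i) o\<^sub>L f (Suc j) = f (Suc j)"
        using le[of i "j - i"] le[of i "Suc j - i"] le[of "Suc i" "j - Suc i"] le[of "Suc i" "Suc j - Suc i"] that
        by simp_all
      show ?thesis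
        by (simp add: d_def compose_distrib le')
    qed
    have orth': "d i o\<^sub>L d j = 0" if "i \<noteq> j" for i j
      using orth[of i j] orth[of j i] that proj_orth_commute[OF dp dp] by (metis linorder_neqE_nat)
    have "inj d"
      using orth' projectionsD(2)[OF dp] d0 by (metis injI)
    then have "infinite (range d)"
      by (rule range_inj_infinite)
    moreover have "range d \<subseteq> M" "orthogonal_projections (range d)"
      using dp d0 by (auto simp: orthogonal_projections_def projections_def intro!: orth')
    ultimately show False
      using fin by (simp add: orth_families_finite_def)
  qed
  from wfE_min[OF this, of e "{q \<in> projections M. q \<noteq> 0 \<and> e o\<^sub>L q = q}"]
  obtain p where p: "p \<in> projections M" "p \<noteq> 0" "e o\<^sub>L p = p"
    and min: "\<And>q. (q, p) \<in> r \<Longrightarrow> \<not> (q \<in> projections M \<and> q \<noteq> 0 \<and> e o\<^sub>L q = q)"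
    using e projectionsD(2)[OF e(1)] by (simp add: conj_commute) (metis (no_types, lifting))
  have "q = 0 \<or> q = p" if q: "q \<in> projections M" "p o\<^sub>L q = q" for q
  proof (rule ccontr)
    assume ne: "\<not> ?thesis"
    have "e o\<^sub>L q = q"
      using p(3) q(2) by (metis blinfun_compose_assoc)
    then show False
      using min[of q] q p ne by (simp add: r_def)
  qed
  then show ?thesis
    using p by (auto simp: minimal_projection_def)
qed

text \<open>The complement of a maximal orthogonal family of minimal projections has no minimal
  projection below it, so it is zero by \<open>minimal_below\<close>.\<close>

lemma minimal_decomposition:
  assumes fin: orth_families_finite
  shows "\<exists>P. finite P \<and> (\<forall>p\<in>P. minimal_projection M p) \<and> (\<forall>p\<in>P. \<forall>q\<in>P. p \<noteq> q \<longrightarrow> p o\<^sub>L q = 0) \<and>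
    \<Sum>P = id_on K"
proof -
  obtain P where P: "\<forall>p\<in>P. minimal_projection M p" "\<forall>p\<in>P. \<forall>q\<in>P. p \<noteq> q \<longrightarrow> p o\<^sub>L q = 0"
    and max: "\<forall>q. minimal_projection M q \<and> (q \<noteq> q \<longrightarrow> q o\<^sub>L q = 0) \<and>
      (\<forall>p\<in>P. (p \<noteq> q \<longrightarrow> p o\<^sub>L q = 0) \<and> (q \<noteq> p \<longrightarrow> q o\<^sub>L p = 0)) \<longrightarrow> q \<in> P"
    using maximal_pairwise_family_ex[of "minimal_projection M" "\<lambda>p q. p \<noteq> q \<longrightarrow> p o\<^sub>L q = 0"]
    by (elim exE conjE)
  have Pp: "P \<subseteq> projections M" and orth: "\<And>p q. p \<in> P \<Longrightarrow> q \<in> P \<Longrightarrow> p \<noteq> q \<Longrightarrow> p o\<^sub>L q = 0"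
    using P by (auto simp: minimal_projection_def)
  have "P \<subseteq> M \<and> orthogonal_projections P"
    unfolding orthogonal_projections_iff using P by (auto simp: minimal_projection_def)
  then have finP: "finite P"
    using fin by (simp add: orth_families_finite_def)
  have s: "\<Sum>P \<in> projections M" "\<forall>p\<in>P. \<Sum>P o\<^sub>L p = p"
    using proj_sum[OF finP Pp orth] by simp_all
  define e where "e = id_on K - \<Sum>P"
  have e: "e \<in> projections M"
    unfolding e_def by (rule proj_diff[OF one_proj s(1)]) (simp add: one_compose projectionsD[OF s(1)])
  have "e = 0"
  proof (rule ccontr)
    assume "e \<noteq> 0"
    then obtain q where q: "minimal_projection M q" "e o\<^sub>L q = q"
      using minimal_below[OF fin e] by blast
    have qp: "q \<in> projections M" "q \<noteq> 0"
      using q by (auto simp: minimal_projection_def)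
    have pq: "p o\<^sub>L q = 0" if "p \<in> P" for p
    proof -
      have pp: "p \<in> projections M"
        using Pp that by blast
      have "p o\<^sub>L \<Sum>P = p"
        using proj_le_commute[OF s(1) pp] s(2) that by simp
      then have "p o\<^sub>L e = 0"
        by (simp add: e_def compose_distrib one_compose projectionsD[OF pp])
      then show ?thesis
        using q(2) by (metis blinfun_compose_assoc compose_zero(1))
    qed
    have "q o\<^sub>L p = 0" if "p \<in> P" for p
      using pq[OF that] proj_orth_commute[OF _ qp(1)] Pp that by blast
    then have "q \<in> P"
      using max q(1) pq by blast
    then show False
      using pq[of q] projectionsD(2)[OF qp(1)] qp(2) by simp
  qed
  then show ?thesis
    using finP P by (auto simp: e_def)
qed

text \<open>The unit is a finite sum of minimal projections, so \<open>M\<close> is the sum of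
  finitely many spaces \<open>q M p\<close>, each of dimension at most one.\<close>

lemma orth_families_finite_imp_finite_dimensional:
  assumes fin: orth_families_finite
  shows "finite_dimensional M"
proof -
  obtain P where P': "finite P" "\<forall>p\<in>P. minimal_projection M p" and sum: "\<Sum>P = id_on K"
    using minimal_decomposition[OF fin] by blast
  then have P: "finite P" "\<And>p. p \<in> P \<Longrightarrow> minimal_projection M p"
    by simp_all
  have pM: "p \<in> M" "p o\<^sub>L p = p" if "p \<in> P" for p
    using P(2)[OF that] by (auto simp: minimal_projection_def projections_def)
  define w where "w p q = (SOME w. w \<in> M \<and> (\<forall>a\<in>M. q o\<^sub>L a = a \<and> a o\<^sub>L p = a \<longrightarrow> (\<exists>c. a = c *\<^sub>C w)))" for p q
  have wP: "w p q \<in> M \<and> (\<forall>a\<in>M. q o\<^sub>L a = a \<and> a o\<^sub>L p = a \<longrightarrow> (\<exists>c. a = c *\<^sub>C w p q))"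
    if "p \<in> P" "q \<in> P" for p q
    unfolding w_def by (rule someI_ex, fold Bex_def, rule minimal_off_diagonal[OF P(2)[OF that(1)] P(2)[OF that(2)]])
  then have w: "\<And>p q. p \<in> P \<Longrightarrow> q \<in> P \<Longrightarrow> w p q \<in> M"
    and span: "\<And>p q a. p \<in> P \<Longrightarrow> q \<in> P \<Longrightarrow> a \<in> M \<Longrightarrow> q o\<^sub>L a = a \<Longrightarrow> a o\<^sub>L p = a \<Longrightarrow> \<exists>c. a = c *\<^sub>C w p q"
    by simp_all
  define B where "B = (\<lambda>(p, q). w p q) ` (P \<times> P)"
  have "complex_vector.span B = M"
  proof
    show "complex_vector.span B \<subseteq> M"
      by (rule complex_vector.span_minimal)
        (auto simp: B_def w complex_vector.subspace_def M_zero M_add M_scaleC)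
    show "M \<subseteq> complex_vector.span B"
    proof
      fix a assume a: "a \<in> M"
      have "a = (\<Sum>P o\<^sub>L a) o\<^sub>L \<Sum>P"
        by (simp add: sum one_compose a)
      also have "\<dots> = (\<Sum>q\<in>P. \<Sum>p\<in>P. q o\<^sub>L a o\<^sub>L p)"
        by (rule blinfun_eqI, simp add: blinfun.sum_left blinfun.sum_right, rule sum.swap)
      also have "\<dots> \<in> complex_vector.span B"
      proof (intro complex_vector.span_sum)
        fix p q assume pq: "p \<in> P" "q \<in> P"
        have "q o\<^sub>L (q o\<^sub>L a o\<^sub>L p) = q o\<^sub>L a o\<^sub>L p" "(q o\<^sub>L a o\<^sub>L p) o\<^sub>L p = q o\<^sub>L a o\<^sub>L p"
          by (simp add: pM(2)[OF pq(2)] flip: blinfun_compose_assoc)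
            (simp add: pM(2)[OF pq(1)] blinfun_compose_assoc)
        then have "\<exists>c. q o\<^sub>L a o\<^sub>L p = c *\<^sub>C w p q"
          by (intro span[OF pq] M_compose pM(1) pq a)
        then obtain c where "q o\<^sub>L a o\<^sub>L p = c *\<^sub>C w p q" ..
        moreover have "w p q \<in> B"
          unfolding B_def by (rule image_eqI[of _ _ "(p, q)"]) (simp_all add: pq)
        ultimately show "q o\<^sub>L a o\<^sub>L p \<in> complex_vector.span B"
          using complex_vector.span_scale[OF complex_vector.span_base] by simp
      qed
      finally show "a \<in> complex_vector.span B" .
    qed
  qed
  moreover have "finite B"
    using P by (simp add: B_def)
  ultimately show ?thesis
    by (auto simp: finite_dimensional_def)
qed

lemma orthogonal_projections_independent:
  assumes P: "P \<subseteq> M" "orthogonal_projections P"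
  shows "\<not> complex_vector.dependent P"
  unfolding complex_vector.dependent_explicit
proof (rule notI, elim exE conjE)
  fix F and u :: "'h oper \<Rightarrow> complex" assume F: "finite F" "F \<subseteq> P" "(\<Sum>v\<in>F. u v *\<^sub>C v) = 0" "\<exists>v\<in>F. u v \<noteq> 0"
  then obtain p where p: "p \<in> F" "u p \<noteq> 0"
    by blast
  have orth: "v o\<^sub>L p = (if v = p then p else 0)" if "v \<in> F" for v
    using that p F(2) P(2) unfolding orthogonal_projections_def by (metis subsetD)
  have "0 = (\<Sum>v\<in>F. u v *\<^sub>C v) o\<^sub>L p"
    by (simp add: F)
  also have "\<dots> = (\<Sum>v\<in>F. u v *\<^sub>C (v o\<^sub>L p))"
    by (rule blinfun_eqI) (simp add: blinfun.sum_left scaleC_blinfun.rep_eq)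
  also have "\<dots> = (\<Sum>v\<in>F. if v = p then u p *\<^sub>C p else 0)"
    by (intro sum.cong) (auto simp: orth)
  also have "\<dots> = u p *\<^sub>C p"
    using F p by simp
  finally show False
    using p F P by (auto simp: orthogonal_projections_def)
qed

lemma finite_dimensional_bound:
  assumes "finite_dimensional M"
  shows "\<exists>n. \<forall>P\<subseteq>M. orthogonal_projections P \<longrightarrow> finite P \<and> card P \<le> n"
proof -
  obtain B where B: "finite B" "complex_vector.span B = M"
    using assms by (auto simp: finite_dimensional_def)
  then show ?thesis
    using complex_vector.independent_span_bound[OF B(1)] orthogonal_projections_independent by metis
qed

lemma finite_dimensional_iff: "finite_dimensional M \<longleftrightarrow> orth_families_finite"
  using finite_dimensional_bound orth_families_finite_imp_finite_dimensional
  unfolding orth_families_finite_def by blast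

end

section \<open>Cardinalities\<close>

lemma countable_card_le:
  assumes "countable A" "infinite N"
  shows "|A| \<le>o |N|"
proof -
  obtain f :: "_ \<Rightarrow> nat" where "inj_on f A"
    using assms(1) by (auto simp: countable_def)
  then have "|A| \<le>o |UNIV :: nat set|"
    by (intro card_of_ordLeq[THEN iffD1]) auto
  also have "|UNIV :: nat set| \<le>o |N|"
    using assms(2) infinite_iff_card_of_nat by blast
  finally show ?thesis .
qed

text \<open>The recurring counting scheme: \<open>P\<close> is an orthogonal family,
  \<open>E\<close> a set of vectors such that each member of \<open>P\<close> meets one of them, and
  Bessel's inequality makes the fibres countable. The infinite cardinal \<open>|N|\<close> absorbs
  the countable factor.\<close>

lemma card_le_by_countable_fibres:
  assumes N: "infinite N" "|E| \<le>o |N|" and ex: "\<And>p. p \<in> P \<Longrightarrow> \<exists>e\<in>E. R p e"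
    and count: "\<And>e. e \<in> E \<Longrightarrow> countable {p \<in> P. R p e}"
  shows "|P| \<le>o |N|"
proof -
  have "P \<subseteq> (\<Union>e\<in>E. {p \<in> P. R p e})"
    using ex by blast
  then have "|P| \<le>o |\<Union>e\<in>E. {p \<in> P. R p e}|"
    by (rule card_of_mono1)
  also have "|\<Union>e\<in>E. {p \<in> P. R p e}| \<le>o |N|"
    using count by (intro card_of_UNION_ordLeq_infinite N ballI countable_card_le)
  finally show ?thesis .
qed

lemma card_Times_le:
  assumes "infinite N" "|A| \<le>o |N|" "|B| \<le>o |N|"
  shows "|A \<times> B| \<le>o |N|"
  using card_of_Times_ordLeq_infinite_Field[of "|N|" A B] assms card_of_Card_order[of N] by (simp add: Field_card_of)

lemma card_Un_le:
  assumes "infinite N" "|A| \<le>o |N|" "|B| \<le>o |N|"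
  shows "|A \<union> B| \<le>o |N|"
  using card_of_Un_ordLeq_infinite_Field[of "|N|" A B] assms card_of_Card_order[of N] by (simp add: Field_card_of)

lemma card_image_le_o: "|A| \<le>o |N| \<Longrightarrow> |f ` A| \<le>o |N|"
  by (rule ordLeq_transitive[OF card_of_image])

lemma card_lists_le:
  assumes N: "infinite N" "|A| \<le>o |N|"
  shows "|lists A| \<le>o |N|"
proof -
  have len: "|{xs \<in> lists A. length xs = n}| \<le>o |N|" for n
  proof (induction n)
    case 0
    have "{xs \<in> lists A. length xs = 0} = {[]}"
      by auto
    then show ?case
      using countable_card_le[OF _ N(1), of "{[]}"] by simp
  next
    case (Suc n)
    have "{xs \<in> lists A. length xs = Suc n} \<subseteq> (\<lambda>(x, xs). x # xs) ` (A \<times> {xs \<in> lists A. length xs = n})"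
    proof
      fix xs assume "xs \<in> {xs \<in> lists A. length xs = Suc n}"
      then obtain y ys where "xs = y # ys" "y \<in> A" "ys \<in> lists A" "length ys = n"
        by (cases xs) auto
      then show "xs \<in> (\<lambda>(x, xs). x # xs) ` (A \<times> {xs \<in> lists A. length xs = n})"
        by auto
    qed
    then show ?case
      by (rule ordLeq_transitive[OF card_of_mono1]) (intro card_image_le_o card_Times_le N Suc.IH)
  qed
  have "lists A \<subseteq> (\<Union>n. {xs \<in> lists A. length xs = n})"
    by auto
  then have "|lists A| \<le>o |\<Union>n. {xs \<in> lists A. length xs = n}|"
    by (rule card_of_mono1)
  also have "|\<Union>n. {xs \<in> lists A. length xs = n}| \<le>o |N|"
    by (intro card_of_UNION_ordLeq_infinite[OF N(1)] ballI len countable_card_le[OF _ N(1)]) simp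
  finally show ?thesis .
qed

text \<open>For each ball of radius \<open>1 / (n + 1)\<close> about a point of \<open>D\<close>
  that meets the image, one parameter landing in it is selected. Balls are needed because
  \<open>D\<close> may lie outside the image.\<close>

lemma dense_parameters_ex:
  fixes f :: "'x \<Rightarrow> 'm::metric_space"
  assumes N: "infinite N" "|D| \<le>o |N|" and sub: "f ` X \<subseteq> closure D"
  shows "\<exists>T\<subseteq>X. |T| \<le>o |N| \<and> f ` X \<subseteq> closure (f ` T)"
proof -
  define g where "g = (\<lambda>(n, d). SOME x. x \<in> X \<and> dist (f x) d < 1 / real (Suc n))"
  define J where "J = {(n, d). d \<in> D \<and> (\<exists>x\<in>X. dist (f x) d < 1 / real (Suc n))}"
  have g: "g (n, d) \<in> X" "dist (f (g (n, d))) d < 1 / real (Suc n)" if "(n, d) \<in> J" for n d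
    using someI_ex[of "\<lambda>x. x \<in> X \<and> dist (f x) d < 1 / real (Suc n)"] that by (auto simp: g_def J_def)
  have "|J| \<le>o |(UNIV :: nat set) \<times> D|"
    by (rule card_of_mono1) (auto simp: J_def)
  also have "|(UNIV :: nat set) \<times> D| \<le>o |N|"
    by (intro card_Times_le N countable_card_le) auto
  finally have "|g ` J| \<le>o |N|"
    by (rule card_image_le_o)
  moreover have "g ` J \<subseteq> X"
    using g(1) by auto
  moreover have "f x \<in> closure (f ` g ` J)" if x: "x \<in> X" for x
    unfolding closure_approachable
  proof (intro allI impI)
    fix e :: real assume "0 < e"
    then obtain n where n: "1 / real (Suc n) < e / 2"
      using nat_approx_posE[of "e / 2"] by auto
    obtain d where d: "d \<in> D" "dist d (f x) < 1 / real (Suc n)"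
      using sub x closure_approachable[of "f x" D]
      by (metis image_subset_iff of_nat_0_less_iff zero_less_Suc zero_less_divide_1_iff)
    then have J: "(n, d) \<in> J"
      using x by (auto simp: J_def dist_commute)
    have "dist (f (g (n, d))) (f x) < e"
      using dist_triangle[of "f (g (n, d))" "f x" d] g(2)[OF J] d n by simp
    then show "\<exists>y\<in>f ` g ` J. dist y (f x) < e"
      using J by blast
  qed
  ultimately show ?thesis
    by (intro exI[of _ "g ` J"]) auto
qed

text \<open>Finite combinations with coefficients from a countable dense set of scalars are coded as
  lists.\<close>

lemma ccspan_dense_ex:
  fixes B :: "'h::complex_hilbert_space set"
  assumes N: "infinite N" "|B| \<le>o |N|"
  shows "\<exists>D. |D| \<le>o |N| \<and> ccspan B \<subseteq> closure D"
proof -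
  obtain Q :: "complex set" where Q: "countable Q" "\<And>X. open X \<Longrightarrow> X \<noteq> {} \<Longrightarrow> \<exists>d\<in>Q. d \<in> X"
    using countable_dense_exists[where 'a = complex] by auto
  define h where "h = (\<lambda>xs. sum_list (map (\<lambda>(c, b). c *\<^sub>C (b :: 'h)) xs))"
  define D where "D = h ` lists (Q \<times> B)"
  have "|D| \<le>o |N|"
    unfolding D_def by (intro card_image_le_o card_lists_le card_Times_le N countable_card_le Q)
  moreover have "ccspan B \<subseteq> closure D"
    unfolding ccspan_def
  proof (rule closure_minimal)
    show "complex_vector.span B \<subseteq> closure D"
    proof
      fix x assume "x \<in> complex_vector.span B"
      then show "x \<in> closure D"
      proof (induction rule: complex_vector.span_induct_alt)
        case base
        have "h [] \<in> D"
          unfolding D_def by (rule imageI) simp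
        then show ?case
          using closure_subset by (auto simp: h_def)
      next
        case (step c b y)
        show ?case
          unfolding closure_approachable
        proof (intro allI impI)
          fix e :: real assume e: "0 < e"
          \<comment> \<open>Keeps the error of the coefficient, scaled by
            \<open>\<parallel>b\<parallel>\<close>, within \<open>e/2\<close>; the
            \<open>+ 1\<close> covers \<open>b = 0\<close>.\<close>
          define r where "r = e / (2 * (norm b + 1))"
          have nb: "0 < norm b + 1"
            by (simp add: add_nonneg_pos)
          then have r: "0 < r"
            using e by (simp add: r_def)
          obtain q where q: "q \<in> Q" "q \<in> ball c r"
            using Q(2)[of "ball c r"] r by auto
          obtain d where d: "d \<in> D" "dist d y < e / 2"
            using step.IH e unfolding closure_approachable by (meson half_gt_zero)
          then obtain xs where xs: "xs \<in> lists (Q \<times> B)" "d = h xs"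
            by (auto simp: D_def)
          have "h ((q, b) # xs) \<in> D"
            unfolding D_def using xs(1) q(1) step.hyps(1) by (intro imageI) simp
          then have "q *\<^sub>C b + d \<in> D"
            by (simp add: h_def xs(2))
          moreover have "dist (q *\<^sub>C b + d) (c *\<^sub>C b + y) < e"
          proof -
            have "(q *\<^sub>C b + d) - (c *\<^sub>C b + y) = (q - c) *\<^sub>C b + (d - y)"
              by (simp add: complex_vector.scale_left_diff_distrib)
            then have "dist (q *\<^sub>C b + d) (c *\<^sub>C b + y) \<le> cmod (q - c) * norm b + dist d y"
              unfolding dist_norm using norm_triangle_ineq[of "(q - c) *\<^sub>C b" "d - y"] by (simp only: norm_scaleC)
            also have "cmod (q - c) * norm b \<le> r * (norm b + 1)"
              using q(2) r by (intro mult_mono) (auto simp: dist_norm norm_minus_commute)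
            also have "r * (norm b + 1) = e / 2"
              using less_imp_neq[OF nb] unfolding r_def by (metis divide_divide_eq_left divide_divide_eq_right
                  mult.commute nonzero_divide_eq_eq)
            finally show ?thesis
              using d(2) by simp
          qed
          ultimately show "\<exists>z\<in>D. dist z (c *\<^sub>C b + y) < e"
            by blast
        qed
      qed
    qed
  qed simp
  ultimately show ?thesis
    by blast
qed

section \<open>Orthonormal bases\<close>

text \<open>Bessel's inequality. The second assumption says that \<open>u i\<close> is the component of \<open>v\<close> along
  \<open>u i\<close>; it covers projections applied to \<open>v\<close> as well as orthonormal expansions.\<close>
lemma orthogonal_components_sum_le:
  fixes u :: "'i \<Rightarrow> 'h::complex_hilbert_space"
  assumes F: "finite F" and orth: "\<And>i j. i \<in> F \<Longrightarrow> j \<in> F \<Longrightarrow> i \<noteq> j \<Longrightarrow> cinner (u i) (u j) = 0"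
    and comp: "\<And>i. i \<in> F \<Longrightarrow> cinner (u i) v = of_real ((norm (u i))\<^sup>2)"
  shows "(\<Sum>i\<in>F. (norm (u i))\<^sup>2) \<le> (norm v)\<^sup>2"
proof -
  define w where "w = sum u F"
  have uw: "cinner (u i) w = of_real ((norm (u i))\<^sup>2)" if "i \<in> F" for i
  proof -
    have "cinner (u i) w = (\<Sum>j\<in>F. if j = i then of_real ((norm (u i))\<^sup>2) else 0)"
      unfolding w_def cinner.sum_right using that by (intro sum.cong) (auto simp: orth cinner_same)
    then show ?thesis
      using that F by simp
  qed
  have "cinner w w = (\<Sum>i\<in>F. of_real ((norm (u i))\<^sup>2))"
    using uw unfolding w_def cinner.sum_left by simp
  then have ww: "(norm w)\<^sup>2 = (\<Sum>i\<in>F. (norm (u i))\<^sup>2)"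
    unfolding cinner_same by (metis of_real_eq_iff of_real_sum)
  have "cinner w v = (\<Sum>i\<in>F. of_real ((norm (u i))\<^sup>2))"
    using comp by (simp add: w_def cinner.sum_left)
  also have "\<dots> = of_real ((norm w)\<^sup>2)"
    by (simp add: ww)
  finally have "(norm w)\<^sup>2 = cmod (cinner w v)"
    by (simp add: norm_power)
  also have "\<dots> \<le> norm w * norm v"
    by (rule cmod_cinner_le)
  finally have "norm w \<le> norm v"
    by (cases "w = 0") (auto simp: power2_eq_square)
  then show ?thesis
    by (simp add: power_mono flip: ww)
qed

text \<open>The uniform bound on finite sums makes the squared norms summable, and a summable family
  of reals has countable support.\<close>

lemma orthogonal_components_countable:
  fixes u :: "'i \<Rightarrow> 'h::complex_hilbert_space"
  assumes orth: "\<And>i j. i \<in> I \<Longrightarrow> j \<in> I \<Longrightarrow> i \<noteq> j \<Longrightarrow> cinner (u i) (u j) = 0"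
    and comp: "\<And>i. i \<in> I \<Longrightarrow> cinner (u i) v = of_real ((norm (u i))\<^sup>2)"
  shows "countable {i \<in> I. u i \<noteq> 0}"
proof -
  have "(\<lambda>i. (norm (u i))\<^sup>2) summable_on I"
  proof (rule nonneg_bdd_above_summable_on)
    show "bdd_above (sum (\<lambda>i. (norm (u i))\<^sup>2) ` {F. F \<subseteq> I \<and> finite F})"
      by (rule bdd_aboveI2[of _ _ "(norm v)\<^sup>2"], rule orthogonal_components_sum_le)
        (use orth comp in \<open>auto simp del: of_real_power\<close>)
  qed simp
  from summable_countable_real[OF this] show ?thesis
    by simp
qed

text \<open>The vector \<open>P i v\<close> is the component of \<open>v\<close> in the range of
  \<open>P i\<close>, so Bessel's inequality applies to these vectors.\<close>

lemma countable_nonorthogonal: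
  fixes P :: "'p \<Rightarrow> 'h::complex_hilbert_space oper"
  assumes "\<And>i. i \<in> I \<Longrightarrow> clinear_op (P i) \<and> P i o\<^sub>L P i = P i \<and> adj (P i) = P i"
    and "\<And>i j. i \<in> I \<Longrightarrow> j \<in> I \<Longrightarrow> i \<noteq> j \<Longrightarrow> P i o\<^sub>L P j = 0"
  shows "countable {i \<in> I. P i v \<noteq> 0}"
proof (rule orthogonal_components_countable)
  fix i assume i: "i \<in> I"
  have "cinner (P i v) v = cinner (P i (P i v)) v"
    using compose_apply[of "P i" "P i" "P i" v] assms(1)[OF i] by simp
  also have "\<dots> = cinner (P i v) (P i v)"
    using cinner_adj[of "P i" "P i v" v] assms(1)[OF i] by simp
  finally show "cinner (P i v) v = of_real ((norm (P i v))\<^sup>2)"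
    by (simp only: cinner_same)
next
  fix i j assume ij: "i \<in> I" "j \<in> I" "i \<noteq> j"
  have "cinner (P i v) (P j v) = cinner v (P i (P j v))"
    using cinner_adj[of "P i" v "P j v"] assms(1)[OF ij(1)] by simp
  then show "cinner (P i v) (P j v) = 0"
    using compose_apply[OF assms(2)[OF ij], of v] by (simp add: cinner.zero_right)
qed

definition orthonormal :: "'h::complex_hilbert_space set \<Rightarrow> bool" where
  "orthonormal B \<longleftrightarrow> (\<forall>x\<in>B. \<forall>y\<in>B. cinner x y = (if x = y then 1 else 0))"

lemma orthonormal_basis_iff: "orthonormal_basis K B \<longleftrightarrow> orthonormal B \<and> ccspan B = K"
  by (simp add: orthonormal_basis_def orthonormal_def ccspan_def)

text \<open>No \<open>b\<close> is orthogonal to all of \<open>Y\<close>, and by Bessel's inequality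
  each \<open>y\<close> is non-orthogonal to only countably many \<open>b\<close>.\<close>

lemma card_orthonormal_le:
  assumes B: "orthonormal B" "B \<subseteq> ccspan Y" and N: "infinite N" "|Y| \<le>o |N|"
  shows "|B| \<le>o |N|"
proof (rule card_le_by_countable_fibres[OF N])
  fix b assume b: "b \<in> B"
  show "\<exists>y\<in>Y. cinner y b \<noteq> 0"
  proof (rule ccontr)
    assume "\<not> ?thesis"
    then have "b \<in> orth_compl (ccspan Y)"
      unfolding orth_compl_ccspan by (auto simp: orth_compl_def cinner_eq_zero_commute)
    with b B have "b = 0"
      by (intro orth_compl_Int_eq_zero[of b "ccspan Y"]) auto
    moreover have "cinner b b = 1"
      using B(1) b by (simp add: orthonormal_def)
    ultimately show False
      by (simp add: cinner.zero_left)
  qed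
next
  fix y
  have "countable {b \<in> B. cinner y b *\<^sub>C b \<noteq> 0}"
  proof (rule orthogonal_components_countable)
    show "cinner (cinner y b *\<^sub>C b) (cinner y c *\<^sub>C c) = 0" if "b \<in> B" "c \<in> B" "b \<noteq> c" for b c
      using B(1) that by (simp add: orthonormal_def cinner_scaleC_left cinner_scaleC_right)
    show "cinner (cinner y b *\<^sub>C b) y = of_real ((norm (cinner y b *\<^sub>C b))\<^sup>2)" if "b \<in> B" for b
    proof -
      have bb: "cinner b b = 1"
        using B(1) that by (simp add: orthonormal_def)
      have "cinner (cinner y b *\<^sub>C b) y = cinner y b * (cnj (cinner y b) * cinner b b)"
        by (simp only: bb cinner_scaleC_left cinner_commute[of b y] mult_1_right)
      also have "\<dots> = cinner (cinner y b *\<^sub>C b) (cinner y b *\<^sub>C b)"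
        by (simp only: cinner_scaleC_left cinner_scaleC_right mult.left_commute)
      finally show ?thesis
        by (simp only: cinner_same)
    qed
  qed
  moreover have "b \<noteq> 0" if "b \<in> B" for b
    using B(1) that unfolding orthonormal_def by (metis cinner_same_eq_zero zero_neq_one)
  ultimately show "countable {b \<in> B. cinner y b \<noteq> 0}"
    by (auto elim!: countable_subset[rotated] simp: complex_vector.scale_eq_0_iff)
qed

lemma orthonormal_basis_ex:
  assumes K: "closed_csubspace K"
  shows "\<exists>B. orthonormal_basis K B"
proof -
  obtain B where BK: "\<forall>x\<in>B. x \<in> K" and on: "\<forall>x\<in>B. \<forall>y\<in>B. cinner x y = (if x = y then 1 else 0)"
    and max: "\<forall>z. z \<in> K \<and> cinner z z = (if z = z then 1 else 0) \<and>
      (\<forall>x\<in>B. cinner x z = (if x = z then 1 else 0) \<and> cinner z x = (if z = x then 1 else 0)) \<longrightarrow> z \<in> B"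
    using maximal_pairwise_family_ex[of "\<lambda>x. x \<in> K" "\<lambda>x y. cinner x y = (if x = y then 1 else 0)"]
    by (elim exE conjE)
  have "ccspan B = K"
  proof (rule ccspan_eqI[OF K])
    show "B \<subseteq> K"
      using BK by blast
    fix x assume x: "x \<in> K" "x \<in> orth_compl B"
    show "x = 0"
    proof (rule ccontr)
      assume x0: "x \<noteq> 0"
      define y where "y = complex_of_real (1 / norm x) *\<^sub>C x"
      have "norm y = 1"
        using x0 by (simp add: y_def norm_scaleC norm_divide)
      then have yy: "cinner y y = 1"
        by (simp add: cinner_same)
      have yB: "cinner y b = 0 \<and> cinner b y = 0" if "b \<in> B" for b
        using x(2) that by (simp add: y_def orth_compl_def cinner_scaleC_left cinner_scaleC_right cinner_eq_zero_commute[of b])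
      have "y \<in> K"
        unfolding y_def by (rule csub_scale[OF K x(1)])
      moreover have "cinner b y = (if b = y then 1 else 0) \<and> cinner y b = (if y = b then 1 else 0)"
        if "b \<in> B" for b
        using yB[OF that] yy by auto
      ultimately have "y \<in> B"
        using yy by (intro max[rule_format] conjI ballI) simp_all
      then show False
        using yB[of y] yy by simp
    qed
  qed
  moreover have "orthonormal B"
    unfolding orthonormal_def by (rule on)
  ultimately show ?thesis
    unfolding orthonormal_basis_iff by blast
qed

lemma hilbert_dim_obtain:
  assumes "closed_csubspace K"
  obtains B where "orthonormal_basis K B" "hilbert_dim K = |B|"
  using someI_ex[OF orthonormal_basis_ex[OF assms]] by (simp add: hilbert_dim_def)

lemma orthogonal_independent:
  fixes A :: "'h::complex_hilbert_space set"
  assumes orth: "\<And>x y. x \<in> A \<Longrightarrow> y \<in> A \<Longrightarrow> x \<noteq> y \<Longrightarrow> cinner x y = 0" and "0 \<notin> A"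
  shows "\<not> complex_vector.dependent A"
  unfolding complex_vector.dependent_explicit
proof (rule notI, elim exE conjE)
  fix F and u :: "'h \<Rightarrow> complex" assume F: "finite F" "F \<subseteq> A" "(\<Sum>v\<in>F. u v *\<^sub>C v) = 0" "\<exists>v\<in>F. u v \<noteq> 0"
  then obtain p where p: "p \<in> F" "u p \<noteq> 0"
    by blast
  have "0 = cinner (\<Sum>v\<in>F. u v *\<^sub>C v) p"
    by (simp add: F cinner.zero_left)
  also have "\<dots> = (\<Sum>v\<in>F. u v * cinner v p)"
    by (simp add: cinner.sum_left cinner_scaleC_left)
  also have "\<dots> = (\<Sum>v\<in>F. if v = p then u p * cinner p p else 0)"
    by (intro sum.cong) (use orth F(2) p in auto)
  also have "\<dots> = u p * cinner p p"
    using F p by simp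
  finally show False
    using p F assms(2) by auto
qed

lemma finite_orthonormal_basis_span:
  assumes B: "orthonormal_basis L B" "finite B" and x: "x \<in> L"
  shows "x \<in> complex_vector.span B"
proof -
  have L: "ccspan B = L" "closed_csubspace L"
    using B closed_csubspace_ccspan[of B] by (auto simp: orthonormal_basis_iff)
  define y where "y = (\<Sum>b\<in>B. cinner x b *\<^sub>C b)"
  have yspan: "y \<in> complex_vector.span B"
    unfolding y_def by (intro complex_vector.span_sum complex_vector.span_scale complex_vector.span_base)
  have "cinner (x - y) c = 0" if "c \<in> B" for c
  proof -
    have "cinner y c = (\<Sum>b\<in>B. if b = c then cinner x c else 0)"
      unfolding y_def cinner.sum_left using B that
      by (intro sum.cong) (auto simp: orthonormal_basis_iff orthonormal_def cinner_scaleC_left)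
    then show ?thesis
      using that B(2) by (simp add: cinner.diff_left)
  qed
  then have "x - y \<in> orth_compl L"
    unfolding L(1)[symmetric] by (simp add: orth_compl_def[of B])
  moreover have "x - y \<in> L"
    using x yspan closure_subset L by (intro csub_diff) (auto simp: ccspan_def)
  ultimately have "x - y = 0"
    using orth_compl_Int_eq_zero by blast
  then show ?thesis
    using yspan by simp
qed

section \<open>The cardinal invariants\<close>

lemma min_card_props:
  assumes "R \<noteq> {}" "\<And>r. r \<in> R \<Longrightarrow> Card_order r"
  shows "min_card R \<in> R" "s \<in> R \<Longrightarrow> min_card R \<le>o s"
proof -
  have "\<exists>r. r \<in> R \<and> (\<forall>s\<in>R. r \<le>o s)"
    using exists_minim_Card_order[of R] assms by blast
  from someI_ex[OF this] show "min_card R \<in> R" "s \<in> R \<Longrightarrow> min_card R \<le>o s"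
    by (simp_all add: min_card_def)
qed

lemma max_card_props:
  assumes "r \<in> R" "\<And>s. s \<in> R \<Longrightarrow> s \<le>o r"
  shows "max_card R \<in> R" "s \<in> R \<Longrightarrow> s \<le>o max_card R"
proof -
  have "\<exists>r. r \<in> R \<and> (\<forall>s\<in>R. s \<le>o r)"
    using assms by blast
  from someI_ex[OF this] show "max_card R \<in> R" "s \<in> R \<Longrightarrow> s \<le>o max_card R"
    by (simp_all add: max_card_def)
qed

subsection \<open>The decomposability number\<close>

context vn
begin

lemma cyc_orthogonal:
  assumes "\<And>a. a \<in> M \<Longrightarrow> cinner (a x) y = 0"
  shows "cyc M y \<subseteq> orth_compl (cyc M x)"
proof (rule cyc_minimal[OF closed_csubspace_orth_compl])
  show "y \<in> orth_compl (cyc M x)"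
    unfolding cyc_def orth_compl_ccspan using assms
    by (auto simp: orth_compl_def cinner_eq_zero_commute[of y])
  show "a z \<in> orth_compl (cyc M x)" if "a \<in> M" "z \<in> orth_compl (cyc M x)" for a z
    using that cyc_inv[OF adj_M[OF that(1)]] by (auto simp: orth_compl_def cinner_adj[OF M_clinear])
qed

text \<open>Projections onto cyclic subspaces of an algebra lie in its commutant. With
  \<open>Mc\<close>, or the commutant of the center, in place of \<open>M\<close>, cyclic families
  are thus bounded by orthogonal families in \<open>M\<close> or in the center.\<close>

lemma orthogonal_cyc_projections:
  assumes E: "E \<subseteq> K" "\<And>x. x \<in> E \<Longrightarrow> x \<noteq> 0"
    and orth: "\<And>x y a. x \<in> E \<Longrightarrow> y \<in> E \<Longrightarrow> x \<noteq> y \<Longrightarrow> a \<in> M \<Longrightarrow> cinner (a x) y = 0"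
  shows "inj_on (\<lambda>x. id_on (cyc M x)) E" "(\<lambda>x. id_on (cyc M x)) ` E \<subseteq> Mc"
    "orthogonal_projections ((\<lambda>x. id_on (cyc M x)) ` E)"
proof -
  let ?p = "\<lambda>x. id_on (cyc M x)"
  have px: "?p x x = x" if "x \<in> E" for x
    using that E(1) self_in_cyc by (intro id_on_id closed_csubspace_cyc) auto
  have prod: "?p x o\<^sub>L ?p y = 0" if "x \<in> E" "y \<in> E" "x \<noteq> y" for x y
  proof (rule blinfun_eqI)
    fix v
    have "?p y v \<in> orth_compl (cyc M x)"
      using cyc_orthogonal[of x y] orth[OF that] id_on_in[OF closed_csubspace_cyc] by blast
    then show "(?p x o\<^sub>L ?p y) v = (0 :: 'h oper) v"
      by (simp add: id_on_zero closed_csubspace_cyc)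
  qed
  have nz: "?p x \<noteq> 0" if "x \<in> E" for x
    using px[OF that] E(2)[OF that] by auto
  have idem: "?p x o\<^sub>L ?p x = ?p x" "adj (?p x) = ?p x" for x
    by (simp_all add: id_on_idem adj_id_on closed_csubspace_cyc)
  show "inj_on ?p E"
  proof (rule inj_onI, rule ccontr)
    fix x y assume xy: "x \<in> E" "y \<in> E" "?p x = ?p y" "x \<noteq> y"
    then have "?p x o\<^sub>L ?p x = 0"
      using prod[of x y] by simp
    then show False
      using idem(1) nz[OF xy(1)] by simp
  qed
  show "?p ` E \<subseteq> Mc"
    using id_on_cyc by blast
  show "orthogonal_projections (?p ` E)"
    unfolding orthogonal_projections_def ball_simps(9)
  proof (intro conjI ballI impI)
    show "?p x o\<^sub>L ?p y = 0" if "x \<in> E" "y \<in> E" "?p x \<noteq> ?p y" for x y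
      by (rule prod[OF that(1,2)]) (use that(3) in auto)
  qed (use nz idem in auto)
qed

lemma orthogonal_projections_countable_meet:
  assumes "P \<subseteq> M" "orthogonal_projections P"
  shows "countable {p \<in> P. blinfun_apply p x \<noteq> 0}"
  by (rule countable_nonorthogonal[of P "\<lambda>p. p"])
    (use assms in \<open>auto simp: orthogonal_projections_def dest: M_clinear\<close>)

text \<open>A cyclic decomposition for \<open>Mc\<close> provides a reference family. If it is
  infinite, counting shows that it is largest. If it is finite, every orthogonal family is
  countable, so any infinite one is largest; and if all are finite, finite dimension bounds their
  sizes uniformly.\<close>

lemma dec_attained: "\<exists>P\<subseteq>M. orthogonal_projections P \<and> (\<forall>Q\<subseteq>M. orthogonal_projections Q \<longrightarrow> |Q| \<le>o |P| )"
proof -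
  interpret C: vn K Mc
    by (rule vn_Mc)
  obtain E where E: "E \<subseteq> K" "\<forall>x\<in>E. x \<noteq> 0" "\<forall>x\<in>E. \<forall>y\<in>E. x \<noteq> y \<longrightarrow> (\<forall>a\<in>Mc. cinner (a x) y = 0)"
    "ccspan {blinfun_apply a x |a x. a \<in> Mc \<and> x \<in> E} = K"
    using C.cyclic_decomposition_ex by (elim exE conjE)
  define P where "P = (\<lambda>x. id_on (cyc Mc x)) ` E"
  have P: "P \<subseteq> M" "orthogonal_projections P" and inj: "inj_on (\<lambda>x. id_on (cyc Mc x)) E"
    using C.orthogonal_cyc_projections[of E] E unfolding P_def bicommutant by blast+
  have meet: "\<exists>x\<in>E. blinfun_apply q x \<noteq> 0" if Q: "Q \<subseteq> M" "orthogonal_projections Q" "q \<in> Q" for q Q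
  proof (rule ccontr)
    assume "\<not> ?thesis"
    then have q0: "q x = 0" if "x \<in> E" for x
      using that by blast
    have qM: "q \<in> M" "q \<noteq> 0"
      using Q by (auto simp: orthogonal_projections_def)
    have "{blinfun_apply a x |a x. a \<in> Mc \<and> x \<in> E} \<subseteq> {x. q x = 0}"
      using Mc_commute_apply[OF qM(1)] q0 by auto
    then have "K \<subseteq> {x. q x = 0}"
      using ccspan_minimal[OF _ closed_csubspace_kernel[OF M_clinear[OF qM(1)]]] E(4) by blast
    then have "q = 0"
      by (intro bo_eqI[OF K M_bo[OF qM(1)] bo_zero[OF K]]) auto
    then show False
      using qM by simp
  qed
  show ?thesis
  proof (cases "finite E")
    case False
    have "|Q| \<le>o |P|" if Q: "Q \<subseteq> M" "orthogonal_projections Q" for Q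
    proof -
      have "|Q| \<le>o |E|"
        by (rule card_le_by_countable_fibres[OF False card_of_mono1[OF order_refl], of Q "\<lambda>q x. blinfun_apply q x \<noteq> 0"])
          (use meet[OF Q] orthogonal_projections_countable_meet[OF Q] in auto)
      also have "|E| \<le>o |P|"
        using inj unfolding P_def card_of_ordLeq[symmetric] by blast
      finally show ?thesis .
    qed
    with P show ?thesis
      by blast
  next
    case True
    have count: "|Q| \<le>o |UNIV :: nat set|" if Q: "Q \<subseteq> M" "orthogonal_projections Q" for Q
      by (rule card_le_by_countable_fibres[of _ E Q "\<lambda>q x. blinfun_apply q x \<noteq> 0"])
        (use meet[OF Q] orthogonal_projections_countable_meet[OF Q] countable_card_le[OF countable_finite[OF True]] in auto)
    show ?thesis
    proof (cases orth_families_finite)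
      case False
      then obtain P' where P': "P' \<subseteq> M" "orthogonal_projections P'" "infinite P'"
        by (auto simp: orth_families_finite_def)
      have "|Q| \<le>o |P'|" if Q: "Q \<subseteq> M" "orthogonal_projections Q" for Q
        using ordLeq_transitive[OF count[OF Q]] P'(3) infinite_iff_card_of_nat by blast
      with P' show ?thesis
        by blast
    next
      case True
      define f where "f Q \<longleftrightarrow> Q \<subseteq> M \<and> orthogonal_projections Q" for Q
      obtain n where n: "\<forall>Q\<subseteq>M. orthogonal_projections Q \<longrightarrow> finite Q \<and> card Q \<le> n"
        using finite_dimensional_bound[OF orth_families_finite_imp_finite_dimensional[OF True]] by blast
      have "f P"
        using P by (simp add: f_def)
      moreover have "\<forall>Q. f Q \<longrightarrow> card Q < Suc n"
        using n by (simp add: f_def less_Suc_eq_le)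
      ultimately have "\<exists>P'. f P' \<and> (\<forall>Q. f Q \<longrightarrow> card Q \<le> card P')"
        by (rule Lattices_Big.ex_has_greatest_nat)
      then obtain P' where P': "f P'" "\<forall>Q. f Q \<longrightarrow> card Q \<le> card P'"
        by (elim exE conjE)
      have "|Q| \<le>o |P'|" if "Q \<subseteq> M" "orthogonal_projections Q" for Q
      proof -
        have "finite Q" "finite P'" "card Q \<le> card P'"
          using n that P' unfolding f_def by blast+
        then show ?thesis
          unfolding card_of_ordLeq[symmetric] by (rule inj_on_iff_card_le[THEN iffD2])
      qed
      with P'(1) show ?thesis
        unfolding f_def by blast
    qed
  qed
qed

lemma dec_obtain:
  obtains P where "P \<subseteq> M" "orthogonal_projections P" "dec M = |P|"
    "\<And>Q. Q \<subseteq> M \<Longrightarrow> orthogonal_projections Q \<Longrightarrow> |Q| \<le>o |P|"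
proof -
  obtain P where P: "P \<subseteq> M" "orthogonal_projections P" "\<forall>Q\<subseteq>M. orthogonal_projections Q \<longrightarrow> |Q| \<le>o |P|"
    using dec_attained by blast
  let ?R = "{|P| |P. P \<subseteq> M \<and> orthogonal_projections P}"
  have "|P| \<in> ?R" and "\<And>s. s \<in> ?R \<Longrightarrow> s \<le>o |P|"
    using P by blast+
  note props = max_card_props[of "|P|" ?R, OF this]
  obtain P' where "P' \<subseteq> M" "orthogonal_projections P'" "max_card ?R = |P'|"
    using props(1) by blast
  moreover have "|Q| \<le>o |P'|" if "Q \<subseteq> M" "orthogonal_projections Q" for Q
    using props(2)[of "|Q|"] that calculation by auto
  ultimately show ?thesis
    using that[of P'] by (simp add: dec_def)
qed

lemma dec_nonempty:
  assumes "dec M = |P|"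
  shows "P \<noteq> {}"
proof
  assume "P = {}"
  obtain P' where P': "dec M = |P'|" "\<And>Q. Q \<subseteq> M \<Longrightarrow> orthogonal_projections Q \<Longrightarrow> |Q| \<le>o |P'|"
    by (rule dec_obtain) blast
  have "id_on K \<noteq> 0"
    using one_apply K_ne csub_zero[OF K] by fastforce
  then have "orthogonal_projections {id_on K}"
    by (simp add: orthogonal_projections_def id_on_idem adj_id_on K)
  then have "|{id_on K}| \<le>o |P|"
    using P'(2)[of "{id_on K}"] M_one P'(1) assms by simp
  then show False
    using \<open>P = {}\<close> card_of_empty3 by (metis insert_not_empty)
qed

subsection \<open>The center\<close>

lemma center_eq: "center M = M \<inter> Mc"
  using M_bo by (auto simp: center_def commutant_iff)

text \<open>The center is contained in \<open>M\<close> and in \<open>Mc\<close>, so its double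
  commutant is contained in both, and their intersection is the center.\<close>

lemma vn_center: "vn K (center M)"
proof (rule vn.intro)
  have sub: "center M \<subseteq> bounded_ops K"
    using M_sub by (auto simp: center_eq)
  have "commutant K (commutant K (center M)) \<subseteq> commutant K (commutant K M)"
    by (intro commutant_antimono) (auto simp: center_eq)
  moreover have "commutant K (commutant K (center M)) \<subseteq> commutant K (commutant K Mc)"
    by (intro commutant_antimono) (auto simp: center_eq)
  moreover have "commutant K (commutant K Mc) = Mc"
    by (simp add: bicommutant)
  moreover have "center M \<subseteq> commutant K (commutant K (center M))"
    by (rule bicommutant_superset[OF sub])
  ultimately have "commutant K (commutant K (center M)) = center M"
    using bicommutant center_eq by blast
  then show "von_neumann_algebra K (center M)"
    using K K_ne sub adj_M adj_Mc by (auto simp: von_neumann_algebra_def center_eq)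
qed

lemma center_subset: "center M \<subseteq> M"
  by (auto simp: center_def)

subsection \<open>Generating sets\<close>

text \<open>The bicommutant of \<open>S\<close> together with its adjoints is a von Neumann algebra
  containing \<open>S\<close>, hence contains \<open>M\<close>.\<close>

lemma generated_subset:
  assumes "generates K M S" "b \<in> commutant K (S \<union> adj ` S)" "a \<in> M"
  shows "a o\<^sub>L b = b o\<^sub>L a"
proof -
  have S: "S \<subseteq> M" and min: "\<And>N. von_neumann_algebra K N \<Longrightarrow> S \<subseteq> N \<Longrightarrow> M \<subseteq> N"
    using assms(1) by (auto simp: generates_def)
  let ?T = "S \<union> adj ` S"
  have T: "?T \<subseteq> bounded_ops K"
    using S adj_M M_bo by blast
  have adjT: "adj a \<in> ?T" if "a \<in> ?T" for a
    using that S adj_adj[OF M_clinear] by force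
  have "von_neumann_algebra K (commutant K (commutant K ?T))"
    by (rule von_neumann_algebra_commutant[OF K K_ne commutant_subset com_adj[OF K T adjT]])
  moreover have "S \<subseteq> commutant K (commutant K ?T)"
    using bicommutant_superset[OF T] by blast
  ultimately have "a \<in> commutant K (commutant K ?T)"
    using min assms(3) by blast
  then show ?thesis
    using assms(2) by (simp add: commutant_iff)
qed

text \<open>The closed span of the words applied to \<open>x\<close> is invariant under the
  generators and their adjoints, so its projection commutes with them and therefore with
  \<open>M\<close>. The empty word puts \<open>x\<close> into it.\<close>

lemma cyc_subset_words:
  assumes gen: "generates K M S" and x: "x \<in> K"
  shows "cyc M x \<subseteq> ccspan ((\<lambda>ws. foldr blinfun_apply ws x) ` lists (S \<union> adj ` S))"
proof -
  let ?T = "S \<union> adj ` S"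
  define V where "V = ccspan ((\<lambda>ws. foldr blinfun_apply ws x) ` lists ?T)"
  have T: "?T \<subseteq> bounded_ops K" and adjT: "\<And>a. a \<in> ?T \<Longrightarrow> adj a \<in> ?T"
  proof -
    have S: "S \<subseteq> M"
      using gen by (simp add: generates_def)
    show "?T \<subseteq> bounded_ops K"
      using S adj_M M_bo by blast
    show "adj a \<in> ?T" if "a \<in> ?T" for a
      using that S adj_adj[OF M_clinear] by force
  qed
  have V: "closed_csubspace V"
    by (simp add: V_def closed_csubspace_ccspan)
  have words: "foldr blinfun_apply ws x \<in> V" if "ws \<in> lists ?T" for ws
    unfolding V_def by (rule subsetD[OF ccspan_superset imageI[OF that]])
  have VK: "V \<subseteq> K"
    unfolding V_def
  proof (rule ccspan_minimal[OF _ K], rule image_subsetI)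
    fix ws assume "ws \<in> lists ?T"
    then show "foldr blinfun_apply ws x \<in> K"
      using T by (cases ws) (auto simp: x intro!: bo_in)
  qed
  have inv: "a v \<in> V" if a: "a \<in> ?T" and v: "v \<in> V" for a v
  proof -
    have "V \<subseteq> {v. a v \<in> V}"
      unfolding V_def[THEN arg_cong[of _ _ "\<lambda>X. X \<subseteq> {v. a v \<in> V}"]]
    proof (rule ccspan_minimal)
      show "(\<lambda>ws. foldr blinfun_apply ws x) ` lists ?T \<subseteq> {v. a v \<in> V}"
      proof (rule image_subsetI)
        fix ws assume "ws \<in> lists ?T"
        then show "foldr blinfun_apply ws x \<in> {v. a v \<in> V}"
          using words[of "a # ws"] a by simp
      qed
      show "closed_csubspace {v. a v \<in> V}"
        using T a by (intro closed_csubspace_op_vimage V bo_clinear) auto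
    qed
    with v show ?thesis
      by blast
  qed
  have p: "id_on V \<in> commutant K ?T"
    by (rule id_on_commutant[OF V VK T adjT inv])
  have xV: "x \<in> V"
    using words[of "[]"] by simp
  have "a x \<in> V" if a: "a \<in> M" for a
  proof -
    have "a (id_on V x) = id_on V (a x)"
      using generated_subset[OF gen p a] by (metis blinfun_apply_blinfun_compose)
    then show ?thesis
      using id_on_in[OF V] id_on_id[OF V xV] by metis
  qed
  then have "cyc M x \<subseteq> V"
    unfolding cyc_def by (intro ccspan_minimal V) auto
  then show ?thesis
    by (simp add: V_def)
qed

lemma scalars_subset: "range (\<lambda>c. c *\<^sub>C id_on K) \<subseteq> M"
  using M_scaleC[OF M_one] by auto

end

text \<open>Commuting with all rank-one operators forces an operator to be scalar. Consequently the
  empty set cannot generate anything larger than the scalars, which makes generating sets of all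
  other algebras nonempty.\<close>

lemma von_neumann_algebra_scalars:
  assumes K: "closed_csubspace K" "K \<noteq> {0}"
  shows "von_neumann_algebra K (range (\<lambda>c. c *\<^sub>C id_on K))"
proof -
  interpret B: vn K "bounded_ops K"
    by (rule vn.intro[OF von_neumann_algebra_bounded_ops[OF K]])
  have "commutant K (bounded_ops K) \<subseteq> range (\<lambda>c. c *\<^sub>C id_on K)"
  proof
    fix b assume b: "b \<in> commutant K (bounded_ops K)"
    obtain u where u: "u \<in> K" "u \<noteq> 0"
      using K csub_zero by blast
    have "b v = (cinner (b u) u / cinner u u) *\<^sub>C v" if v: "v \<in> K" for v
    proof -
      \<comment> \<open>The rank-one operator with values in the multiples of \<open>v\<close>;
        commuting with it evaluates \<open>b\<close> at \<open>v\<close>.\<close>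
      define r where "r = Blinfun (\<lambda>x. cinner x u *\<^sub>C v)"
      have "bounded_linear (\<lambda>x. cinner x u *\<^sub>C v)"
      proof (rule bounded_linear_intro)
        show "norm (cinner x u *\<^sub>C v) \<le> norm x * (norm u * norm v)" for x
          using mult_right_mono[OF cmod_cinner_le[of x u], of "norm v"] by (simp add: norm_scaleC mult.assoc)
      qed (simp_all add: cinner_add_left scaleC_add_left cinner.scaleR_left scaleR_conv_of_real
          complex_vector.scale_scale[symmetric] scaleC_of_real del: complex_vector.scale_scale)
      then have r: "r x = cinner x u *\<^sub>C v" for x
        by (simp add: r_def bounded_linear_Blinfun_apply)
      have "r \<in> bounded_ops K"
        using csub_scale[OF K(1) v] u
        by (auto simp: bounded_ops_iff clinear_op_def r cinner_scaleC_left scaleC_scaleC orth_compl_def)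
      then have "r (b u) = b (r u)"
        using b by (metis commutant_iff blinfun_apply_blinfun_compose)
      then have "cinner (b u) u *\<^sub>C v = cinner u u *\<^sub>C b v"
        using clinear_opD[OF bo_clinear[of b K]] b by (simp add: r commutant_iff)
      then have "(cinner (b u) u / cinner u u) *\<^sub>C v = (1 / cinner u u) *\<^sub>C cinner u u *\<^sub>C b v"
        by (metis (no_types, lifting) scaleC_scaleC divide_inverse mult.commute mult_1_left)
      then show ?thesis
        using u by (simp add: scaleC_scaleC)
    qed
    then have "b = (cinner (b u) u / cinner u u) *\<^sub>C id_on K"
      using b K by (intro bo_eqI[OF K(1)])
        (auto simp: commutant_iff bo_scaleC id_on_bounded_ops scaleC_blinfun.rep_eq id_on_id)
    then show "b \<in> range (\<lambda>c. c *\<^sub>C id_on K)"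
      by blast
  qed
  moreover have "range (\<lambda>c. c *\<^sub>C id_on K) \<subseteq> commutant K (bounded_ops K)"
    by (rule vn.scalars_subset[OF B.vn_Mc])
  ultimately show ?thesis
    using B.vn_Mc by (simp add: vn_def)
qed

context vn
begin

text \<open>The convention for the scalars is what allows a nonempty \<open>S\<close> in every case,
  so that products with \<open>|S|\<close> never collapse to zero.\<close>

lemma gen_obtain:
  obtains S where "generates K M S" "S \<noteq> {}" "gen K M = |S|"
    "\<And>S'. generates K M S' \<Longrightarrow> S' \<noteq> {} \<Longrightarrow> |S| \<le>o |S'|"
proof (cases "M = range (\<lambda>c. c *\<^sub>C id_on K)")
  case True
  have "M \<subseteq> N" if "von_neumann_algebra K N" for N
    unfolding True by (rule vn.scalars_subset[OF vn.intro[OF that]])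
  then have "generates K M {id_on K}"
    using vN M_one by (simp add: generates_def)
  moreover have "gen K M = |{id_on K}|"
    by (simp add: gen_def True)
  moreover have "|{id_on K}| \<le>o |S'|" if "S' \<noteq> {}" for S' :: "'h oper set"
    by (rule card_of_singl_ordLeq[OF that])
  ultimately show ?thesis
    using that by blast
next
  case False
  let ?R = "{|S| |S. generates K M S}"
  have gen: "gen K M = min_card ?R"
    using False by (simp add: gen_def)
  have "generates K M M"
    using vN by (simp add: generates_def)
  then have ne: "?R \<noteq> {}" and co: "\<And>r. r \<in> ?R \<Longrightarrow> Card_order r"
    using card_of_Card_order by blast+
  obtain S where S: "generates K M S" "min_card ?R = |S|"
    using min_card_props(1)[OF ne co] by blast
  have "S \<noteq> {}"
  proof
    assume "S = {}"
    then have "M \<subseteq> range (\<lambda>c. c *\<^sub>C id_on K)"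
      using S(1) von_neumann_algebra_scalars[OF K K_ne] unfolding generates_def by blast
    then show False
      using False scalars_subset by blast
  qed
  moreover have "|S| \<le>o |S'|" if "generates K M S'" for S'
    using min_card_props(2)[OF ne co, of "|S'|"] that S(2) by auto
  ultimately show ?thesis
    using that S gen by metis
qed

end

section \<open>Bounds from a faithful normal representation: orthogonal families and generating
  sets\<close>

context normal_rep
begin

text \<open>A nonzero \<open>\<pi> p\<close> cannot vanish on the whole basis, and each basis vector
  meets only countably many of the orthogonal projections \<open>\<pi> p\<close>.\<close>

lemma card_orthogonal_projections_le:
  assumes B: "orthonormal_basis L B" and N: "infinite N" "|B| \<le>o |N|" and P: "P \<subseteq> M" "orthogonal_projections P"
  shows "|P| \<le>o |N|"
proof (rule card_le_by_countable_fibres[OF N])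
  fix p assume p: "p \<in> P"
  then have pM: "p \<in> M" "p \<noteq> 0"
    using P by (auto simp: orthogonal_projections_def)
  show "\<exists>b\<in>B. \<pi> p b \<noteq> 0"
  proof (rule ccontr)
    assume "\<not> ?thesis"
    then have "B \<subseteq> {x. \<pi> p x = 0}"
      by blast
    then have "ccspan B \<subseteq> {x. \<pi> p x = 0}"
      by (rule ccspan_minimal[OF _ closed_csubspace_kernel[OF pi_clinear[OF pM(1)]]])
    then have "\<pi> p = 0"
      using B by (intro bo_eqI[OF L pi_bo[OF pM(1)] bo_zero[OF L]]) (auto simp: orthonormal_basis_iff)
    then show False
      using pM pi_eq_zero by simp
  qed
next
  fix b
  show "countable {p \<in> P. \<pi> p b \<noteq> 0}"
  proof (rule countable_nonorthogonal)
    fix p assume "p \<in> P"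
    then have p: "p \<in> M" "p o\<^sub>L p = p" "adj p = p"
      using P by (auto simp: orthogonal_projections_def)
    then show "clinear_op (\<pi> p) \<and> \<pi> p o\<^sub>L \<pi> p = \<pi> p \<and> adj (\<pi> p) = \<pi> p"
      using pi_compose[OF p(1) p(1)] pi_adj[OF p(1)] by (simp add: pi_clinear)
  next
    fix p q assume "p \<in> P" "q \<in> P" "p \<noteq> q"
    then have "p \<in> M" "q \<in> M" "p o\<^sub>L q = 0"
      using P by (auto simp: orthogonal_projections_def)
    then show "\<pi> p o\<^sub>L \<pi> q = 0"
      using pi_compose[of p q] by (simp add: pi_zero)
  qed
qed

text \<open>Nonzero vectors chosen in the ranges of the \<open>\<pi> p\<close> are orthogonal, hence
  independent in the span of a finite set. In contrapositive form this makes
  \<open>chi_r K M\<close> infinite for infinite-dimensional \<open>M\<close>.\<close>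

lemma finite_basis_imp_finite_dimensional:
  assumes B: "orthonormal_basis L B" "finite B"
  shows "finite_dimensional M"
proof -
  have "finite P" if P: "P \<subseteq> M" "orthogonal_projections P" for P
  proof -
    have pP: "p \<in> M" "p \<noteq> 0" "p o\<^sub>L p = p" "adj p = p" if "p \<in> P" for p
      using P that by (auto simp: orthogonal_projections_def)
    have "\<exists>v. \<pi> p v \<noteq> 0" if "p \<in> P" for p
      using pi_eq_zero[OF pP(1)[OF that]] pP(2)[OF that] by (metis blinfun_eqI zero_blinfun.rep_eq)
    then obtain w where w: "\<And>p. p \<in> P \<Longrightarrow> \<pi> p (w p) \<noteq> 0"
      by metis
    define v where "v p = \<pi> p (w p)" for p
    have orth: "cinner (v p) (v q) = 0" if "p \<in> P" "q \<in> P" "p \<noteq> q" for p q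
    proof -
      have "p o\<^sub>L q = 0"
        using P(2) that by (auto simp: orthogonal_projections_def)
      then have "\<pi> p (\<pi> q (w q)) = 0"
        using pi_compose[OF pP(1)[OF that(1)] pP(1)[OF that(2)]] compose_apply[of "\<pi> p" "\<pi> q" 0]
        by (simp add: pi_zero)
      moreover have "cinner (v p) (v q) = cinner (w p) (\<pi> p (\<pi> q (w q)))"
        using cinner_adj[OF pi_clinear[OF pP(1)[OF that(1)]]] pi_adj[OF pP(1)[OF that(1)]] pP(4)[OF that(1)]
        by (simp add: v_def)
      ultimately show ?thesis
        by (simp add: cinner.zero_right)
    qed
    have inj: "inj_on v P"
      using orth w by (metis cinner_same_eq_zero inj_onI v_def)
    have "\<not> complex_vector.dependent (v ` P)"
      by (rule orthogonal_independent) (use orth w in \<open>auto simp: v_def\<close>)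
    moreover have "v ` P \<subseteq> complex_vector.span B"
      using finite_orthonormal_basis_span[OF B] bo_in[OF pi_bo[OF pP(1)]] by (auto simp: v_def)
    ultimately have "finite (v ` P)"
      using complex_vector.independent_span_bound[OF B(2)] by blast
    then show ?thesis
      using inj finite_imageD by blast
  qed
  then show ?thesis
    by (simp add: finite_dimensional_iff orth_families_finite_def)
qed

lemma generating_set_ex:
  assumes B: "orthonormal_basis L B" and N: "infinite N" "|B| \<le>o |N|"
  shows "\<exists>S. S \<noteq> {} \<and> generates K M S \<and> |S| \<le>o |N|"
proof -
  interpret C: vn K Mc
    by (rule vn_Mc)
  \<comment> \<open>Dominated vectors exist in every nonzero subspace invariant under
    \<open>Mc\<close>, which is the condition on \<open>Q\<close> in \<open>total_family_ex\<close>
    for the algebra \<open>Mc\<close>.\<close>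
  have "\<exists>E\<subseteq>K. (\<forall>\<eta>\<in>E. \<eta> \<noteq> 0 \<and> (\<exists>\<xi>. \<forall>a\<in>M. norm (blinfun_apply a \<eta>) \<le> norm (\<pi> a \<xi>))) \<and>
    (\<forall>x\<in>E. \<forall>y\<in>E. x \<noteq> y \<longrightarrow> (\<forall>a\<in>Mc. cinner (a x) y = 0)) \<and>
    ccspan {blinfun_apply a x |a x. a \<in> Mc \<and> x \<in> E} = K"
    by (rule C.total_family_ex) (rule dominated_vector_ex)
  then obtain E where EK: "E \<subseteq> K" and E0: "\<forall>\<eta>\<in>E. \<eta> \<noteq> 0 \<and> (\<exists>\<xi>. \<forall>a\<in>M. norm (blinfun_apply a \<eta>) \<le> norm (\<pi> a \<xi>))"
    and Eorth: "\<forall>x\<in>E. \<forall>y\<in>E. x \<noteq> y \<longrightarrow> (\<forall>a\<in>Mc. cinner (a x) y = 0)"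
    and Etotal: "ccspan {blinfun_apply a x |a x. a \<in> Mc \<and> x \<in> E} = K"
    by blast
  define P where "P = (\<lambda>x. id_on (cyc Mc x)) ` E"
  have P: "inj_on (\<lambda>x. id_on (cyc Mc x)) E" "P \<subseteq> M" "orthogonal_projections P"
    using C.orthogonal_cyc_projections[of E] EK E0 Eorth unfolding P_def bicommutant by blast+
  have "|E| \<le>o |P|"
    using P(1) unfolding P_def card_of_ordLeq[symmetric] by blast
  also have "|P| \<le>o |N|"
    by (rule card_orthogonal_projections_le[OF B N P(2,3)])
  finally have E_card: "|E| \<le>o |N|" .
  obtain D where D: "|D| \<le>o |N|" "L \<subseteq> closure D"
    using ccspan_dense_ex[OF N] B by (auto simp: orthonormal_basis_iff)
  have T_ex: "\<exists>T\<subseteq>M. |T| \<le>o |N| \<and> (\<forall>a\<in>M. blinfun_apply a \<eta> \<in> closure ((\<lambda>a. blinfun_apply a \<eta>) ` T))"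
    if \<eta>: "\<eta> \<in> E" for \<eta>
  proof -
    obtain \<xi> where \<xi>: "\<forall>a\<in>M. norm (blinfun_apply a \<eta>) \<le> norm (\<pi> a \<xi>)"
      using E0 \<eta> by blast
    have "(\<lambda>a. \<pi> a \<xi>) ` M \<subseteq> closure D"
      using bo_in[OF pi_bo] D(2) by blast
    from dense_parameters_ex[OF N(1) D(1) this] obtain T where T: "T \<subseteq> M" "|T| \<le>o |N|"
      "(\<lambda>a. \<pi> a \<xi>) ` M \<subseteq> closure ((\<lambda>a. \<pi> a \<xi>) ` T)"
      by blast
    have "a \<eta> \<in> closure ((\<lambda>a. blinfun_apply a \<eta>) ` T)" if a: "a \<in> M" for a
      unfolding closure_approachable
    proof (intro allI impI)
      fix e :: real assume "0 < e"
      moreover have "\<pi> a \<xi> \<in> closure ((\<lambda>a. \<pi> a \<xi>) ` T)"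
        using T(3) a by blast
      ultimately obtain t where t: "t \<in> T" "dist (\<pi> t \<xi>) (\<pi> a \<xi>) < e"
        unfolding closure_approachable by blast
      then have tM: "t \<in> M"
        using T by blast
      have "dist (t \<eta>) (a \<eta>) = norm ((t - a) \<eta>)"
        by (simp add: dist_norm blinfun.diff_left)
      also have "\<dots> \<le> norm (\<pi> (t - a) \<xi>)"
        using \<xi> M_diff[OF tM a] by blast
      also have "\<dots> = dist (\<pi> t \<xi>) (\<pi> a \<xi>)"
        by (simp add: pi_diff tM a dist_norm blinfun.diff_left)
      finally show "\<exists>y\<in>(\<lambda>a. blinfun_apply a \<eta>) ` T. dist y (a \<eta>) < e"
        using t by (intro bexI[OF _ imageI[OF t(1)]]) simp
    qed
    then show ?thesis
      using T by blast
  qed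
  have "\<forall>\<eta>. \<exists>T. \<eta> \<in> E \<longrightarrow> T \<subseteq> M \<and> |T| \<le>o |N| \<and>
      (\<forall>a\<in>M. blinfun_apply a \<eta> \<in> closure ((\<lambda>a. blinfun_apply a \<eta>) ` T))"
    using T_ex by blast
  from choice[OF this] obtain T where "\<forall>\<eta>. \<eta> \<in> E \<longrightarrow> T \<eta> \<subseteq> M \<and> |T \<eta>| \<le>o |N| \<and>
      (\<forall>a\<in>M. blinfun_apply a \<eta> \<in> closure ((\<lambda>a. blinfun_apply a \<eta>) ` T \<eta>))" ..
  then have T: "\<And>\<eta>. \<eta> \<in> E \<Longrightarrow> T \<eta> \<subseteq> M" "\<And>\<eta>. \<eta> \<in> E \<Longrightarrow> |T \<eta>| \<le>o |N|"
    "\<And>\<eta> a. \<eta> \<in> E \<Longrightarrow> a \<in> M \<Longrightarrow> blinfun_apply a \<eta> \<in> closure ((\<lambda>a. blinfun_apply a \<eta>) ` T \<eta>)"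
    by simp_all
  define Y where "Y = (\<Union>\<eta>\<in>E. (\<lambda>a. blinfun_apply a \<eta>) ` T \<eta>)"
  have Y_card: "|Y| \<le>o |N|"
    unfolding Y_def by (intro card_of_UNION_ordLeq_infinite N(1) E_card ballI card_image_le_o T(2))
  have ME: "a \<eta> \<in> closure Y" if "\<eta> \<in> E" "a \<in> M" for a \<eta>
    using T(3)[OF that] closure_mono[of "(\<lambda>a. blinfun_apply a \<eta>) ` T \<eta>" Y] that(1) by (auto simp: Y_def)
  \<comment> \<open>Here \<open>y = t \<eta>\<close> with \<open>t\<close> in \<open>M\<close>, so
    \<open>a y = (a t) \<eta>\<close> again lies in \<open>M \<eta>\<close>.\<close>
  have MY: "a y \<in> closure Y" if y: "y \<in> Y" and a: "a \<in> M" for a y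
  proof -
    obtain \<eta> t where t: "\<eta> \<in> E" "t \<in> T \<eta>" "y = t \<eta>"
      using y by (auto simp: Y_def)
    then show ?thesis
      using ME[OF t(1) M_compose[OF a], of t] T(1) by auto
  qed
  \<comment> \<open>Both coordinates take values in \<open>closure Y\<close>, so
    \<open>Y \<times> Y\<close> supplies the small dense set in the product space.\<close>
  have S_ex: "\<exists>S\<subseteq>M. |S| \<le>o |N| \<and>
      (\<lambda>a. (blinfun_apply a y, adj a y')) ` M \<subseteq> closure ((\<lambda>a. (blinfun_apply a y, adj a y')) ` S)"
    if "y \<in> Y" "y' \<in> Y" for y y'
  proof (rule dense_parameters_ex[OF N(1)])
    show "|Y \<times> Y| \<le>o |N|"
      by (intro card_Times_le N(1) Y_card)
    show "(\<lambda>a. (blinfun_apply a y, adj a y')) ` M \<subseteq> closure (Y \<times> Y)"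
      using MY that adj_M by (auto simp: closure_Times)
  qed
  have "\<forall>z. \<exists>S. z \<in> Y \<times> Y \<longrightarrow> S \<subseteq> M \<and> |S| \<le>o |N| \<and>
      (\<lambda>a. (blinfun_apply a (fst z), adj a (snd z))) ` M
        \<subseteq> closure ((\<lambda>a. (blinfun_apply a (fst z), adj a (snd z))) ` S)"
  proof
    fix z
    show "\<exists>S. z \<in> Y \<times> Y \<longrightarrow> S \<subseteq> M \<and> |S| \<le>o |N| \<and>
      (\<lambda>a. (blinfun_apply a (fst z), adj a (snd z))) ` M
        \<subseteq> closure ((\<lambda>a. (blinfun_apply a (fst z), adj a (snd z))) ` S)"
    proof (cases "z \<in> Y \<times> Y")
      case True
      then have "fst z \<in> Y" "snd z \<in> Y"
        by auto
      from S_ex[OF this] show ?thesis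
        by (elim exE) (rule exI, rule impI)
    qed simp
  qed
  from choice[OF this] obtain S where S: "\<forall>z. z \<in> Y \<times> Y \<longrightarrow> S z \<subseteq> M \<and> |S z| \<le>o |N| \<and>
      (\<lambda>a. (blinfun_apply a (fst z), adj a (snd z))) ` M
        \<subseteq> closure ((\<lambda>a. (blinfun_apply a (fst z), adj a (snd z))) ` S z)" ..
  \<comment> \<open>The unit is included to make \<open>G\<close> nonempty.\<close>
  define G where "G = insert (id_on K) (\<Union>z\<in>Y \<times> Y. S z)"
  have G_card: "|G| \<le>o |N|"
  proof -
    have "|\<Union>z\<in>Y \<times> Y. S z| \<le>o |N|"
      by (intro card_of_UNION_ordLeq_infinite N(1) card_Times_le Y_card ballI) (simp add: S)
    moreover have "|{id_on K}| \<le>o |N|"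
      by (rule countable_card_le[OF _ N(1)]) simp
    ultimately have "|{id_on K} \<union> (\<Union>z\<in>Y \<times> Y. S z)| \<le>o |N|"
      by (intro card_Un_le N(1))
    then show ?thesis
      by (simp add: G_def)
  qed
  have GM: "G \<subseteq> M"
    using S M_one unfolding G_def by blast
  define Z where "Z = {blinfun_apply c y |c y. c \<in> Mc \<and> y \<in> Y}"
  have YK: "Y \<subseteq> K"
    using T(1) bo_in[OF M_bo] by (auto simp: Y_def)
  have ZK: "Z \<subseteq> K"
    using bo_in[OF Mc_bo] by (auto simp: Z_def)
  \<comment> \<open>Each \<open>\<eta>\<close> lies in the closure of \<open>Y\<close>, so
    \<open>Mc Y\<close> spans as much as \<open>Mc E\<close>, that is, all of
    \<open>K\<close>.\<close>
  have Ztotal: "ccspan Z = K"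
  proof
    show "ccspan Z \<subseteq> K"
      by (rule ccspan_minimal[OF ZK K])
    have "c \<eta> \<in> ccspan Z" if c: "c \<in> Mc" and \<eta>: "\<eta> \<in> E" for c \<eta>
    proof -
      note V = closed_csubspace_op_vimage[OF bo_clinear[OF Mc_bo[OF c]] closed_csubspace_ccspan, of Z]
      have "Y \<subseteq> {x. c x \<in> ccspan Z}"
        using c ccspan_superset[of Z] by (auto simp: Z_def)
      then have "closure Y \<subseteq> {x. c x \<in> ccspan Z}"
        by (rule closure_minimal[OF _ csub_closed[OF V]])
      moreover have "\<eta> \<in> closure Y"
        using ME[OF \<eta> M_one] one_apply \<eta> EK by auto
      ultimately show ?thesis
        by blast
    qed
    then have "ccspan {blinfun_apply a x |a x. a \<in> Mc \<and> x \<in> E} \<subseteq> ccspan Z"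
      by (intro ccspan_minimal closed_csubspace_ccspan) auto
    then show "K \<subseteq> ccspan Z"
      by (simp add: Etotal)
  qed
  have commute: "b \<in> Mc" if b: "b \<in> bounded_ops K" and bG: "\<And>s. s \<in> G \<Longrightarrow> s o\<^sub>L b = b o\<^sub>L s" for b
  proof -
    have "x o\<^sub>L b = b o\<^sub>L x" if x: "x \<in> M" for x
    proof -
      define w where "w = (x o\<^sub>L b) - (b o\<^sub>L x)"
      have w: "w \<in> bounded_ops K"
        unfolding w_def by (intro bo_diff[OF K] bo_compose b M_bo[OF x])
      have form: "cinner (x (b (c y))) (a y') = cinner (b (x (c y))) (a y')"
        if c: "c \<in> Mc" and a: "a \<in> Mc" and y: "y \<in> Y" and y': "y' \<in> Y" for c a y y'
      proof -
        \<comment> \<open>The commutation test with \<open>x\<close> moved across the inner product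
          on one side. It is a closed condition on the pair \<open>(x y, x* y')\<close>; the members
          of \<open>S (y, y')\<close> satisfy it, hence so does every \<open>x\<close> in
          \<open>M\<close>.\<close>
        define F where "F = {(z, z'). cinner (b (c y)) (a z') = cinner (b (c z)) (a y')}"
        have key: "(blinfun_apply s y, adj s y') \<in> F \<longleftrightarrow>
            cinner (s (b (c y))) (a y') = cinner (b (s (c y))) (a y')" if s: "s \<in> M" for s
        proof -
          have "cinner (s (b (c y))) (a y') = cinner (b (c y)) (adj s (a y'))"
            by (rule cinner_adj[OF M_clinear[OF s]])
          then show ?thesis
            by (simp add: F_def Mc_commute_apply[OF s c] Mc_commute_apply[OF adj_M[OF s] a])
        qed
        have "closed F"
          unfolding F_def case_prod_beta
          by (intro closed_Collect_eq cinner.continuous_on blinfun.continuous_on continuous_on_const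
              continuous_on_fst continuous_on_snd continuous_on_id)
        moreover have "(\<lambda>a. (blinfun_apply a y, adj a y')) ` S (y, y') \<subseteq> F"
        proof (rule image_subsetI)
          fix s assume s: "s \<in> S (y, y')"
          then have "s \<in> G"
            using y y' by (auto simp: G_def)
          then show "(blinfun_apply s y, adj s y') \<in> F"
            using bG[of s] GM by (subst key) (auto, metis blinfun_apply_blinfun_compose)
        qed
        ultimately have "closure ((\<lambda>a. (blinfun_apply a y, adj a y')) ` S (y, y')) \<subseteq> F"
          by (rule closure_minimal[rotated])
        then have "(blinfun_apply x y, adj x y') \<in> F"
          using S[rule_format, of "(y, y')"] y y' x by auto
        then show ?thesis
          by (simp add: key x)
      qed
      have wZ: "w u = 0" if uZ: "u \<in> Z" for u
      proof -
        obtain c y where u: "u = blinfun_apply c y" "c \<in> Mc" "y \<in> Y"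
          using uZ by (auto simp: Z_def)
        have "w u \<in> orth_compl Z"
          using form u by (auto simp: orth_compl_def Z_def w_def blinfun.diff_left cinner.diff_left)
        then have "w u \<in> orth_compl K"
          unfolding Ztotal[symmetric] by simp
        then show ?thesis
          using orth_compl_Int_eq_zero[OF bo_in[OF w]] by blast
      qed
      have "K \<subseteq> {u. w u = 0}"
        unfolding Ztotal[symmetric]
        by (rule ccspan_minimal[OF _ closed_csubspace_kernel[OF bo_clinear[OF w]]]) (use wZ in blast)
      then have "w = 0"
        by (intro bo_eqI[OF K w bo_zero[OF K]]) auto
      then show ?thesis
        by (simp add: w_def)
    qed
    with b show ?thesis
      by (simp add: commutant_iff)
  qed
  have "M \<subseteq> A" if A: "von_neumann_algebra K A" "G \<subseteq> A" for A
  proof -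
    have "commutant K A \<subseteq> Mc"
      using A(2) by (auto simp: commutant_iff[of _ K A] intro!: commute)
    then have "commutant K Mc \<subseteq> commutant K (commutant K A)"
      by (rule commutant_antimono)
    then show ?thesis
      using A(1) by (simp add: bicommutant von_neumann_algebra_def)
  qed
  then have "generates K M G"
    using GM vN by (simp add: generates_def)
  then show ?thesis
    using G_card by (intro exI[of _ G]) (auto simp: G_def)
qed

end

section \<open>Small representations and the cardinal identities\<close>

context vn
begin

text \<open>The form of the compression of \<open>a\<close> at \<open>x\<close> is the form of
  \<open>a\<close> at \<open>p x\<close>, so the approximation of suprema by forms in
  \<open>M\<close> gives normality.\<close>

lemma subspace_rep:
  assumes V: "closed_csubspace V" "V \<subseteq> K" and inv: "\<And>a x. a \<in> M \<Longrightarrow> x \<in> V \<Longrightarrow> a x \<in> V"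
    and faithful: "\<And>a. a \<in> M \<Longrightarrow> (\<And>x. x \<in> V \<Longrightarrow> a x = 0) \<Longrightarrow> a = 0"
  shows "faithful_normal_rep K M V (\<lambda>a. a o\<^sub>L id_on V)"
proof -
  define p where "p = id_on V"
  have pMc: "p \<in> Mc"
    unfolding p_def by (rule id_on_commutant[OF V M_sub adj_M inv])
  have p: "p o\<^sub>L p = p" "adj p = p" "clinear_op p"
    by (simp_all add: p_def id_on_idem adj_id_on clinear_id_on V)
  have comm: "a o\<^sub>L p = p o\<^sub>L a" if "a \<in> M" for a
    using pMc that by (simp add: commutant_iff)
  have bo: "a o\<^sub>L p \<in> bounded_ops V" if a: "a \<in> M" for a
    using inv[OF a id_on_in[OF V(1)]] id_on_zero[OF V(1)] clinear_compose[OF M_clinear[OF a] p(3)]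
    by (auto simp: bounded_ops_iff p_def)
  have adj: "adj (a o\<^sub>L p) = adj a o\<^sub>L p" if a: "a \<in> M" for a
    using adj_compose[OF M_clinear[OF a] p(3)] comm[OF adj_M[OF a]] p by simp
  have q: "qform (a o\<^sub>L p) x = qform a (p x)" if a: "a \<in> M" for a x
  proof -
    have "cinner (a (p x)) x = cinner (p (a (p x))) x"
      using compose_apply[OF comm[OF a], of "p x"] compose_apply[OF p(1), of x] by simp
    also have "\<dots> = cinner (a (p x)) (p x)"
      using cinner_adj[OF p(3)] p(2) by simp
    finally show ?thesis
      by (simp add: qform_def)
  qed
  have hom: "(\<lambda>a. a o\<^sub>L p) \<in> star_hom (oper_algebra K M) (oper_algebra V (bounded_ops V))"
  proof -
    have "(a o\<^sub>L b) o\<^sub>L p = (a o\<^sub>L p) o\<^sub>L (b o\<^sub>L p)" if "a \<in> M" "b \<in> M" for a b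
      using comm[OF that(2)] p(1) by (metis blinfun_compose_assoc)
    moreover have "id_on K o\<^sub>L p = id_on V"
      unfolding p_def by (rule bo_id_left[OF K id_on_subspace_bo[OF V]])
    ultimately show ?thesis
      by (auto simp: star_hom_def Ring.ring_hom_def oper_algebra_def bo adj compose_add_left compose_scaleC_left)
  qed
  moreover have "inj_on (\<lambda>a. a o\<^sub>L p) M"
  proof (rule inj_onI)
    fix a b assume ab: "a \<in> M" "b \<in> M" "a o\<^sub>L p = b o\<^sub>L p"
    have "a - b = 0"
    proof (rule faithful[OF M_diff[OF ab(1,2)]])
      fix x assume "x \<in> V"
      then have "p x = x"
        by (simp add: p_def id_on_id V)
      then show "(a - b) x = 0"
        using compose_apply[OF ab(3), of x] by (simp add: blinfun.diff_left)
    qed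
    then show "a = b"
      by simp
  qed
  moreover have "normal_map M V (\<lambda>a. a o\<^sub>L p)"
    unfolding normal_map_def
  proof (intro allI impI, elim conjE)
    fix D s assume D: "D \<subseteq> self_adjoint_part M" "D \<noteq> {}"
      and dir: "\<forall>a\<in>D. \<forall>b\<in>D. \<exists>c\<in>D. op_le a c \<and> op_le b c" and s: "op_lub M D s"
    have sM: "s \<in> M" "adj s = s" and le_s: "\<And>d. d \<in> D \<Longrightarrow> op_le d s"
      using s by (auto simp: op_lub_def self_adjoint_part_def)
    have DM: "d \<in> M" if "d \<in> D" for d
      using D that by (auto simp: self_adjoint_part_def)
    show "op_lub (bounded_ops V) ((\<lambda>a. a o\<^sub>L p) ` D) (s o\<^sub>L p)"
      unfolding op_lub_def
    proof (intro conjI ballI impI)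
      show "s o\<^sub>L p \<in> self_adjoint_part (bounded_ops V)"
        by (simp add: self_adjoint_part_def bo adj sM)
      show "op_le d (s o\<^sub>L p)" if d: "d \<in> (\<lambda>a. a o\<^sub>L p) ` D" for d
      proof -
        obtain d' where "d' \<in> D" "d = d' o\<^sub>L p"
          using d by blast
        then show ?thesis
          using le_s[of d'] by (simp add: op_le_iff q DM sM)
      qed
      fix u assume u: "u \<in> self_adjoint_part (bounded_ops V)" "\<forall>d\<in>(\<lambda>a. a o\<^sub>L p) ` D. op_le d u"
      show "op_le (s o\<^sub>L p) u"
        unfolding op_le_iff
      proof (rule allI, rule field_le_epsilon)
        fix x and e :: real assume "0 < e"
        then obtain d where d: "d \<in> D" "qform s (p x) < qform d (p x) + e"
          using op_lub_approx[OF D _ s] dir by blast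
        have "qform (d o\<^sub>L p) x \<le> qform u x"
          using u(2) d(1) by (auto simp: op_le_iff)
        then show "qform (s o\<^sub>L p) x \<le> qform u x + e"
          using d by (simp add: q DM sM)
      qed
    qed
  qed
  ultimately show ?thesis
    using V(1) by (simp add: faithful_normal_rep_def p_def)
qed

lemma chi_r_obtain:
  obtains L :: "'h set" and \<pi> :: "'h oper \<Rightarrow> 'h oper" and B
  where "faithful_normal_rep K M L \<pi>" "orthonormal_basis L B" "chi_r K M = |B|"
    "\<And>(L' :: 'h set) \<pi>'. faithful_normal_rep K M L' \<pi>' \<Longrightarrow> |B| \<le>o hilbert_dim L'"
proof -
  let ?R = "{hilbert_dim L |(L :: 'h set) \<pi>. faithful_normal_rep K M L \<pi>}"
  have "faithful_normal_rep K M K (\<lambda>a. a o\<^sub>L id_on K)"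
    by (rule subspace_rep[OF K order_refl bo_in[OF M_bo] bo_eqI[OF K M_bo bo_zero[OF K]]]) auto
  then have ne: "?R \<noteq> {}"
    by blast
  have co: "Card_order r" if "r \<in> ?R" for r
    using that card_of_Card_order by (auto simp: hilbert_dim_def)
  obtain L \<pi> where L: "faithful_normal_rep K M L \<pi>" "chi_r K M = hilbert_dim L"
    using min_card_props(1)[OF ne co] unfolding chi_r_def by blast
  have "closed_csubspace L"
    using L(1) by (simp add: faithful_normal_rep_def)
  then obtain B where B: "orthonormal_basis L B" "hilbert_dim L = |B|"
    by (rule hilbert_dim_obtain)
  have "|B| \<le>o hilbert_dim L'" if "faithful_normal_rep K M L' \<pi>'" for L' :: "'h set" and \<pi>'
    using min_card_props(2)[OF ne co, of "hilbert_dim L'"] that L(2) B(2) by (auto simp: chi_r_def)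
  with L B show ?thesis
    using that by simp
qed

lemma chi_r_le_hilbert_dim:
  assumes "faithful_normal_rep K M (L :: 'h set) \<pi>"
  shows "chi_r K M \<le>o hilbert_dim L"
proof -
  obtain L0 :: "'h set" and \<pi>0 :: "'h oper \<Rightarrow> 'h oper" and B where "faithful_normal_rep K M L0 \<pi>0"
    "orthonormal_basis L0 B" and B: "chi_r K M = |B|"
    and le: "\<And>(L' :: 'h set) \<pi>'. faithful_normal_rep K M L' \<pi>' \<Longrightarrow> |B| \<le>o hilbert_dim L'"
    by (rule chi_r_obtain) (rule that, (assumption | blast)+)
  show ?thesis
    unfolding B by (rule le[OF assms])
qed

text \<open>The largest subspace \<open>W\<close> of \<open>K\<close> annihilated by
  \<open>a0 M\<close> is invariant under \<open>M\<close> and \<open>Mc\<close>, so its projection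
  is central. Since \<open>W\<close> contains \<open>E\<close>, it contains the image of
  \<open>E\<close> under the commutant of the center, which is total.\<close>

lemma center_total_family_faithful:
  assumes E: "E \<subseteq> K" "ccspan {blinfun_apply b x |b x. b \<in> commutant K (center M) \<and> x \<in> E} = K"
    and a0: "a0 \<in> M" "\<And>a x. a \<in> M \<Longrightarrow> x \<in> E \<Longrightarrow> a0 (a x) = 0"
  shows "a0 = 0"
proof -
  interpret C: vn K Mc
    by (rule vn_Mc)
  define W where "W = K \<inter> (\<Inter>a\<in>M. {v. (a0 o\<^sub>L a) v = 0})"
  have W: "closed_csubspace W"
    unfolding W_def
    by (intro closed_csubspace_Int K closed_csubspace_Inter)
      (auto intro!: closed_csubspace_kernel M_clinear M_compose a0 simp del: blinfun_apply_blinfun_compose)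
  have WK: "W \<subseteq> K"
    by (auto simp: W_def)
  have "id_on W \<in> Mc"
  proof (rule id_on_commutant[OF W WK M_sub adj_M])
    fix a v assume "a \<in> M" "v \<in> W"
    then show "a v \<in> W"
      using bo_in[OF M_bo] M_compose[of _ a] by (fastforce simp: W_def)
  qed
  moreover have "id_on W \<in> M"
  proof (rule id_on_in_M[OF W WK])
    fix b v assume b: "b \<in> Mc" and v: "v \<in> W"
    have "a0 (a (b v)) = 0" if "a \<in> M" for a
      using v that by (simp add: Mc_commute_apply[OF that b] Mc_commute_apply[OF a0(1) b] W_def blinfun.zero_right)
    then show "b v \<in> W"
      using bo_in[OF Mc_bo[OF b]] by (simp add: W_def)
  qed
  ultimately have pZ: "id_on W \<in> center M"
    by (simp add: center_eq)
  have EW: "E \<subseteq> W"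
    using E a0 by (auto simp: W_def)
  have "b x \<in> W" if "b \<in> commutant K (center M)" "x \<in> E" for b x
  proof -
    have "id_on W (b x) = b (id_on W x)"
      using that(1) pZ by (metis commutant_iff blinfun_apply_blinfun_compose)
    also have "\<dots> = b x"
      using EW that(2) by (simp add: id_on_id[OF W] subsetD)
    finally show ?thesis
      by (simp add: id_on_iff[OF W])
  qed
  then have "ccspan {blinfun_apply b x |b x. b \<in> commutant K (center M) \<and> x \<in> E} \<subseteq> W"
    by (intro ccspan_minimal W) auto
  then have "K \<subseteq> W"
    using E(2) by simp
  then have "a0 v = 0" if "v \<in> K" for v
    using that M_one one_apply by (force simp: W_def)
  then show ?thesis
    by (intro bo_eqI[OF K M_bo[OF a0(1)] bo_zero[OF K]]) auto
qed

lemma chi_r_le: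
  assumes B: "chi_r K M = |B|" and D: "dec (center M) = |D|" and S: "generates K M S" "S \<noteq> {}"
  shows "|B| \<le>o |(UNIV :: nat set) \<times> (D \<times> S)|"
proof -
  let ?N = "(UNIV :: nat set) \<times> (D \<times> S)"
  interpret Z: vn K "center M"
    by (rule vn_center)
  interpret ZC: vn K "commutant K (center M)"
    by (rule Z.vn_Mc)
  have Dne: "D \<noteq> {}"
    by (rule Z.dec_nonempty[OF D])
  have N: "infinite ?N"
    using Dne S(2) by (simp add: finite_cartesian_product_iff)
  obtain E where E: "E \<subseteq> K" "\<forall>x\<in>E. x \<noteq> 0"
    "\<forall>x\<in>E. \<forall>y\<in>E. x \<noteq> y \<longrightarrow> (\<forall>a\<in>commutant K (center M). cinner (a x) y = 0)"
    "ccspan {blinfun_apply a x |a x. a \<in> commutant K (center M) \<and> x \<in> E} = K"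
    using ZC.cyclic_decomposition_ex by (elim exE conjE)
  define P where "P = (\<lambda>x. id_on (cyc (commutant K (center M)) x)) ` E"
  have P: "inj_on (\<lambda>x. id_on (cyc (commutant K (center M)) x)) E" "P \<subseteq> center M" "orthogonal_projections P"
    using ZC.orthogonal_cyc_projections[of E] E unfolding P_def Z.bicommutant by blast+
  have "|E| \<le>o |P|"
    using P(1) unfolding P_def card_of_ordLeq[symmetric] by blast
  also have "|P| \<le>o |D|"
  proof -
    obtain D' where "dec (center M) = |D'|" "\<And>Q. Q \<subseteq> center M \<Longrightarrow> orthogonal_projections Q \<Longrightarrow> |Q| \<le>o |D'|"
      by (rule Z.dec_obtain) blast
    then show ?thesis
      using P D by metis
  qed
  also have "|D| \<le>o |D \<times> S|"
    by (rule card_of_Times1[OF S(2)])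
  also have "|D \<times> S| \<le>o |?N|"
    by (rule card_of_Times2) simp
  finally have E_card: "|E| \<le>o |?N|" .
  have "|S| \<le>o |D \<times> S|"
    by (rule card_of_Times2[OF Dne])
  also have "|D \<times> S| \<le>o |?N|"
    by (rule card_of_Times2) simp
  finally have S_card: "|S| \<le>o |?N|" .
  define V where "V = ccspan {blinfun_apply a x |a x. a \<in> M \<and> x \<in> E}"
  have V: "closed_csubspace V"
    by (simp add: V_def closed_csubspace_ccspan)
  have aV: "a x \<in> V" if "a \<in> M" "x \<in> E" for a x
    unfolding V_def by (rule subsetD[OF ccspan_superset]) (use that in blast)
  have VK: "V \<subseteq> K"
    unfolding V_def by (rule ccspan_minimal[OF _ K]) (use bo_in[OF M_bo] in auto)
  have "faithful_normal_rep K M V (\<lambda>a. a o\<^sub>L id_on V)"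
  proof (rule subspace_rep[OF V VK])
    fix a v assume a: "a \<in> M" and v: "v \<in> V"
    have "V \<subseteq> {v. a v \<in> V}"
      unfolding V_def[THEN arg_cong[of _ _ "\<lambda>X. X \<subseteq> {v. a v \<in> V}"]]
    proof (rule ccspan_minimal[OF _ closed_csubspace_op_vimage[OF M_clinear[OF a] V]])
      show "{blinfun_apply a x |a x. a \<in> M \<and> x \<in> E} \<subseteq> {v. a v \<in> V}"
        using aV[OF M_compose[OF a]] by auto
    qed
    then show "a v \<in> V"
      using v by blast
  next
    fix a assume "a \<in> M" "\<And>x. x \<in> V \<Longrightarrow> a x = 0"
    then show "a = 0"
      using aV by (intro center_total_family_faithful[OF E(1,4)]) auto
  qed
  moreover obtain B' where B': "orthonormal_basis V B'" "hilbert_dim V = |B'|"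
    using hilbert_dim_obtain[OF V] .
  ultimately have "|B| \<le>o |B'|"
    using B by (metis chi_r_le_hilbert_dim)
  also have "|B'| \<le>o |?N|"
  proof (rule card_orthonormal_le[OF _ _ N])
    let ?T = "S \<union> adj ` S"
    \<comment> \<open>Words over a set of size at most \<open>|?N|\<close> are themselves at most
      \<open>|?N|\<close> many, so adjoints and products of generators cost nothing.\<close>
    let ?Y = "(\<lambda>(ws, x). foldr blinfun_apply ws x) ` (lists ?T \<times> E)"
    show "orthonormal B'"
      using B'(1) by (simp add: orthonormal_basis_iff)
    show "|?Y| \<le>o |?N|"
      by (intro card_image_le_o card_Times_le N card_lists_le card_Un_le S_card E_card)
    have "a x \<in> ccspan ?Y" if "a \<in> M" "x \<in> E" for a x
    proof -
      have "a x \<in> cyc M x"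
        by (rule in_cyc[OF that(1)])
      also have "\<dots> \<subseteq> ccspan ((\<lambda>ws. foldr blinfun_apply ws x) ` lists ?T)"
        using cyc_subset_words[OF S(1)] that E by blast
      also have "\<dots> \<subseteq> ccspan ?Y"
        by (rule ccspan_mono) (use that in auto)
      finally show ?thesis .
    qed
    then have "V \<subseteq> ccspan ?Y"
      unfolding V_def by (intro ccspan_minimal closed_csubspace_ccspan) auto
    then show "B' \<subseteq> ccspan ?Y"
      using B'(1) ccspan_superset[of B'] by (auto simp: orthonormal_basis_iff)
  qed
  finally show ?thesis .
qed

text \<open>Restates all bounds through plain sets, so that the remaining claims are cardinal
  arithmetic; \<open>(UNIV :: nat set) \<times> B\<close> stands for
  \<open>\<aleph>\<^sub>0 \<cdot> chi_r K M\<close>.\<close>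

lemma invariants_obtain:
  obtains B D S P :: "_ set"
  where "chi_r K M = |B|" "dec (center M) = |D|" "gen K M = |S|" "dec M = |P|"
    "|D| \<le>o |P|" "|P| \<le>o |(UNIV :: nat set) \<times> B|"
    "|(UNIV :: nat set) \<times> B| =o |(UNIV :: nat set) \<times> (D \<times> S)|"
    "D \<noteq> {}" "S \<noteq> {}" "finite B \<Longrightarrow> finite_dimensional M"
proof -
  interpret Z: vn K "center M"
    by (rule vn_center)
  obtain S where S: "generates K M S" "S \<noteq> {}" "gen K M = |S|"
    "\<And>S'. generates K M S' \<Longrightarrow> S' \<noteq> {} \<Longrightarrow> |S| \<le>o |S'|"
    by (rule gen_obtain) (rule that, (assumption | blast)+)
  obtain D where D: "D \<subseteq> center M" "orthogonal_projections D" "dec (center M) = |D|"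
    by (rule Z.dec_obtain) (rule that, (assumption | blast)+)
  obtain P where P: "P \<subseteq> M" "orthogonal_projections P" "dec M = |P|"
    "\<And>Q. Q \<subseteq> M \<Longrightarrow> orthogonal_projections Q \<Longrightarrow> |Q| \<le>o |P|"
    by (rule dec_obtain) (rule that, (assumption | blast)+)
  obtain L :: "'h set" and \<pi> :: "'h oper \<Rightarrow> 'h oper" and B
    where rep: "faithful_normal_rep K M L \<pi>" and B: "orthonormal_basis L B" "chi_r K M = |B|"
    by (rule chi_r_obtain) (rule that, (assumption | blast)+)
  interpret R: normal_rep K M L \<pi>
    by unfold_locales (rule rep)
  let ?NB = "(UNIV :: nat set) \<times> B" and ?N = "(UNIV :: nat set) \<times> (D \<times> S)"
  have Dne: "D \<noteq> {}"
    by (rule Z.dec_nonempty[OF D(3)])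
  have Bne: "B \<noteq> {}"
  proof
    assume "B = {}"
    then have "L \<subseteq> {0}"
      using B(1) ccspan_minimal[OF _ closed_csubspace_zero, of B] by (auto simp: orthonormal_basis_iff)
    then show False
      using R.L_ne csub_zero[OF R.L] by blast
  qed
  have NB: "infinite ?NB" and N: "infinite ?N"
    using Bne Dne S(2) by (simp_all add: finite_cartesian_product_iff)
  have B_NB: "|B| \<le>o |?NB|"
    by (rule card_of_Times2) simp
  have "|D| \<le>o |?NB|" and P_NB: "|P| \<le>o |?NB|"
    using R.card_orthogonal_projections_le[OF B(1) NB B_NB _ D(2)] D(1) center_subset
      R.card_orthogonal_projections_le[OF B(1) NB B_NB P(1,2)] by auto
  moreover have "|S| \<le>o |?NB|"
  proof -
    obtain S' where S': "S' \<noteq> {}" "generates K M S'" "|S'| \<le>o |?NB|"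
      using R.generating_set_ex[OF B(1) NB B_NB] by (elim exE conjE)
    show ?thesis
      by (rule ordLeq_transitive[OF S(4)[OF S'(2,1)] S'(3)])
  qed
  moreover have "|UNIV :: nat set| \<le>o |?NB|"
    by (rule card_of_Times1[OF Bne])
  ultimately have "|?N| \<le>o |?NB|"
    by (intro card_Times_le NB)
  moreover have "|?NB| \<le>o |?N|"
    by (intro card_Times_le N chi_r_le[OF B(2) D(3) S(1,2)]) (rule card_of_Times1, use Dne S(2) in simp)
  ultimately have "|?NB| =o |?N|"
    by (simp add: ordIso_iff_ordLeq)
  moreover have "|D| \<le>o |P|"
    by (rule P(4)[OF order_trans[OF D(1) center_subset] D(2)])
  ultimately show ?thesis
    by (intro that[of B D S P] B(2) D(3) S(2,3) P(3) P_NB Dne R.finite_basis_imp_finite_dimensional[OF B(1)])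
qed

text \<open>The number \<open>dec M\<close> is at most
  \<open>\<aleph>\<^sub>0 \<cdot> dec (center M) \<cdot> gen K M\<close>. If
  \<open>dec (center M)\<close> were at most \<open>\<aleph>\<^sub>0 \<cdot> gen K M\<close>, this
  product would collapse to the latter, against the hypothesis; so \<open>dec (center M)\<close>
  dominates, and the product collapses to it.\<close>

lemma dec_eq_dec_center:
  assumes less: "natLeq *c gen K M <o dec M"
  shows "dec M =o dec (center M)"
proof -
  obtain B D S P :: "_ set" where inv: "chi_r K M = |B|" "dec (center M) = |D|" "gen K M = |S|" "dec M = |P|"
    "|D| \<le>o |P|" "|P| \<le>o |(UNIV :: nat set) \<times> B|"
    "|(UNIV :: nat set) \<times> B| =o |(UNIV :: nat set) \<times> (D \<times> S)|" "D \<noteq> {}" "S \<noteq> {}"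
    by (rule invariants_obtain) (rule that, (assumption | blast)+)
  let ?NS = "(UNIV :: nat set) \<times> S" and ?N = "(UNIV :: nat set) \<times> (D \<times> S)"
  have NS: "infinite ?NS"
    using inv by (simp add: finite_cartesian_product_iff)
  have nat_NS: "|UNIV :: nat set| \<le>o |?NS|" and S_NS: "|S| \<le>o |?NS|"
    using inv by (auto intro: card_of_Times1 card_of_Times2)
  have less': "|?NS| <o |P|"
    using less by (simp add: inv cprod_def Field_natLeq Field_card_of)
  have P_N: "|P| \<le>o |?N|"
    using inv ordLeq_ordIso_trans by blast
  have NS_D: "|?NS| \<le>o |D|"
  proof (rule ccontr)
    assume "\<not> ?thesis"
    then have "|D| \<le>o |?NS|"
      using ordLeq_total[OF card_of_Well_order card_of_Well_order] by blast
    then have "|?N| \<le>o |?NS|"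
      by (intro card_Times_le NS nat_NS S_NS)
    then show False
      using P_N less' ordLeq_transitive not_ordLess_ordLeq by blast
  qed
  then have "infinite D"
    using NS card_of_ordLeq_infinite by blast
  then have "|?N| \<le>o |D|"
    by (intro card_Times_le card_of_mono1[OF order_refl] ordLeq_transitive[OF nat_NS NS_D]
        ordLeq_transitive[OF S_NS NS_D])
  then have "|P| \<le>o |D|"
    using P_N ordLeq_transitive by blast
  then show ?thesis
    using inv by (simp add: ordIso_iff_ordLeq)
qed

lemma chi_r_eq: "natLeq *c chi_r K M =o natLeq *c dec (center M) *c gen K M"
proof -
  obtain B D S P :: "_ set" where inv: "chi_r K M = |B|" "dec (center M) = |D|" "gen K M = |S|"
    "|(UNIV :: nat set) \<times> B| =o |(UNIV :: nat set) \<times> (D \<times> S)|"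
    by (rule invariants_obtain) (rule that, (assumption | blast)+)
  then show ?thesis
    by (simp add: cprod_def Field_natLeq Field_card_of)
qed

text \<open>A countable \<open>D\<close> is absorbed by \<open>\<aleph>\<^sub>0\<close>. When
  \<open>M\<close> is infinite-dimensional, \<open>B\<close> is infinite and absorbs the factor
  \<open>\<aleph>\<^sub>0\<close> on the other side.\<close>

lemma chi_r_sigma_finite_center:
  assumes "sigma_finite (center M)"
  shows "chi_r K M \<le>o natLeq *c gen K M"
    and "\<not> finite_dimensional M \<Longrightarrow> chi_r K M =o natLeq *c gen K M"
proof -
  obtain B D S P :: "_ set" where inv: "chi_r K M = |B|" "dec (center M) = |D|" "gen K M = |S|"
    "|(UNIV :: nat set) \<times> B| =o |(UNIV :: nat set) \<times> (D \<times> S)|" "D \<noteq> {}" "S \<noteq> {}"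
    "finite B \<Longrightarrow> finite_dimensional M"
    by (rule invariants_obtain) (rule that, (assumption | blast)+)
  let ?NS = "(UNIV :: nat set) \<times> S" and ?N = "(UNIV :: nat set) \<times> (D \<times> S)" and ?NB = "(UNIV :: nat set) \<times> B"
  have NS: "infinite ?NS"
    using inv by (simp add: finite_cartesian_product_iff)
  have nat_NS: "|UNIV :: nat set| \<le>o |?NS|" and S_NS: "|S| \<le>o |?NS|"
    using inv by (auto intro: card_of_Times1 card_of_Times2)
  have gen: "natLeq *c gen K M = |?NS|"
    by (simp add: inv cprod_def Field_natLeq Field_card_of)
  have "|D| \<le>o natLeq"
    using assms inv by (simp add: sigma_finite_def)
  also have "natLeq =o |UNIV :: nat set|"
    using card_of_nat ordIso_symmetric by blast
  finally have "|D| \<le>o |?NS|"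
    using nat_NS ordLeq_transitive by blast
  then have N_NS: "|?N| \<le>o |?NS|"
    by (intro card_Times_le NS nat_NS S_NS)
  have "|B| \<le>o |?NB|"
    by (rule card_of_Times2) simp
  then have "|B| \<le>o |?N|"
    using inv(4) ordLeq_ordIso_trans by blast
  then have le: "|B| \<le>o |?NS|"
    using N_NS ordLeq_transitive by blast
  then show "chi_r K M \<le>o natLeq *c gen K M"
    unfolding gen unfolding inv(1) .
  assume "\<not> finite_dimensional M"
  then have B: "infinite B"
    using inv by blast
  have "|?NS| \<le>o |?N|"
    by (intro card_of_Times_mono2 card_of_Times2) (use inv in simp)
  also have "|?N| \<le>o |?NB|"
    using inv(4) ordIso_iff_ordLeq by blast
  also have "|?NB| \<le>o |B|"
    using B infinite_iff_card_of_nat by (intro card_Times_le card_of_mono1 order_refl) blast+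
  finally have "|?NS| \<le>o |B|" .
  with le show "chi_r K M =o natLeq *c gen K M"
    unfolding gen unfolding inv(1) by (simp add: ordIso_iff_ordLeq)
qed

end

section \<open>Finite-dimensional factors\<close>

lemma compose_sum_left: "sum f I o\<^sub>L a = (\<Sum>i\<in>I. f i o\<^sub>L a)"
  for a :: "'h::complex_hilbert_space oper" and f :: "'i \<Rightarrow> 'h oper"
  by (rule blinfun_eqI) (simp add: blinfun.sum_left)

lemma compose_sum_right: "a o\<^sub>L sum f I = (\<Sum>i\<in>I. a o\<^sub>L f i)"
  for a :: "'h::complex_hilbert_space oper" and f :: "'i \<Rightarrow> 'h oper"
  by (rule blinfun_eqI) (simp add: blinfun.sum_left blinfun.sum_right)

lemma mat_adjoint_index:
  "A \<in> carrier_mat n n \<Longrightarrow> i < n \<Longrightarrow> j < n \<Longrightarrow> mat_adjoint A $$ (i, j) = cnj (A $$ (j, i))"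
  for A :: "complex mat"
  by (auto simp: mat_adjoint_def mat_of_rows_def)

lemma mat_adjoint_carrier: "A \<in> carrier_mat n n \<Longrightarrow> mat_adjoint A \<in> carrier_mat n n"
  for A :: "complex mat"
  by (auto simp: mat_adjoint_def mat_of_rows_def)

context vn
begin

text \<open>The projection onto the closed span of \<open>M p K\<close> is central.\<close>
lemma factor_connected:
  assumes factor: "\<And>z. z \<in> projections (center M) \<Longrightarrow> z = 0 \<or> z = id_on K"
    and p: "p \<in> projections M" "p \<noteq> 0" and q: "q \<in> projections M" "q \<noteq> 0"
  shows "\<exists>a\<in>M. q o\<^sub>L (a o\<^sub>L p) \<noteq> 0"
proof (rule ccontr)
  assume "\<not> ?thesis"
  then have zero: "q o\<^sub>L (a o\<^sub>L p) = 0" if "a \<in> M" for a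
    using that by blast
  define S where "S = {blinfun_apply a (p x) |a x. a \<in> M}"
  define V where "V = ccspan S"
  note pM = projectionsD(1)[OF p(1)] and qM = projectionsD(1)[OF q(1)]
  have V: "closed_csubspace V"
    by (simp add: V_def closed_csubspace_ccspan)
  have SV: "S \<subseteq> V"
    unfolding V_def by (rule ccspan_superset)
  have VK: "V \<subseteq> K"
    unfolding V_def by (rule ccspan_minimal[OF _ K]) (use bo_in[OF M_bo] in \<open>auto simp: S_def\<close>)
  have inv: "b v \<in> V" if bS: "\<And>s. s \<in> S \<Longrightarrow> b s \<in> S" and b: "clinear_op b" and v: "v \<in> V" for b :: "'h oper" and v
  proof -
    have "V \<subseteq> {v. b v \<in> V}"
      unfolding V_def[THEN arg_cong[of _ _ "\<lambda>X. X \<subseteq> {v. b v \<in> V}"]]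
      by (rule ccspan_minimal[OF _ closed_csubspace_op_vimage[OF b V]]) (use bS SV in blast)
    then show ?thesis
      using v by blast
  qed
  have SM: "b s \<in> S" if b: "b \<in> M" and s: "s \<in> S" for b s
  proof -
    obtain a x where "a \<in> M" "s = blinfun_apply a (p x)"
      using s by (auto simp: S_def)
    then have "b s = blinfun_apply (b o\<^sub>L a) (p x)" "b o\<^sub>L a \<in> M"
      using M_compose[OF b] by auto
    then show ?thesis
      unfolding S_def by blast
  qed
  have SMc: "b s \<in> S" if b: "b \<in> Mc" and s: "s \<in> S" for b s
  proof -
    obtain a x where "a \<in> M" "s = blinfun_apply a (p x)"
      using s by (auto simp: S_def)
    then have "b s = blinfun_apply a (p (b x))"
      using Mc_commute_apply[OF _ b] pM by metis
    then show ?thesis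
      using \<open>a \<in> M\<close> unfolding S_def by blast
  qed
  have "id_on V \<in> Mc"
    by (rule id_on_commutant[OF V VK M_sub adj_M]) (simp_all add: inv SM M_clinear)
  moreover have "id_on V \<in> M"
    by (rule id_on_in_M[OF V VK]) (simp add: inv SMc bo_clinear[OF Mc_bo])
  ultimately have "id_on V \<in> projections (center M)"
    using V by (simp add: projections_def center_eq id_on_idem adj_id_on)
  moreover have "id_on V \<noteq> 0"
  proof
    assume "id_on V = 0"
    then have "v = 0" if "v \<in> V" for v
      using id_on_id[OF V that] by simp
    moreover have "p x \<in> S" for x
      unfolding S_def mem_Collect_eq using pM compose_apply[OF projectionsD(2)[OF p(1)], of x]
      by (intro exI[of _ p] exI[of _ x]) simp
    ultimately have "p x = 0" for x
      using SV by blast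
    then show False
      using p(2) by (metis blinfun_eqI zero_blinfun.rep_eq)
  qed
  ultimately have "id_on V = id_on K"
    using factor by blast
  then have "x \<in> V \<longleftrightarrow> x \<in> K" for x
    using id_on_iff[OF V, of x] id_on_iff[OF K, of x] by simp
  then have "V = K"
    by blast
  moreover have "V \<subseteq> {v. q v = 0}"
    unfolding V_def
  proof (rule ccspan_minimal[OF _ closed_csubspace_kernel[OF M_clinear[OF qM]]], rule subsetI)
    fix s assume "s \<in> S"
    then obtain a x where "a \<in> M" "s = blinfun_apply a (p x)"
      by (auto simp: S_def)
    then show "s \<in> {v. q v = 0}"
      using compose_apply[OF zero[of a], of x] by simp
  qed
  ultimately have "q = 0"
    by (intro bo_eqI[OF K M_bo[OF qM] bo_zero[OF K]]) auto
  then show False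
    using q by simp
qed

text \<open>For \<open>w = q a p\<close>, minimality of \<open>p\<close> gives
  \<open>w* w = c p\<close> with \<open>c > 0\<close>, so rescaling normalises the initial
  projection. Then \<open>v v* = d q\<close>, and \<open>v v* v = v\<close> forces
  \<open>d = 1\<close>.\<close>

lemma partial_isometry_ex:
  assumes p: "minimal_projection M p" and q: "minimal_projection M q"
    and a: "a \<in> M" "q o\<^sub>L (a o\<^sub>L p) \<noteq> 0"
  shows "\<exists>v\<in>M. adj v o\<^sub>L v = p \<and> v o\<^sub>L adj v = q \<and> v o\<^sub>L p = v \<and> q o\<^sub>L v = v"
proof -
  have pq: "p \<in> projections M" "q \<in> projections M"
    using p q by (auto simp: minimal_projection_def)
  note pD = projectionsD[OF pq(1)] and qD = projectionsD[OF pq(2)]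
  define w where "w = q o\<^sub>L (a o\<^sub>L p)"
  have wM: "w \<in> M" and w0: "w \<noteq> 0"
    using a pD qD by (auto simp: w_def M_compose)
  note w_cl = M_clinear[OF wM]
  have wp: "w o\<^sub>L p = w"
    by (simp add: w_def blinfun_compose_assoc pD)
  have qw: "q o\<^sub>L w = w"
    unfolding w_def by (simp add: qD flip: blinfun_compose_assoc)
  have wa: "adj w \<in> M" "p o\<^sub>L adj w = adj w" "adj w o\<^sub>L q = adj w"
    using adj_compose[OF w_cl proj_clinear[OF pq(1)]] adj_compose[OF proj_clinear[OF pq(2)] w_cl]
    by (simp_all add: wp qw pD qD adj_M wM)
  obtain c where c: "adj w o\<^sub>L w = c *\<^sub>C p"
    using minimal_corner[OF p M_compose[OF wa(1) wM]] wp wa by (metis blinfun_compose_assoc)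
  obtain x where x: "w x \<noteq> 0"
    using w0 by (metis blinfun_eqI zero_blinfun.rep_eq)
  \<comment> \<open>Evaluating \<open>w* w = c p\<close> at one vector with
    \<open>w x \<noteq> 0\<close> identifies \<open>c\<close> with this positive real.\<close>
  define r where "r = (norm (w x))\<^sup>2 / (norm (p x))\<^sup>2"
  have px: "p x \<noteq> 0"
    using x compose_apply[OF wp, of x] blinfun.zero_right by metis
  have "c * cinner (p x) x = of_real ((norm (w x))\<^sup>2)"
  proof -
    have "c * cinner (p x) x = cinner ((adj w o\<^sub>L w) x) x"
      by (simp add: c scaleC_blinfun.rep_eq cinner_scaleC_left)
    also have "\<dots> = cinner (w x) (w x)"
      by (simp add: cinner_adj'[OF w_cl])
    finally show ?thesis
      by (simp only: cinner_same)
  qed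
  moreover have "cinner (p x) x = of_real ((norm (p x))\<^sup>2)"
  proof -
    have "cinner (p x) x = cinner (p (p x)) x"
      using compose_apply[OF pD(2), of x] by simp
    also have "\<dots> = cinner (p x) (p x)"
      using cinner_adj[OF proj_clinear[OF pq(1)], of "p x" x] by (simp add: pD)
    finally show ?thesis
      by (simp only: cinner_same)
  qed
  ultimately have "c * of_real ((norm (p x))\<^sup>2) = of_real ((norm (w x))\<^sup>2)"
    by simp
  then have cr: "c = of_real r"
    using px by (simp add: r_def field_simps)
  have r: "0 < r"
    using x px by (simp add: r_def)
  define v where "v = (1 / sqrt r) *\<^sub>R w"
  have va: "adj v = (1 / sqrt r) *\<^sub>R adj w"
    by (simp add: v_def scaleR_eq_scaleC_op adj_scaleC w_cl)
  have vM: "v \<in> M" and vp: "v o\<^sub>L p = v" and qv: "q o\<^sub>L v = v"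
    by (simp_all add: v_def M_scaleR wM compose_distrib wp qw)
  have "adj v o\<^sub>L v = (1 / r) *\<^sub>R (adj w o\<^sub>L w)"
    using r by (simp add: va) (simp add: v_def compose_distrib)
  also have "\<dots> = p"
    using r by (simp add: c cr scaleR_eq_scaleC_op scaleC_scaleC)
  finally have vv: "adj v o\<^sub>L v = p" .
  have "v \<noteq> 0"
    using w0 r by (simp add: v_def)
  have "adj v o\<^sub>L q = adj v"
    by (simp add: va compose_distrib wa)
  then obtain d where d: "v o\<^sub>L adj v = d *\<^sub>C q"
    using minimal_corner[OF q M_compose[OF vM adj_M[OF vM]]] qv by (metis blinfun_compose_assoc)
  have "d *\<^sub>C v = (v o\<^sub>L adj v) o\<^sub>L v"
    by (simp add: d compose_scaleC_left qv)
  also have "\<dots> = 1 *\<^sub>C v"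
    by (simp add: blinfun_compose_assoc vv vp)
  finally have "d = 1"
    using \<open>v \<noteq> 0\<close> complex_vector.scale_right_imp_eq by blast
  then show ?thesis
    using vM vv d vp qv by auto
qed

text \<open>In a factor, partial isometries \<open>v i\<close> connect one minimal projection
  \<open>p\<close> with all members of a minimal decomposition of the unit. The products
  \<open>v i o\<^sub>L adj (v j)\<close> are matrix units, and the matrix entry of \<open>x\<close>
  is the coefficient of \<open>p\<close> in
  \<open>adj (v i) o\<^sub>L (x o\<^sub>L v j)\<close>.\<close>

lemma factor_star_isomorphic_matrix_algebra:
  assumes factor: "\<And>z. z \<in> projections (center M) \<Longrightarrow> z = 0 \<or> z = id_on K"
    and fin: "finite_dimensional M"
  shows "\<exists>n\<ge>1. star_isomorphic (oper_algebra K M) (matrix_algebra n)"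
proof -
  obtain P where P: "finite P" "\<forall>p\<in>P. minimal_projection M p"
    "\<forall>p\<in>P. \<forall>q\<in>P. p \<noteq> q \<longrightarrow> p o\<^sub>L q = 0" "\<Sum>P = id_on K"
    using minimal_decomposition fin by (auto simp: finite_dimensional_iff)
  define n where "n = card P"
  obtain h where h: "bij_betw h {..<n} P"
    using ex_bij_betw_nat_finite[OF P(1)] by (auto simp: n_def lessThan_atLeast0)
  have hP: "h i \<in> P" if "i < n" for i
    using h that by (auto simp: bij_betw_def)
  have "id_on K \<noteq> 0"
    using one_apply K_ne csub_zero[OF K] by fastforce
  then have "P \<noteq> {}"
    using P(4) by auto
  then have n: "0 < n"
    using P(1) by (simp add: n_def card_gt_0_iff)
  define p where "p = h 0"
  have mp: "minimal_projection M p"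
    using P(2) hP[OF n] by (simp add: p_def)
  have minp: "p \<in> projections M" "p \<noteq> 0"
    using mp by (auto simp: minimal_projection_def)
  note pD = projectionsD[OF minp(1)]
  have "\<exists>v. i < n \<longrightarrow> v \<in> M \<and> adj v o\<^sub>L v = p \<and> v o\<^sub>L adj v = h i \<and> v o\<^sub>L p = v \<and> h i o\<^sub>L v = v" for i
  proof (cases "i < n")
    case True
    have mi: "minimal_projection M (h i)"
      using P(2) hP[OF True] by blast
    then have "h i \<in> projections M" "h i \<noteq> 0"
      by (auto simp: minimal_projection_def)
    then obtain a where "a \<in> M" "h i o\<^sub>L (a o\<^sub>L p) \<noteq> 0"
      using factor_connected[OF factor minp] by blast
    from partial_isometry_ex[OF mp mi this] show ?thesis
      by blast
  qed simp
  from choice[OF allI[OF this]] obtain v where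
    "\<forall>i. i < n \<longrightarrow> v i \<in> M \<and> adj (v i) o\<^sub>L v i = p \<and> v i o\<^sub>L adj (v i) = h i \<and> v i o\<^sub>L p = v i \<and> h i o\<^sub>L v i = v i" ..
  then have v: "\<And>i. i < n \<Longrightarrow> v i \<in> M" "\<And>i. i < n \<Longrightarrow> adj (v i) o\<^sub>L v i = p"
    "\<And>i. i < n \<Longrightarrow> v i o\<^sub>L adj (v i) = h i" "\<And>i. i < n \<Longrightarrow> v i o\<^sub>L p = v i" "\<And>i. i < n \<Longrightarrow> h i o\<^sub>L v i = v i"
    by simp_all
  note va = adj_M[OF v(1)] and v_cl = M_clinear[OF v(1)]
  have hD: "adj (h i) = h i" "clinear_op (h i)" if "i < n" for i
    using P(2) hP[OF that] by (auto simp: minimal_projection_def projections_def M_clinear)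
  have vap: "p o\<^sub>L adj (v i) = adj (v i)" and vah: "adj (v i) o\<^sub>L h i = adj (v i)" if "i < n" for i
    using adj_compose[OF v_cl[OF that] proj_clinear[OF minp(1)]] adj_compose[OF hD(2)[OF that] v_cl[OF that]]
    by (simp_all add: v that pD hD)
  have vv: "adj (v i) o\<^sub>L v j = (if i = j then p else 0)" if "i < n" "j < n" for i j
  proof (cases "i = j")
    case False
    then have "h i \<noteq> h j"
      using h that by (auto simp: bij_betw_def inj_on_def)
    then have "h i o\<^sub>L h j = 0"
      using P(3) hP that by blast
    moreover have "adj (v i) o\<^sub>L v j = adj (v i) o\<^sub>L (h i o\<^sub>L h j) o\<^sub>L v j"
      using vah[OF that(1)] v(5)[OF that(2)] by (metis blinfun_compose_assoc)
    ultimately show ?thesis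
      using False by simp
  qed (simp add: v that)
  have sum_vv: "(\<Sum>k<n. v k o\<^sub>L adj (v k)) = id_on K"
    using sum.reindex_bij_betw[OF h, of "\<lambda>x. x"] P(4) by (simp add: v)
  define X where "X x i j = (SOME c. adj (v i) o\<^sub>L (x o\<^sub>L v j) = c *\<^sub>C p)" for x i j
  have X: "adj (v i) o\<^sub>L (x o\<^sub>L v j) = X x i j *\<^sub>C p" if "x \<in> M" "i < n" "j < n" for x i j
    unfolding X_def
  proof (rule someI_ex, rule minimal_corner[OF mp])
    show "adj (v i) o\<^sub>L (x o\<^sub>L v j) \<in> M"
      using that by (simp add: M_compose v va)
    show "p o\<^sub>L (adj (v i) o\<^sub>L (x o\<^sub>L v j)) = adj (v i) o\<^sub>L (x o\<^sub>L v j)"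
      using vap[OF that(2)] by (metis blinfun_compose_assoc)
    show "(adj (v i) o\<^sub>L (x o\<^sub>L v j)) o\<^sub>L p = adj (v i) o\<^sub>L (x o\<^sub>L v j)"
      using v(4)[OF that(3)] by (simp add: blinfun_compose_assoc)
  qed
  have X_eqI: "X x i j = c" if "x \<in> M" "i < n" "j < n" "adj (v i) o\<^sub>L (x o\<^sub>L v j) = c *\<^sub>C p" for x i j c
    using X[OF that(1-3)] that(4) minp(2) complex_vector.scale_right_imp_eq by metis
  \<comment> \<open>The unit, written as a sum of the \<open>v k o\<^sub>L adj (v k)\<close>, is
    inserted on both sides of \<open>x\<close>.\<close>
  have recon: "x = (\<Sum>i<n. \<Sum>j<n. X x i j *\<^sub>C (v i o\<^sub>L adj (v j)))" if x: "x \<in> M" for x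
  proof -
    have "x = (\<Sum>i<n. v i o\<^sub>L adj (v i)) o\<^sub>L (x o\<^sub>L (\<Sum>j<n. v j o\<^sub>L adj (v j)))"
      by (simp add: sum_vv one_compose x)
    also have "\<dots> = (\<Sum>i<n. \<Sum>j<n. (v i o\<^sub>L adj (v i)) o\<^sub>L (x o\<^sub>L (v j o\<^sub>L adj (v j))))"
      by (simp add: compose_sum_left compose_sum_right) (rule sum.swap)
    also have "\<dots> = (\<Sum>i<n. \<Sum>j<n. X x i j *\<^sub>C (v i o\<^sub>L adj (v j)))"
    proof (intro sum.cong refl)
      fix i j assume ij: "i \<in> {..<n}" "j \<in> {..<n}"
      have "(v i o\<^sub>L adj (v i)) o\<^sub>L (x o\<^sub>L (v j o\<^sub>L adj (v j))) = v i o\<^sub>L ((adj (v i) o\<^sub>L (x o\<^sub>L v j)) o\<^sub>L adj (v j))"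
        by (simp add: blinfun_compose_assoc)
      also have "\<dots> = X x i j *\<^sub>C (v i o\<^sub>L adj (v j))"
        using ij by (simp add: X x compose_scaleC_left vap compose_scaleC_right v_cl)
      finally show "(v i o\<^sub>L adj (v i)) o\<^sub>L (x o\<^sub>L (v j o\<^sub>L adj (v j))) = X x i j *\<^sub>C (v i o\<^sub>L adj (v j))" .
    qed
    finally show ?thesis .
  qed
  define F where "F x = mat n n (\<lambda>(i, j). X x i j)" for x
  have F_carrier: "F x \<in> carrier_mat n n" for x
    by (simp add: F_def)
  have F_index: "F x $$ (i, j) = X x i j" if "i < n" "j < n" for x i j
    using that by (simp add: F_def)
  have F_eqI: "F x = A" if "A \<in> carrier_mat n n" "\<And>i j. i < n \<Longrightarrow> j < n \<Longrightarrow> X x i j = A $$ (i, j)" for x A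
    using that by (intro eq_matI) (auto simp: F_def)
  have hom: "F \<in> star_hom (oper_algebra K M) (matrix_algebra n)"
  proof -
    have "F (x o\<^sub>L y) = F x * F y" if xy: "x \<in> M" "y \<in> M" for x y
    proof (rule F_eqI)
      show "F x * F y \<in> carrier_mat n n"
        by (rule mult_carrier_mat[OF F_carrier F_carrier])
      fix i j assume ij: "i < n" "j < n"
      have "adj (v i) o\<^sub>L ((x o\<^sub>L y) o\<^sub>L v j) = adj (v i) o\<^sub>L (x o\<^sub>L ((\<Sum>k<n. v k o\<^sub>L adj (v k)) o\<^sub>L (y o\<^sub>L v j)))"
        unfolding sum_vv using xy ij by (simp add: one_compose M_compose v(1) blinfun_compose_assoc)
      also have "\<dots> = (\<Sum>k<n. (adj (v i) o\<^sub>L (x o\<^sub>L v k)) o\<^sub>L (adj (v k) o\<^sub>L (y o\<^sub>L v j)))"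
        by (simp add: compose_sum_left compose_sum_right blinfun_compose_assoc)
      also have "\<dots> = (\<Sum>k<n. (X x i k * X y k j) *\<^sub>C p)"
        using ij by (intro sum.cong) (simp_all add: X xy compose_scaleC_left compose_scaleC_right
            proj_clinear minp pD scaleC_scaleC)
      also have "\<dots> = (\<Sum>k<n. X x i k * X y k j) *\<^sub>C p"
        by (simp add: complex_vector.scale_sum_left)
      finally have "X (x o\<^sub>L y) i j = (\<Sum>k<n. X x i k * X y k j)"
        using xy ij by (intro X_eqI) (simp_all add: M_compose)
      also have "\<dots> = (F x * F y) $$ (i, j)"
        using ij by (simp add: F_def lessThan_atLeast0 Matrix.scalar_prod_def)
      finally show "X (x o\<^sub>L y) i j = (F x * F y) $$ (i, j)" .
    qed
    moreover have "F (x + y) = F x + F y" if xy: "x \<in> M" "y \<in> M" for x y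
    proof (rule F_eqI)
      fix i j assume ij: "i < n" "j < n"
      have "X (x + y) i j = X x i j + X y i j"
        using xy ij by (intro X_eqI) (simp_all add: M_add compose_distrib X scaleC_add_left)
      then show "X (x + y) i j = (F x + F y) $$ (i, j)"
        using ij by (simp add: F_def)
    qed (simp add: F_def)
    moreover have "F (id_on K) = 1\<^sub>m n"
    proof (rule F_eqI)
      fix i j assume ij: "i < n" "j < n"
      have "X (id_on K) i j = (if i = j then 1 else 0)"
        using ij by (intro X_eqI) (simp_all add: M_one one_compose v vv)
      then show "X (id_on K) i j = 1\<^sub>m n $$ (i, j)"
        using ij by simp
    qed simp
    moreover have "F (c *\<^sub>C x) = c \<cdot>\<^sub>m F x" if x: "x \<in> M" for c x
    proof (rule F_eqI)
      fix i j assume ij: "i < n" "j < n"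
      have "X (c *\<^sub>C x) i j = c * X x i j"
        using x ij by (intro X_eqI)
          (simp_all add: M_scaleC compose_scaleC_left compose_scaleC_right clinear_adj v_cl X scaleC_scaleC)
      then show "X (c *\<^sub>C x) i j = (c \<cdot>\<^sub>m F x) $$ (i, j)"
        using ij by (simp add: F_def)
    qed (simp add: F_def)
    moreover have "F (adj x) = mat_adjoint (F x)" if x: "x \<in> M" for x
    proof (rule F_eqI)
      fix i j assume ij: "i < n" "j < n"
      note cl = M_clinear[OF x] v_cl[OF ij(1)] v_cl[OF ij(2)]
      have "adj (v i) o\<^sub>L (adj x o\<^sub>L v j) = adj (adj (v j) o\<^sub>L (x o\<^sub>L v i))"
        by (simp add: adj_compose clinear_compose clinear_adj cl adj_adj blinfun_compose_assoc)
      also have "\<dots> = cnj (X x j i) *\<^sub>C p"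
        by (simp add: X x ij adj_scaleC proj_clinear minp pD)
      finally have "X (adj x) i j = cnj (X x j i)"
        using x ij by (intro X_eqI adj_M)
      then show "X (adj x) i j = mat_adjoint (F x) $$ (i, j)"
        using ij by (simp add: mat_adjoint_index[OF F_carrier] F_index)
    qed (rule mat_adjoint_carrier[OF F_carrier])
    ultimately show ?thesis
      using F_carrier by (auto simp: star_hom_def Ring.ring_hom_def oper_algebra_def matrix_algebra_def)
  qed
  have "bij_betw F M (carrier_mat n n)"
    unfolding bij_betw_def
  proof
    show "inj_on F M"
    proof (rule inj_onI)
      fix x y assume xy: "x \<in> M" "y \<in> M" "F x = F y"
      have "X x i j = X y i j" if "i < n" "j < n" for i j
        using xy(3) F_index[OF that] by metis
      then have "(\<Sum>i<n. \<Sum>j<n. X x i j *\<^sub>C (v i o\<^sub>L adj (v j))) = (\<Sum>i<n. \<Sum>j<n. X y i j *\<^sub>C (v i o\<^sub>L adj (v j)))"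
        by (intro sum.cong) auto
      then show "x = y"
        using recon[OF xy(1)] recon[OF xy(2)] by simp
    qed
    show "F ` M = carrier_mat n n"
    proof
      show "F ` M \<subseteq> carrier_mat n n"
        using F_carrier by blast
      show "carrier_mat n n \<subseteq> F ` M"
      proof
        fix A :: "complex mat" assume A: "A \<in> carrier_mat n n"
        define x where "x = (\<Sum>i<n. \<Sum>j<n. A $$ (i, j) *\<^sub>C (v i o\<^sub>L adj (v j)))"
        have x: "x \<in> M"
          unfolding x_def by (intro M_sum M_scaleC M_compose v va) auto
        have "F x = A"
        proof (rule F_eqI[OF A], rule X_eqI[OF x])
          fix k l assume kl: "k < n" "l < n"
          have "adj (v k) o\<^sub>L (x o\<^sub>L v l) =
            (\<Sum>i<n. \<Sum>j<n. A $$ (i, j) *\<^sub>C ((adj (v k) o\<^sub>L v i) o\<^sub>L (adj (v j) o\<^sub>L v l)))"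
            unfolding x_def compose_sum_left compose_sum_right
            by (simp add: compose_scaleC_left compose_scaleC_right clinear_adj v_cl kl blinfun_compose_assoc)
          also have "\<dots> = (\<Sum>i<n. \<Sum>j<n. if j = l then if i = k then A $$ (k, l) *\<^sub>C p else 0 else 0)"
            using kl by (intro sum.cong refl) (auto simp: vv pD)
          also have "\<dots> = A $$ (k, l) *\<^sub>C p"
            using kl by simp
          finally show "adj (v k) o\<^sub>L (x o\<^sub>L v l) = A $$ (k, l) *\<^sub>C p" .
        qed
        then show "A \<in> F ` M"
          using x by blast
      qed
    qed
  qed
  then have "star_isomorphic (oper_algebra K M) (matrix_algebra n)"
    unfolding star_isomorphic_def
    by (intro bexI[OF _ hom]) (simp add: oper_algebra_def matrix_algebra_def)
  then show ?thesis
    using n by (intro exI[of _ n]) simp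
qed

end

section \<open>Direct sum decompositions\<close>

text \<open>For central \<open>z\<close>, the condition \<open>a z = a\<close> also gives
  \<open>z a = a\<close>, so the one-sided form describes \<open>z M z\<close>.\<close>

definition corner :: "'h::complex_hilbert_space oper set \<Rightarrow> 'h oper \<Rightarrow> 'h oper set" where
  "corner M z = {a \<in> M. a o\<^sub>L z = a}"

lemma corner_iff: "a \<in> corner M z \<longleftrightarrow> a \<in> M \<and> a o\<^sub>L z = a"
  by (simp add: corner_def)

text \<open>By Pythagoras the squared norms of finite partial sums increase and are bounded, so the
  net over finite subsets is Cauchy.\<close>

lemma orthogonal_sum_convergent:
  fixes u :: "'i \<Rightarrow> 'h::complex_hilbert_space"
  assumes orth: "\<And>i j. i \<in> I \<Longrightarrow> j \<in> I \<Longrightarrow> i \<noteq> j \<Longrightarrow> cinner (u i) (u j) = 0"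
    and bound: "\<And>F. finite F \<Longrightarrow> F \<subseteq> I \<Longrightarrow> (\<Sum>i\<in>F. (norm (u i))\<^sup>2) \<le> C"
  shows "\<exists>l. (sum u \<longlongrightarrow> l) (finite_subsets_at_top I)"
proof -
  define g where "g F = (\<Sum>i\<in>F. (norm (u i))\<^sup>2)" for F
  have pyth: "(norm (sum u F))\<^sup>2 = g F" if "finite F" "F \<subseteq> I" for F
    using that
  proof (induction F rule: finite_induct)
    case (insert x F)
    have "cinner (u x) (sum u F) = 0"
      unfolding cinner.sum_right using insert by (intro sum.neutral) (auto intro!: orth)
    then show ?case
      using insert by (simp add: norm_add_orthogonal g_def)
  qed (simp add: g_def)
  define A where "A = {F. finite F \<and> F \<subseteq> I}"
  have bdd: "bdd_above (g ` A)"
    using bound by (intro bdd_aboveI2[of _ _ C]) (auto simp: A_def g_def)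
  have ne: "A \<noteq> {}"
    by (auto simp: A_def)
  have "cauchy_filter (filtermap (sum u) (finite_subsets_at_top I))"
    unfolding cauchy_filter_metric_filtermap
  proof (intro allI impI)
    fix e :: real assume e: "0 < e"
    then have "(SUP F\<in>A. g F) - (e/3)\<^sup>2 < (SUP F\<in>A. g F)"
      by simp
    then obtain F0 where F0: "F0 \<in> A" "(SUP F\<in>A. g F) - (e/3)\<^sup>2 < g F0"
      using less_cSUP_iff[OF ne bdd] by blast
    have near: "norm (sum u F - sum u F0) \<le> e/3" if F: "finite F" "F0 \<subseteq> F" "F \<subseteq> I" for F
    proof -
      have split: "sum w F = sum w F0 + sum w (F - F0)" for w :: "'i \<Rightarrow> 'b::comm_monoid_add"
        using sum.subset_diff[OF F(2,1), of w] by (simp add: add.commute)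
      have "g F \<le> (SUP F\<in>A. g F)"
        using F by (intro cSUP_upper bdd) (simp add: A_def)
      moreover have "(norm (sum u (F - F0)))\<^sup>2 = g F - g F0"
        using F pyth[of "F - F0"] by (auto simp: g_def split[of "\<lambda>i. (norm (u i))\<^sup>2"])
      ultimately have "(norm (sum u F - sum u F0))\<^sup>2 \<le> (e/3)\<^sup>2"
        using F0(2) by (simp add: split[of u])
      then show ?thesis
        by (rule power2_le_imp_le) (use e in simp)
    qed
    show "\<exists>P. eventually P (finite_subsets_at_top I) \<and> (\<forall>F G. P F \<and> P G \<longrightarrow> dist (sum u F) (sum u G) < e)"
    proof (intro exI conjI allI impI)
      show "eventually (\<lambda>F. norm (sum u F - sum u F0) \<le> e/3) (finite_subsets_at_top I)"
        unfolding eventually_finite_subsets_at_top using F0(1) near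
        by (intro exI[of _ F0]) (auto simp: A_def)
      fix F G assume "norm (sum u F - sum u F0) \<le> e/3 \<and> norm (sum u G - sum u F0) \<le> e/3"
      then show "dist (sum u F) (sum u G) < e"
        using dist_triangle2[of "sum u F" "sum u G" "sum u F0"] e by (simp add: dist_norm)
    qed
  qed
  then show ?thesis
    by (rule cauchy_filter_filtermap_imp_tendsto) simp
qed

section \<open>Central corners, and decomposition along orthogonal central projections\<close>

context vn
begin

lemma norm_proj_le: "p \<in> projections M \<Longrightarrow> norm (p x) \<le> norm x"
proof -
  assume p: "p \<in> projections M"
  have "(norm (p x))\<^sup>2 \<le> norm (p x) * norm x"
    unfolding qform_proj[OF p, symmetric] qform_def
    by (rule order_trans[OF complex_Re_le_cmod cmod_cinner_le])
  then show ?thesis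
    by (cases "p x = 0") (auto simp: power2_eq_square)
qed

lemma center_proj:
  assumes "z \<in> projections (center M)"
  shows "z \<in> projections M" "z \<in> center M" "closed_csubspace (range z)" "z = id_on (range z)"
    "\<And>a. a \<in> M \<Longrightarrow> z o\<^sub>L a = a o\<^sub>L z" "range z \<subseteq> K" "\<And>x. z (z x) = z x"
proof -
  show z: "z \<in> projections M" "z \<in> center M"
    using assms center_subset by (auto simp: projections_def)
  show "closed_csubspace (range z)" "z = id_on (range z)"
    using projection_eq_id_on[OF proj_clinear[OF z(1)]] projectionsD[OF z(1)] by auto
  show "z o\<^sub>L a = a o\<^sub>L z" if "a \<in> M" for a
    using z(2) that by (simp add: center_def)
  show "range z \<subseteq> K"
    using bo_in[OF M_bo[OF projectionsD(1)[OF z(1)]]] by blast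
  show "z (z x) = z x" for x
    by (rule compose_apply[OF projectionsD(2)[OF z(1)]])
qed

text \<open>For \<open>c\<close> in \<open>Mc\<close>, the compression \<open>c z\<close> commutes
  with the corner. An element \<open>b\<close> of the double commutant taken on
  \<open>range z\<close> therefore commutes with \<open>c z\<close>, and
  \<open>b = b z = z b\<close> turns this into commuting with \<open>c\<close>.\<close>

lemma vn_corner:
  assumes z: "z \<in> projections (center M)" "z \<noteq> 0"
  shows "vn (range z) (corner M z)"
proof (rule vn.intro)
  note zp = center_proj[OF z(1)]
  let ?V = "range z"
  have zM: "z \<in> M"
    using zp(1) by (simp add: projections_def)
  have zMc: "z \<in> Mc"
    using zp(2) by (simp add: center_eq)
  have orth_sub: "x \<in> orth_compl ?V" if "x \<in> orth_compl K" for x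
    using that zp(6) by (auto simp: orth_compl_def)
  have bo_mono: "b \<in> bounded_ops K" if "b \<in> bounded_ops ?V" for b
    using that zp(6) orth_sub unfolding bounded_ops_iff by blast
  have zero: "z x = 0" if "x \<in> orth_compl ?V" for x
    using id_on_zero[OF zp(3) that] zp(4) by simp
  have bo: "a \<in> bounded_ops ?V" if a: "a \<in> corner M z" for a
  proof -
    have aM: "a \<in> M" "a o\<^sub>L z = a"
      using a by (auto simp: corner_iff)
    have "z o\<^sub>L a = a"
      using zp(5)[OF aM(1)] aM by simp
    then have "a x \<in> ?V" for x
      by (metis compose_apply rangeI)
    moreover have "a x = 0" if "x \<in> orth_compl ?V" for x
      using compose_apply[OF aM(2), of x] zero[OF that] by (simp add: blinfun.zero_right)
    ultimately show ?thesis
      by (simp add: bounded_ops_iff M_clinear aM)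
  qed
  have "?V \<noteq> {0}"
  proof
    assume "?V = {0}"
    then have "z = 0"
      by (intro blinfun_eqI) auto
    then show False
      using z by simp
  qed
  moreover have "adj a \<in> corner M z" if "a \<in> corner M z" for a
  proof -
    have aM: "a \<in> M" "a o\<^sub>L z = a"
      using that by (auto simp: corner_iff)
    then have "z o\<^sub>L a = a"
      using zp(5) by simp
    then have "adj a o\<^sub>L z = adj a"
      using adj_compose[OF proj_clinear[OF zp(1)] M_clinear[OF aM(1)]] projectionsD(3)[OF zp(1)] by simp
    then show ?thesis
      by (simp add: corner_iff adj_M aM)
  qed
  moreover have "commutant ?V (commutant ?V (corner M z)) \<subseteq> corner M z"
  proof
    fix b assume b: "b \<in> commutant ?V (commutant ?V (corner M z))"
    then have bV: "b \<in> bounded_ops ?V"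
      by (simp add: commutant_iff)
    have bz: "b o\<^sub>L z = b" "z o\<^sub>L b = b"
      using bo_id_right[OF zp(3) bV] bo_id_left[OF zp(3) bV] zp(4) by simp_all
    have "b \<in> M"
    proof (rule MI[OF bo_mono[OF bV]])
      fix c assume c: "c \<in> Mc"
      have cz: "z o\<^sub>L c = c o\<^sub>L z"
        by (rule Mc_commute[OF zM c])
      have "c (z x) \<in> ?V" for x
        using compose_apply[OF cz, of x] by (metis blinfun_apply_blinfun_compose rangeI)
      then have "c o\<^sub>L z \<in> bounded_ops ?V"
        using zero clinear_compose[OF bo_clinear[OF Mc_bo[OF c]] M_clinear[OF zM]]
        by (auto simp: bounded_ops_iff blinfun.zero_right)
      moreover have "a o\<^sub>L (c o\<^sub>L z) = (c o\<^sub>L z) o\<^sub>L a" if a: "a \<in> corner M z" for a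
      proof -
        have aM: "a \<in> M" "a o\<^sub>L z = a" "z o\<^sub>L a = a"
          using a zp(5)[of a] by (auto simp: corner_iff)
        have "a o\<^sub>L (c o\<^sub>L z) = c o\<^sub>L (a o\<^sub>L z)"
          by (simp add: Mc_commute[OF aM(1) c] flip: blinfun_compose_assoc)
        also have "\<dots> = c o\<^sub>L (z o\<^sub>L a)"
          by (simp add: aM)
        finally show ?thesis
          by (simp add: blinfun_compose_assoc)
      qed
      ultimately have "c o\<^sub>L z \<in> commutant ?V (corner M z)"
        by (simp add: commutant_iff)
      then have "(c o\<^sub>L z) o\<^sub>L b = b o\<^sub>L (c o\<^sub>L z)"
        using b by (simp add: commutant_iff)
      then have "c o\<^sub>L b = b o\<^sub>L (z o\<^sub>L c)"
        by (simp add: blinfun_compose_assoc bz cz)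
      then show "c o\<^sub>L b = b o\<^sub>L c"
        by (simp add: bz flip: blinfun_compose_assoc)
    qed
    then show "b \<in> corner M z"
      by (simp add: corner_iff bz)
  qed
  moreover have "corner M z \<subseteq> commutant ?V (commutant ?V (corner M z))"
    by (rule bicommutant_superset) (use bo in blast)
  moreover have "corner M z \<subseteq> bounded_ops ?V"
    using bo by blast
  ultimately show "von_neumann_algebra (range z) (corner M z)"
    using zp(3) by (simp add: von_neumann_algebra_def subset_antisym)
qed

text \<open>For \<open>b\<close> in \<open>M\<close> the element \<open>b z\<close> is in the
  corner, so a central \<open>a\<close> of the corner commutes with it; \<open>a z = z a = a\<close>
  then removes the \<open>z\<close>.\<close>

lemma center_corner:
  assumes z: "z \<in> projections (center M)"
  shows "center (corner M z) = corner (center M) z"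
proof
  note zp = center_proj[OF z]
  have zM: "z \<in> M"
    using zp(1) by (simp add: projections_def)
  show "corner (center M) z \<subseteq> center (corner M z)"
    by (auto simp: corner_iff center_def)
  show "center (corner M z) \<subseteq> corner (center M) z"
  proof
    fix a assume a: "a \<in> center (corner M z)"
    then have aM: "a \<in> M" "a o\<^sub>L z = a" "z o\<^sub>L a = a"
      using zp(5)[of a] by (auto simp: corner_iff center_def)
    have "a o\<^sub>L b = b o\<^sub>L a" if b: "b \<in> M" for b
    proof -
      have "b o\<^sub>L z \<in> corner M z"
        using M_compose[OF b zM] by (simp add: corner_iff blinfun_compose_assoc projectionsD[OF zp(1)])
      then have "a o\<^sub>L (b o\<^sub>L z) = (b o\<^sub>L z) o\<^sub>L a"
        using a by (simp add: center_def)
      then have "a o\<^sub>L (z o\<^sub>L b) = b o\<^sub>L (z o\<^sub>L a)"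
        by (simp add: zp(5)[OF b] blinfun_compose_assoc)
      then show ?thesis
        by (simp add: aM) (simp add: aM flip: blinfun_compose_assoc)
    qed
    then show "a \<in> corner (center M) z"
      by (simp add: corner_iff center_def aM)
  qed
qed

text \<open>The isomorphism sends \<open>a\<close> to the family of the \<open>a z\<close>. Totality
  of the ranges gives injectivity. A bounded family is the image of the strong limit of its finite
  partial sums, which exists by orthogonality and stays in \<open>M\<close>.\<close>

lemma direct_sum_decomposition:
  assumes I: "I \<subseteq> projections (center M)" and orth: "\<And>z w. z \<in> I \<Longrightarrow> w \<in> I \<Longrightarrow> z \<noteq> w \<Longrightarrow> z o\<^sub>L w = 0"
    and total: "ccspan (\<Union>z\<in>I. range (blinfun_apply z)) = K"
  shows "star_isomorphic (oper_algebra K M) (linf_direct_sum I (\<lambda>z. range (blinfun_apply z)) (corner M))"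
proof -
  define f where "f a = (\<lambda>z\<in>I. a o\<^sub>L z)" for a :: "'h oper"
  have zp: "z \<in> projections M" "z \<in> M" "z o\<^sub>L z = z" "adj z = z" "clinear_op z" "id_on (range z) = z"
    and comm: "a \<in> M \<Longrightarrow> z o\<^sub>L a = a o\<^sub>L z" if "z \<in> I" for z a
    using center_proj[OF subsetD[OF I that]] by (auto simp: projections_def M_clinear)
  have corner: "a o\<^sub>L z \<in> corner M z" if "a \<in> M" "z \<in> I" for a z
    using that by (simp add: corner_iff M_compose zp blinfun_compose_assoc)
  have norm_le: "norm (a o\<^sub>L z) \<le> norm a" if z: "z \<in> I" for a z
  proof (rule norm_blinfun_bound)
    fix x
    show "norm ((a o\<^sub>L z) x) \<le> norm a * norm x"
      using norm_blinfun[of a "z x"] mult_left_mono[OF norm_proj_le[OF zp(1)[OF z], of x] norm_ge_zero[of a]]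
      by simp
  qed simp
  let ?S = "linf_direct_sum I (\<lambda>z. range (blinfun_apply z)) (corner M)"
  have carrier_S: "carrier ?S = {x \<in> Pi\<^sub>E I (corner M). \<exists>C. \<forall>i\<in>I. norm (x i) \<le> C}"
    by (simp add: linf_direct_sum_def)
  have f_carrier: "f a \<in> carrier ?S" if a: "a \<in> M" for a
    unfolding carrier_S using corner[OF a] norm_le by (auto simp: f_def)
  have hom: "f \<in> star_hom (oper_algebra K M) ?S"
  proof -
    have "(a o\<^sub>L b) o\<^sub>L z = (a o\<^sub>L z) o\<^sub>L (b o\<^sub>L z)" if "a \<in> M" "b \<in> M" "z \<in> I" for a b z
      using comm[OF that(3,2)] zp(3)[OF that(3)] by (metis blinfun_compose_assoc)
    moreover have "adj a o\<^sub>L z = adj (a o\<^sub>L z)" if "a \<in> M" "z \<in> I" for a z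
      using comm[OF that(2) adj_M[OF that(1)]] by (simp add: adj_compose M_clinear that zp)
    moreover have "id_on K o\<^sub>L z = id_on (range z)" if "z \<in> I" for z
      by (simp add: one_compose zp that)
    ultimately show ?thesis
      using f_carrier
      by (auto simp: star_hom_def Ring.ring_hom_def oper_algebra_def linf_direct_sum_def f_def fun_eq_iff
          restrict_def compose_add_left compose_scaleC_left)
  qed
  have eq_zero: "a = 0" if a: "a \<in> M" "\<And>z. z \<in> I \<Longrightarrow> a o\<^sub>L z = 0" for a
  proof -
    have "(\<Union>z\<in>I. range (blinfun_apply z)) \<subseteq> {x. a x = 0}"
      using compose_apply[OF a(2)] by auto
    then have "K \<subseteq> {x. a x = 0}"
      unfolding total[symmetric] by (rule ccspan_minimal[OF _ closed_csubspace_kernel[OF M_clinear[OF a(1)]]])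
    then show ?thesis
      by (intro bo_eqI[OF K M_bo[OF a(1)] bo_zero[OF K]]) auto
  qed
  have inj: "inj_on f M"
  proof (rule inj_onI)
    fix a b assume ab: "a \<in> M" "b \<in> M" "f a = f b"
    have "a o\<^sub>L z = b o\<^sub>L z" if "z \<in> I" for z
      using fun_cong[OF ab(3), of z] that by (simp add: f_def)
    then have "a - b = 0"
      by (intro eq_zero[OF M_diff[OF ab(1,2)]]) (simp add: compose_distrib)
    then show "a = b"
      by simp
  qed
  have surj: "\<exists>a\<in>M. f a = x" if x: "x \<in> carrier ?S" for x
  proof -
    have xc: "x z \<in> M" "x z o\<^sub>L z = x z" "z o\<^sub>L x z = x z" if "z \<in> I" for z
      using x that comm[OF that, of "x z"] unfolding carrier_S by (auto simp: corner_iff dest!: PiE_mem)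
    obtain C0 where C0: "\<And>z. z \<in> I \<Longrightarrow> norm (x z) \<le> C0"
      using x unfolding carrier_S by blast
    \<comment> \<open>The maximum makes the bound nonnegative, as squaring it requires.\<close>
    define C where "C = max C0 0"
    have C: "0 \<le> C" "\<And>z. z \<in> I \<Longrightarrow> norm (x z) \<le> C"
      using C0 by (auto simp: C_def intro: max.coboundedI1)
    have x_orth: "cinner (x z v) (x w v) = 0" if "z \<in> I" "w \<in> I" "z \<noteq> w" for z w v
    proof -
      have "cinner (x z v) (x w v) = cinner (z (x z v)) (w (x w v))"
        using compose_apply[OF xc(3)[OF that(1)]] compose_apply[OF xc(3)[OF that(2)]] by simp
      also have "\<dots> = cinner (x z v) (z (w (x w v)))"
        using cinner_adj[OF zp(5)[OF that(1)]] zp(4)[OF that(1)] by simp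
      finally show ?thesis
        using compose_apply[OF orth[OF that]] by (simp add: cinner.zero_right)
    qed
    \<comment> \<open>As \<open>x z v = x z (z v)\<close>, the terms are bounded through
      \<open>C \<parallel>z v\<parallel>\<close>, and Bessel's inequality controls the orthogonal
      vectors \<open>z v\<close>.\<close>
    have sq: "(\<Sum>z\<in>F. (norm (x z v))\<^sup>2) \<le> (C * norm v)\<^sup>2" if F: "finite F" "F \<subseteq> I" for F v
    proof -
      have "(\<Sum>z\<in>F. (norm (x z v))\<^sup>2) \<le> (\<Sum>z\<in>F. C\<^sup>2 * (norm (blinfun_apply z v))\<^sup>2)"
      proof (rule sum_mono)
        fix z assume "z \<in> F"
        then have z: "z \<in> I"
          using F by blast
        have "norm (x z v) \<le> norm (x z) * norm (z v)"
          using norm_blinfun[of "x z" "z v"] compose_apply[OF xc(2)[OF z]] by simp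
        also have "\<dots> \<le> C * norm (z v)"
          by (intro mult_right_mono C z) simp
        finally show "(norm (x z v))\<^sup>2 \<le> C\<^sup>2 * (norm (z v))\<^sup>2"
          using power_mono[of "norm (x z v)" "C * norm (z v)" 2] by (simp add: power_mult_distrib)
      qed
      also have "\<dots> = C\<^sup>2 * (\<Sum>z\<in>F. (norm (blinfun_apply z v))\<^sup>2)"
        by (simp add: sum_distrib_left)
      also have "(\<Sum>z\<in>F. (norm (blinfun_apply z v))\<^sup>2) \<le> (norm v)\<^sup>2"
      proof (rule orthogonal_components_sum_le[OF F(1)])
        fix z w assume zw: "z \<in> F" "w \<in> F" "z \<noteq> w"
        then have "cinner (z v) (w v) = cinner v (z (w v))"
          using F cinner_adj[OF zp(5)] zp(4) by (metis subsetD)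
        moreover have "z (w v) = (0 :: 'h oper) v"
          using zw F by (intro compose_apply orth) auto
        ultimately show "cinner (z v) (w v) = 0"
          by (simp add: cinner.zero_right)
      next
        fix z assume "z \<in> F"
        then have z: "z \<in> I"
          using F by blast
        have "cinner (z v) v = cinner (z (z v)) v"
          using compose_apply[OF zp(3)[OF z]] by simp
        also have "\<dots> = cinner (z v) (z v)"
          using cinner_adj[OF zp(5)[OF z]] zp(4)[OF z] by simp
        finally show "cinner (z v) v = of_real ((norm (z v))\<^sup>2)"
          by (simp only: cinner_same)
      qed
      finally show ?thesis
        by (simp add: power_mult_distrib mult_left_mono)
    qed
    let ?F = "finite_subsets_at_top I"
    have "\<exists>l. ((\<lambda>F. \<Sum>z\<in>F. x z v) \<longlongrightarrow> l) ?F" for v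
      by (rule orthogonal_sum_convergent[OF x_orth sq])
    then have "\<forall>v. \<exists>l. ((\<lambda>F. \<Sum>z\<in>F. x z v) \<longlongrightarrow> l) ?F"
      by blast
    from choice[OF this] obtain g where g: "\<forall>v. ((\<lambda>F. \<Sum>z\<in>F. x z v) \<longlongrightarrow> g v) ?F" ..
    have bot: "?F \<noteq> bot"
      by simp
    have "bounded_linear g"
    proof (rule bounded_linear_intro)
      show "g (v + w) = g v + g w" for v w
      proof -
        have "((\<lambda>F. (\<Sum>z\<in>F. x z v) + (\<Sum>z\<in>F. x z w)) \<longlongrightarrow> g v + g w) ?F"
          by (intro tendsto_intros g[rule_format])
        then show ?thesis
          unfolding sum.distrib[symmetric] blinfun.add_right[symmetric]
          by (rule tendsto_unique[OF bot g[rule_format]])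
      qed
      show "g (r *\<^sub>R v) = r *\<^sub>R g v" for r v
      proof -
        have "((\<lambda>F. r *\<^sub>R (\<Sum>z\<in>F. x z v)) \<longlongrightarrow> r *\<^sub>R g v) ?F"
          by (intro tendsto_intros g[rule_format])
        then show ?thesis
          unfolding scaleR_sum_right blinfun.scaleR_right[symmetric]
          by (rule tendsto_unique[OF bot g[rule_format]])
      qed
      show "norm (g v) \<le> norm v * C" for v
      proof (rule tendsto_upperbound[OF tendsto_norm[OF g[rule_format]] _ bot])
        show "\<forall>\<^sub>F F in ?F. norm (\<Sum>z\<in>F. x z v) \<le> norm v * C"
          unfolding eventually_finite_subsets_at_top
        proof (intro exI[of _ "{}"] conjI allI impI)
          fix F assume F: "finite F \<and> {} \<subseteq> F \<and> F \<subseteq> I"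
          have "(norm (\<Sum>z\<in>F. x z v))\<^sup>2 = (\<Sum>z\<in>F. (norm (x z v))\<^sup>2)"
          proof -
            have "finite F" "F \<subseteq> I"
              using F by auto
            then show ?thesis
            proof (induction F rule: finite_induct)
              case (insert w F)
              have "cinner (x w v) (\<Sum>z\<in>F. x z v) = 0"
                unfolding cinner.sum_right using insert by (intro sum.neutral) (auto intro!: x_orth)
              then show ?case
                using insert by (simp add: norm_add_orthogonal)
            qed simp
          qed
          also have "\<dots> \<le> (norm v * C)\<^sup>2"
            using sq[of F v] F by (simp add: mult.commute)
          finally show "norm (\<Sum>z\<in>F. x z v) \<le> norm v * C"
            by (rule power2_le_imp_le) (use C in simp)
        qed simp_all
      qed
    qed
    define a where "a = Blinfun g"
    have a: "((\<lambda>F. (\<Sum>z\<in>F. x z v)) \<longlongrightarrow> a v) ?F" for v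
      using g \<open>bounded_linear g\<close> by (simp add: a_def bounded_linear_Blinfun_apply)
    have aM: "a \<in> M"
    proof (rule M_lim[OF bot])
      \<comment> \<open>Intersecting with \<open>I\<close> makes every index admissible for
        \<open>M_lim\<close>; eventually along the filter it changes nothing.\<close>
      show "(\<Sum>z\<in>F \<inter> I. x z) \<in> M" for F
        by (intro M_sum xc) simp
      show "((\<lambda>F. (\<Sum>z\<in>F \<inter> I. x z) v) \<longlongrightarrow> a v) ?F" for v
      proof (rule Lim_transform_eventually[OF a])
        show "\<forall>\<^sub>F F in ?F. (\<Sum>z\<in>F. x z v) = (\<Sum>z\<in>F \<inter> I. x z) v"
          unfolding eventually_finite_subsets_at_top
          by (intro exI[of _ "{}"]) (auto simp: blinfun.sum_left Int_absorb2)
      qed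
    qed
    have a_eq: "a o\<^sub>L w = x w" if w: "w \<in> I" for w
    proof (rule blinfun_eqI)
      fix v
      have "x z (w v) = 0" if "z \<in> I" "z \<noteq> w" for z
        using compose_apply[OF xc(2)[OF that(1)], of "w v"] compose_apply[OF orth[OF that(1) w that(2)], of v]
        by (simp add: blinfun.zero_right)
      moreover have "x w (w v) = x w v"
        by (rule compose_apply[OF xc(2)[OF w]])
      ultimately have "(\<Sum>z\<in>F. x z (w v)) = x w v" if "finite F" "w \<in> F" "F \<subseteq> I" for F
        using that by (subst sum.remove[of F w]) (auto intro!: sum.neutral)
      then have "\<forall>\<^sub>F F in ?F. (\<Sum>z\<in>F. x z (w v)) = x w v"
        unfolding eventually_finite_subsets_at_top using w by (intro exI[of _ "{w}"]) auto
      from Lim_transform_eventually[OF a this] have "a (w v) = x w v"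
        by (simp add: tendsto_const_iff)
      then show "(a o\<^sub>L w) v = x w v"
        by simp
    qed
    have xE: "x \<in> Pi\<^sub>E I (corner M)"
      using x unfolding carrier_S by simp
    have "f a = x"
    proof
      fix z
      show "f a z = x z"
        by (cases "z \<in> I") (simp_all add: f_def a_eq PiE_arb[OF xE])
    qed
    with aM show ?thesis
      by blast
  qed
  have "bij_betw f M (carrier ?S)"
    using inj f_carrier surj by (auto simp: bij_betw_def)
  then show ?thesis
    unfolding star_isomorphic_def by (intro bexI[OF _ hom]) (simp add: oper_algebra_def)
qed

text \<open>The implication leaves exactly the two kinds of summands wanted: infinite-dimensional
  corners and finite-dimensional factors.\<close>

definition infinite_or_factor :: "'h oper \<Rightarrow> bool" where
  "infinite_or_factor z \<longleftrightarrow>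
     finite_dimensional (corner M z) \<longrightarrow> (\<forall>q\<in>projections (center (corner M z)). q = 0 \<or> q = z)"

text \<open>In an invariant subspace, a nonzero \<open>x\<close> serves if the corner of its central
  projection is infinite-dimensional. Otherwise a minimal central projection \<open>e\<close> lies
  below, and every nonzero vector of \<open>range e\<close> has central projection exactly
  \<open>e\<close>.\<close>

lemma infinite_or_factor_decomposition:
  "\<exists>E\<subseteq>K. (\<forall>x\<in>E. x \<noteq> 0 \<and> infinite_or_factor (id_on (cyc (commutant K (center M)) x))) \<and>
    (\<forall>x\<in>E. \<forall>y\<in>E. x \<noteq> y \<longrightarrow> (\<forall>a\<in>commutant K (center M). cinner (a x) y = 0)) \<and>
    ccspan {blinfun_apply a x |a x. a \<in> commutant K (center M) \<and> x \<in> E} = K"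
proof -
  let ?T = "commutant K (center M)"
  interpret Z: vn K "center M"
    by (rule vn_center)
  interpret ZC: vn K ?T
    by (rule Z.vn_Mc)
  have proj: "id_on (cyc ?T x) \<in> projections (center M)" for x
    using ZC.id_on_cyc Z.bicommutant by (intro Z.id_on_proj closed_csubspace_cyc) simp
  show ?thesis
  proof (rule ZC.total_family_ex)
    fix V assume V: "closed_csubspace V" "V \<subseteq> K" "V \<noteq> {0}" and inv: "\<And>a x. a \<in> ?T \<Longrightarrow> x \<in> V \<Longrightarrow> a x \<in> V"
    obtain x where x: "x \<in> V" "x \<noteq> 0"
      using V csub_zero by blast
    define z where "z = id_on (cyc ?T x)"
    have z: "z \<in> projections (center M)"
      unfolding z_def by (rule proj)
    have xz: "z x = x"
      using x V ZC.self_in_cyc[of x] by (auto simp: z_def intro!: id_on_id closed_csubspace_cyc)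
    have zV: "range z \<subseteq> V"
      using ZC.cyc_minimal[OF V(1) x(1) inv] id_on_in[OF closed_csubspace_cyc] by (auto simp: z_def)
    show "\<exists>x\<in>V. x \<noteq> 0 \<and> infinite_or_factor (id_on (cyc ?T x))"
    proof (cases "finite_dimensional (corner M z)")
      case False
      then show ?thesis
        using x by (auto simp: infinite_or_factor_def z_def)
    next
      case True
      have z0: "z \<noteq> 0"
        using xz x by auto
      interpret N: vn "range z" "corner M z"
        by (rule vn_corner[OF z z0])
      interpret ZN: vn "range z" "center (corner M z)"
        by (rule N.vn_center)
      have famN: N.orth_families_finite
        using True N.finite_dimensional_iff by simp
      have "ZN.orth_families_finite"
        using famN N.center_subset unfolding N.orth_families_finite_def ZN.orth_families_finite_def by blast
      moreover have "z \<in> projections (center (corner M z))"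
        using z by (auto simp: center_corner[OF z] corner_iff projections_def)
      ultimately obtain e where e: "minimal_projection (center (corner M z)) e" "z o\<^sub>L e = e"
        using ZN.minimal_below[OF _ _ z0] by blast
      have eN: "e \<in> projections (center (corner M z))" "e \<noteq> 0"
        using e(1) by (auto simp: minimal_projection_def)
      then have eZ: "e \<in> projections (center M)" "e o\<^sub>L z = e"
        by (auto simp: center_corner[OF z] corner_iff projections_def)
      note ep = center_proj[OF eZ(1)]
      obtain y where y: "e y \<noteq> 0"
        using eN(2) by (metis blinfun_eqI zero_blinfun.rep_eq)
      define \<eta> where "\<eta> = e y"
      have \<eta>: "\<eta> \<noteq> 0" "\<eta> \<in> range e" "e \<eta> = \<eta>"
        using y ep(7) by (auto simp: \<eta>_def)
      have \<eta>V: "\<eta> \<in> V"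
        unfolding \<eta>_def using compose_apply[OF e(2), of y] zV by (metis rangeI subsetD)
      define q where "q = id_on (cyc ?T \<eta>)"
      have q: "q \<in> projections (center M)"
        unfolding q_def by (rule proj)
      have sub: "cyc ?T \<eta> \<subseteq> range e"
      proof (rule ZC.cyc_minimal[OF ep(3) \<eta>(2)])
        fix a v assume a: "a \<in> ?T" and "v \<in> range e"
        then obtain w where "v = e w"
          by blast
        then have "a v = e (a w)"
          using Z.Mc_commute_apply[OF ep(2) a] by simp
        then show "a v \<in> range e"
          by simp
      qed
      have eq: "e o\<^sub>L q = q"
      proof (rule blinfun_eqI)
        fix v
        have "q v \<in> range e"
          using sub id_on_in[OF closed_csubspace_cyc, of ?T \<eta> v] by (auto simp: q_def)
        then show "(e o\<^sub>L q) v = q v"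
          using ep(7) by auto
      qed
      have qe: "q o\<^sub>L e = q"
        using proj_le_commute[OF ep(1) center_proj(1)[OF q]] eq by simp
      have "q o\<^sub>L z = q"
        using qe eZ(2) by (metis blinfun_compose_assoc)
      then have "q \<in> projections (center (corner M z))"
        using q by (auto simp: center_corner[OF z] corner_iff projections_def)
      moreover have "q \<noteq> 0"
        using \<eta> ZC.self_in_cyc[of \<eta>] \<eta>V V id_on_id[OF closed_csubspace_cyc, of \<eta> ?T \<eta>] by (auto simp: q_def)
      ultimately have q_eq: "q = e"
        using e(1) eq by (auto simp: minimal_projection_def)
      have e0: "e \<noteq> 0"
        by (rule eN(2))
      interpret R: vn "range e" "corner M e"
        by (rule vn_corner[OF eZ(1) e0])
      have sub_corner: "corner M e \<subseteq> corner M z"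
        using eZ(2) by (auto simp: corner_iff) (metis blinfun_compose_assoc)
      have "R.orth_families_finite"
        using famN sub_corner unfolding N.orth_families_finite_def R.orth_families_finite_def by blast
      then have "finite_dimensional (corner M e)"
        by (simp add: R.finite_dimensional_iff)
      moreover have "r = 0 \<or> r = e" if r: "r \<in> projections (center (corner M e))" for r
      proof -
        have rZ: "r \<in> center M" "r o\<^sub>L e = r" "r o\<^sub>L r = r" "adj r = r"
          using r by (auto simp: center_corner[OF eZ(1)] corner_iff projections_def)
        have "r o\<^sub>L z = r"
          using rZ(2) eZ(2) by (metis blinfun_compose_assoc)
        then have "r \<in> projections (center (corner M z))"
          using rZ by (auto simp: center_corner[OF z] corner_iff projections_def)
        moreover have "e o\<^sub>L r = r"
          using rZ(1,2) ep(5)[of r] center_subset by auto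
        ultimately show ?thesis
          using e(1) by (auto simp: minimal_projection_def)
      qed
      ultimately have "infinite_or_factor q"
        by (simp add: infinite_or_factor_def q_eq)
      then show ?thesis
        using \<eta>(1) \<eta>V by (auto simp: q_def)
    qed
  qed
qed

text \<open>The vector \<open>x\<close> is cyclic in \<open>range z\<close> for the commutant of the
  center, so no nonzero central projection below \<open>z\<close> annihilates it; an orthogonal
  family meets \<open>x\<close> only countably often.\<close>

lemma sigma_finite_center_corner:
  assumes x: "x \<in> K" "x \<noteq> 0"
  defines "z \<equiv> id_on (cyc (commutant K (center M)) x)"
  shows "sigma_finite (center (corner M z))"
proof -
  let ?T = "commutant K (center M)"
  interpret Z: vn K "center M"
    by (rule vn_center)
  interpret ZC: vn K ?T
    by (rule Z.vn_Mc)
  have z: "z \<in> projections (center M)"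
    unfolding z_def using ZC.id_on_cyc Z.bicommutant by (intro Z.id_on_proj closed_csubspace_cyc) simp
  have xz: "z x = x"
    using x ZC.self_in_cyc[of x] by (auto simp: z_def intro!: id_on_id closed_csubspace_cyc)
  then have z0: "z \<noteq> 0"
    using x by auto
  interpret N: vn "range z" "corner M z"
    by (rule vn_corner[OF z z0])
  interpret ZN: vn "range z" "center (corner M z)"
    by (rule N.vn_center)
  obtain P where P: "P \<subseteq> center (corner M z)" "orthogonal_projections P" "dec (center (corner M z)) = |P|"
    by (rule ZN.dec_obtain) blast
  have PZ: "p \<in> center M" "p o\<^sub>L z = p" if "p \<in> P" for p
    using P(1) that by (auto simp: center_corner[OF z] corner_iff)
  have "p x \<noteq> 0" if p: "p \<in> P" for p
  proof
    assume px: "p x = 0"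
    have cl: "clinear_op p"
      using PZ(1)[OF p] center_subset M_clinear by blast
    have "cyc ?T x \<subseteq> {v. p v = 0}"
    proof (rule ZC.cyc_minimal[OF closed_csubspace_kernel[OF cl]])
      show "a v \<in> {v. p v = 0}" if "a \<in> ?T" "v \<in> {v. p v = 0}" for a v
        using Z.Mc_commute_apply[OF PZ(1)[OF p] that(1)] that(2) by (simp add: blinfun.zero_right)
    qed (simp add: px)
    then have "p (z v) = 0" for v
      using id_on_in[OF closed_csubspace_cyc] by (auto simp: z_def)
    then have "p = 0"
      using compose_apply[OF PZ(2)[OF p]] by (intro blinfun_eqI) simp
    then show False
      using P(2) p by (auto simp: orthogonal_projections_def)
  qed
  then have "P = {p \<in> P. blinfun_apply p x \<noteq> 0}"
    by blast
  then have "countable P"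
    using ZN.orthogonal_projections_countable_meet[OF P(1,2), of x] by simp
  then have "|P| \<le>o |UNIV :: nat set|"
    by (rule countable_card_le) simp
  also have "|UNIV :: nat set| =o natLeq"
    by (rule card_of_nat)
  finally show ?thesis
    by (simp add: sigma_finite_def P(3))
qed

lemma direct_sum_ex:
  "\<exists>(I :: 'h oper set) (Ks :: 'h oper \<Rightarrow> 'h set) (Ms :: 'h oper \<Rightarrow> 'h oper set).
    (\<forall>i\<in>I. von_neumann_algebra (Ks i) (Ms i)) \<and>
    star_isomorphic (oper_algebra K M) (linf_direct_sum I Ks Ms) \<and>
    (\<forall>i\<in>I. (\<exists>n\<ge>1. star_isomorphic (oper_algebra (Ks i) (Ms i)) (matrix_algebra n)) \<or>
       chi_r (Ks i) (Ms i) =o natLeq *c gen (Ks i) (Ms i))"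
proof -
  let ?T = "commutant K (center M)"
  interpret Z: vn K "center M"
    by (rule vn_center)
  interpret ZC: vn K ?T
    by (rule Z.vn_Mc)
  obtain E where E: "E \<subseteq> K" "\<forall>x\<in>E. x \<noteq> 0 \<and> infinite_or_factor (id_on (cyc ?T x))"
    "\<forall>x\<in>E. \<forall>y\<in>E. x \<noteq> y \<longrightarrow> (\<forall>a\<in>?T. cinner (a x) y = 0)"
    "ccspan {blinfun_apply a x |a x. a \<in> ?T \<and> x \<in> E} = K"
    using infinite_or_factor_decomposition by (elim exE conjE)
  define I where "I = (\<lambda>x. id_on (cyc ?T x)) ` E"
  have I: "I \<subseteq> center M" "orthogonal_projections I"
    using ZC.orthogonal_cyc_projections[of E] E unfolding I_def Z.bicommutant by blast+
  have IP: "I \<subseteq> projections (center M)" and I0: "\<And>z. z \<in> I \<Longrightarrow> z \<noteq> 0"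
    and orth: "\<And>z w. z \<in> I \<Longrightarrow> w \<in> I \<Longrightarrow> z \<noteq> w \<Longrightarrow> z o\<^sub>L w = 0"
    using I by (auto simp: orthogonal_projections_def projections_def)
  have "{blinfun_apply a x |a x. a \<in> ?T \<and> x \<in> E} \<subseteq> (\<Union>z\<in>I. range (blinfun_apply z))"
  proof
    fix v assume "v \<in> {blinfun_apply a x |a x. a \<in> ?T \<and> x \<in> E}"
    then obtain a x where v: "v = blinfun_apply a x" "a \<in> ?T" "x \<in> E"
      by blast
    have "v = id_on (cyc ?T x) v"
      using in_cyc[OF v(2), of x] by (simp add: v(1) id_on_id[OF closed_csubspace_cyc])
    then have "v \<in> range (id_on (cyc ?T x))"
      by (rule range_eqI)
    then show "v \<in> (\<Union>z\<in>I. range (blinfun_apply z))"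
      using v(3) unfolding I_def by blast
  qed
  from ccspan_mono[OF this] have "K \<subseteq> ccspan (\<Union>z\<in>I. range (blinfun_apply z))"
    by (simp only: E(4))
  moreover have "ccspan (\<Union>z\<in>I. range (blinfun_apply z)) \<subseteq> K"
    by (rule ccspan_minimal[OF _ K]) (use center_proj(6) IP in blast)
  ultimately have iso: "star_isomorphic (oper_algebra K M) (linf_direct_sum I (\<lambda>z. range (blinfun_apply z)) (corner M))"
    by (intro direct_sum_decomposition[OF IP orth]) auto
  have vn: "vn (range z) (corner M z)" if "z \<in> I" for z :: "'h oper"
    using vn_corner IP I0 that by blast
  have alt: "(\<exists>n\<ge>1. star_isomorphic (oper_algebra (range z) (corner M z)) (matrix_algebra n)) \<or>
      chi_r (range z) (corner M z) =o natLeq *c gen (range z) (corner M z)" if z: "z \<in> I" for z :: "'h oper"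
  proof -
    interpret N: vn "range z" "corner M z"
      using vn_corner IP I0 z by blast
    obtain x where x: "x \<in> E" "z = id_on (cyc ?T x)"
      using z by (auto simp: I_def)
    then have xK: "x \<in> K" "x \<noteq> 0" and good: "infinite_or_factor z"
      using E by auto
    show ?thesis
    proof (cases "finite_dimensional (corner M z)")
      case True
      have factor: "q = 0 \<or> q = id_on (range z)" if "q \<in> projections (center (corner M z))" for q
        using True good that center_proj(4)[OF subsetD[OF IP z]] by (auto simp: infinite_or_factor_def)
      show ?thesis
        by (rule disjI1[OF N.factor_star_isomorphic_matrix_algebra[OF factor True]])
    next
      case False
      \<comment> \<open>The infinite-dimensional summand has \<open>\<sigma>\<close>-finite center,
        so the equality in (3) applies to it.\<close>
      then show ?thesis
        using sigma_finite_center_corner[OF xK] x(2) by (intro disjI2 N.chi_r_sigma_finite_center(2)) simp_all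
    qed
  qed
  show ?thesis
    by (intro exI[of _ I] exI[of _ "\<lambda>z. range (blinfun_apply z)"] exI[of _ "corner M"] conjI ballI
        iso alt vn[unfolded vn_def])
qed

end

theorem proposition5p1:
  fixes K :: "'h::complex_hilbert_space set" and M :: "'h oper set"
  assumes "von_neumann_algebra K M"
  shows
    "(natLeq *c gen K M <o dec M \<longrightarrow> dec M =o dec (center M)) \<and>
     natLeq *c chi_r K M =o natLeq *c dec (center M) *c gen K M \<and>
     (sigma_finite (center M) \<longrightarrow>
        chi_r K M \<le>o natLeq *c gen K M \<and>
        (\<not> finite_dimensional M \<longrightarrow> chi_r K M =o natLeq *c gen K M)) \<and>
     (\<exists>(I :: 'h oper set) (Ks :: 'h oper \<Rightarrow> 'h set) (Ms :: 'h oper \<Rightarrow> 'h oper set).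
        (\<forall>i\<in>I. von_neumann_algebra (Ks i) (Ms i)) \<and>
        star_isomorphic (oper_algebra K M) (linf_direct_sum I Ks Ms) \<and>
        (\<forall>i\<in>I. (\<exists>n\<ge>1. star_isomorphic (oper_algebra (Ks i) (Ms i)) (matrix_algebra n)) \<or>
               chi_r (Ks i) (Ms i) =o natLeq *c gen (Ks i) (Ms i)))"
proof -
  interpret vn K M
    by (rule vn.intro[OF assms])
  show ?thesis
    using dec_eq_dec_center chi_r_eq chi_r_sigma_finite_center direct_sum_ex by blast
qed

end
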